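(* Let $b>0$ and let $\mathbf X=(X(t),\,t\in\mathbb R)$ be a centered stationary Gaussian process with continuous sample paths and covariance function $R_{\mathbf X}(t)=E[X(s)X(s+t)]$, $s,t\in\mathbb R$. Suppose that $R_{\mathbf X}$ is strictly convex on $[0,b]$. Let $T_*=\arg\min_{0\le t\le b}X(t)$. Then, as $u\to\infty$, $$P\Bigl(T_*\in\cdot\,\Big|\,\min_{0\le t\le b}X(t)>u\Bigr)\Rightarrow\nu_*,$$ where $\nu_*$ is the unique optimal probability measure for the optimization problem $$\min_{\nu\in M_1[0,b]}\int_{[0,b]}\int_{[0,b]}R_{\mathbf X}(t-s)\,\nu(ds)\,\nu(dt).$$
   Context: $M_1[0,b]$ denotes the set of all Borel probability measures on $[0,b]$; an optimal probability measure is one attaining the minimum. $T_*$ is the location of the minimum of the process on $[0,b]$, the leftmost location being chosen in case of ties. $\Rightarrow$ denotes weak convergence of probability measures on $[0,b]$.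
   Formalization: The convergence is stated under the added assumption that P(min X(t) > u) > 0 for all u; the written hypotheses allow processes (e.g. a periodic Brownian bridge minus its mean, b = 1) for which the conditioning event has probability zero and the conditional law is undefined. *)

theory Defs
  imports "HOL-Probability.Probability"
begin

text \<open>A process is a function \<open>X\<close> taking a time and then a sample point.\<close>

(* The normal law with mean m and standard deviation s \<ge> 0; for s = 0 it is the point mass at m. *)
definition gaussian_law :: "real \<Rightarrow> real \<Rightarrow> real measure" where
  "gaussian_law m s =
     (if s = 0 then return borel m else density lborel (\<lambda>x. ennreal (normal_density m s x)))"

(* All finite-dimensional distributions are (possibly degenerate) multivariate normal, i.e. every
   finite linear combination is normal; the covariance matrices are not required to be regular. *)
definition gaussian_process :: "'w measure \<Rightarrow> (real \<Rightarrow> 'w \<Rightarrow> real) \<Rightarrow> bool" where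
  "gaussian_process M X \<longleftrightarrow>
     prob_space M \<and> (\<forall>t. X t \<in> borel_measurable M) \<and>
     (\<forall>I a. finite I \<longrightarrow>
        (\<exists>m s. s \<ge> 0 \<and> distr M borel (\<lambda>\<omega>. \<Sum>t\<in>I. a t * X t \<omega>) = gaussian_law m s))"

definition centered_process :: "'w measure \<Rightarrow> (real \<Rightarrow> 'w \<Rightarrow> real) \<Rightarrow> bool" where
  "centered_process M X \<longleftrightarrow> (\<forall>t. integrable M (X t) \<and> (LINT \<omega>|M. X t \<omega>) = 0)"

definition stationary_process :: "'w measure \<Rightarrow> (real \<Rightarrow> 'w \<Rightarrow> real) \<Rightarrow> bool" where
  "stationary_process M X \<longleftrightarrow>
     (\<forall>I h. finite I \<longrightarrow>
        distr M (\<Pi>\<^sub>M t\<in>I. borel) (\<lambda>\<omega>. \<lambda>t\<in>I. X (t + h) \<omega>) =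
        distr M (\<Pi>\<^sub>M t\<in>I. borel) (\<lambda>\<omega>. \<lambda>t\<in>I. X t \<omega>))"

definition strictly_convex_on :: "real set \<Rightarrow> (real \<Rightarrow> real) \<Rightarrow> bool" where
  "strictly_convex_on S f \<longleftrightarrow>
     convex S \<and>
     (\<forall>x\<in>S. \<forall>y\<in>S. \<forall>c. x \<noteq> y \<and> 0 < c \<and> c < 1 \<longrightarrow>
        f ((1 - c) * x + c * y) < (1 - c) * f x + c * f y)"

definition min_on :: "real \<Rightarrow> (real \<Rightarrow> real) \<Rightarrow> real" where
  "min_on b f = (INF t\<in>{0..b}. f t)"

(* The leftmost location of the minimum. *)
definition argmin_on :: "real \<Rightarrow> (real \<Rightarrow> real) \<Rightarrow> real" where
  "argmin_on b f = (LEAST t. t \<in> {0..b} \<and> (\<forall>s\<in>{0..b}. f t \<le> f s))"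

(* Borel probability measures whose underlying space is [0,b] itself, not the real line. *)
definition prob_measures_on :: "real \<Rightarrow> real measure set" where
  "prob_measures_on b = {\<nu>. prob_space \<nu> \<and> sets \<nu> = sets (restrict_space borel {0..b})}"

definition energy :: "(real \<Rightarrow> real) \<Rightarrow> real measure \<Rightarrow> real" where
  "energy R \<nu> = (LINT t|\<nu>. (LINT s|\<nu>. R (t - s)))"

definition optimal_measure :: "real \<Rightarrow> (real \<Rightarrow> real) \<Rightarrow> real measure \<Rightarrow> bool" where
  "optimal_measure b R \<nu> \<longleftrightarrow> is_arg_min (energy R) (\<lambda>\<nu>. \<nu> \<in> prob_measures_on b) \<nu>"

definition exceed_event :: "'w measure \<Rightarrow> (real \<Rightarrow> 'w \<Rightarrow> real) \<Rightarrow> real \<Rightarrow> real \<Rightarrow> 'w set" where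
  "exceed_event M X b u = {\<omega> \<in> space M. min_on b (\<lambda>t. X t \<omega>) > u}"

(* The conditional law of the leftmost argmin on [0,b], given that the minimum exceeds u; as a
   conditional probability it is meaningful when the conditioning event has positive probability. *)
definition cond_argmin_law ::
    "'w measure \<Rightarrow> (real \<Rightarrow> 'w \<Rightarrow> real) \<Rightarrow> real \<Rightarrow> real \<Rightarrow> real measure" where
  "cond_argmin_law M X b u =
     distr (uniform_measure M (exceed_event M X b u)) (restrict_space borel {0..b})
       (\<lambda>\<omega>. argmin_on b (\<lambda>t. X t \<omega>))"

(* Weak convergence on the compact space [0,b] of a family with a real parameter u \<rightarrow> \<infinity>
   (the library's weak_conv_m is for sequences of measures on the whole line).  Test functions are
   continuous on [0,b], hence automatically bounded. *)
definition weakly_converges_on ::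
    "real \<Rightarrow> (real \<Rightarrow> real measure) \<Rightarrow> real measure \<Rightarrow> bool" where
  "weakly_converges_on b \<mu> \<nu> \<longleftrightarrow>
     (\<forall>f :: real \<Rightarrow> real. continuous_on {0..b} f \<longrightarrow>
        ((\<lambda>u. LINT t|\<mu> u. f t) \<longlongrightarrow> (LINT t|\<nu>. f t)) at_top)"

end

theory Submission
  imports Defs
begin

text \<open>Write \<open>m\<close> for the minimum of the path over \<open>[0,b]\<close>, \<open>T\<close> for its leftmost location, \<open>p(v) = P(m > v)\<close>,
\<open>\<nu>\<^sub>v\<close> for the law of \<open>T\<close> given \<open>m > v\<close>, \<open>K(\<mu>,\<nu>)\<close> for the double integral of \<open>R(t - s)\<close> and \<open>e(\<nu>) = K(\<nu>,\<nu>)\<close>.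

\<^bold>\<open>Existence and uniqueness.\<close> Existence is weak compactness. The energy need not be strictly convex: when \<open>R(b) = R(0)\<close>,
the point masses at \<open>0\<close> and \<open>b\<close> differ by a signed measure of energy zero. Strict convexity of \<open>R\<close> enters through a
rearrangement instead. Describe measures by quantile functions \<open>p\<close>, \<open>q\<close> on \<open>(0,1)\<close>. Since both are increasing,
\<open>p(v) - p(u)\<close> and \<open>q(v) - q(u)\<close> have the same sign, so only the half \<open>[0,b]\<close> of the kernel matters, where it is convex;
replacing \<open>p\<close>, \<open>q\<close> by their pointwise minimum and maximum lowers the total energy, strictly if they cross
(\<open>strictly_convex_rearrangement\<close>). The same holds for \<open>p\<close> and the translate \<open>q + \<delta>\<close>, so that the difference of the
quantile functions of two optimal measures is a constant (\<open>quantiles_do_not_cross\<close>, \<open>optimal_translate\<close>). In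
particular all optimal measures have the same variance. The midpoint of two optimal measures is optimal, because
\<open>R\<close> is positive semidefinite, but has a larger variance unless the means agree (\<open>optimal_unique\<close>).

\<^bold>\<open>The limit.\<close> Shifting the path by \<open>\<epsilon> R(\<cdot> - s)\<close> (\<open>cameron_martin\<close>) and
differentiating the minimum in \<open>\<epsilon>\<close> gives \<open>E[X\<^sub>s (m - v)\<^sup>+] = E[R(T - s); m > v]\<close> (\<open>integration_by_parts\<close>).
Hence \<open>p(v) \<cdot> \<integral> R(t - s) \<nu>\<^sub>v(ds) = E[X\<^sub>t (m - v)\<^sup>+]\<close>. With \<open>A(v) = E (m - v)\<^sup>+\<close> this has two consequences. Because \<open>X\<^sub>t \<ge> v\<close>
where \<open>m > v\<close>, every probability measure \<open>\<nu>\<close> satisfies \<open>K(\<nu>,\<nu>\<^sub>v) \<ge> v A(v) / p(v)\<close>. Integrating against \<open>\<nu>\<^sub>v\<close> with an independent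
copy \<open>X'\<close>, whose minimum is \<open>m'\<close>, gives \<open>e(\<nu>\<^sub>v) p(v)\<^sup>2 = E[X'(T) (m' - v)\<^sup>+; m > v]\<close>, where \<open>X'(T) \<le> m + \<parallel>X' - X\<parallel>\<close>. So
\<open>e(\<nu>\<^sub>v) \<le> K(\<nu>,\<nu>\<^sub>v) + o(1)\<close> once two independent paths that both exceed \<open>v\<close> are at distance \<open>o(v)\<close>.

For the latter, \<open>(X + X')/\<surd>2\<close> and \<open>(X' - X)/\<surd>2\<close> are again independent copies of \<open>X\<close> (\<open>rotation_invariance\<close>); if
\<open>m > v\<close>, \<open>m' > v\<close> and \<open>\<parallel>X' - X\<parallel> > \<delta>v\<close>, the first exceeds \<open>\<surd>2 v\<close> and the second has norm above \<open>\<delta>v/\<surd>2\<close>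
(\<open>discrepancy_bound\<close>). This costs \<open>p(\<surd>2 v)\<close> times a Gaussian tail (\<open>fernique\<close>). The same rotation gives
\<open>p(u) p(w) \<le> p(\<alpha>u + \<beta>w)\<close> for \<open>\<alpha>, \<beta> \<ge> 0\<close> with \<open>\<alpha>\<^sup>2 + \<beta>\<^sup>2 = 1\<close>, so \<open>- log p(v) / v\<^sup>2\<close> converges and \<open>p(\<surd>2 v) \<le> p(v)\<^sup>2 exp(o(v\<^sup>2))\<close>
(\<open>supermultiplicative_square_growth\<close>): the Gaussian tail wins.

A weak limit \<open>\<nu>'\<close> of \<open>\<nu>\<^sub>v\<close> along a sequence thus satisfies \<open>e(\<nu>') \<le> K(\<nu>,\<nu>') \<le> (e(\<nu>) + e(\<nu>'))/2\<close> for all \<open>\<nu>\<close>, so it is optimal,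
and uniqueness together with compactness yields convergence (\<open>argmin_law_converges\<close>).\<close>

section \<open>Characteristic functions determine the law of a random family\<close>

text \<open>Normalizing the total mass, which is the value at \<open>0\<close> of the characteristic function, reduces this to
Levy's uniqueness theorem for probability measures.\<close>
lemma finite_borel_measure_eq_by_char:
  fixes M1 M2 :: "real measure"
  assumes fin: "finite_measure M1" "finite_measure M2"
    and sets: "sets M1 = sets borel" "sets M2 = sets borel"
    and eq: "\<And>t. (CLINT x|M1. iexp (t * x)) = (CLINT x|M2. iexp (t * x))"
  shows "M1 = M2"
proof -
  interpret M1: finite_measure M1 by fact
  interpret M2: finite_measure M2 by fact
  have sp: "space M1 = UNIV" "space M2 = UNIV"
    using sets[THEN sets_eq_imp_space_eq] by auto
  define c where "c = measure M1 UNIV"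
  have mass: "measure M1 UNIV = c" "measure M2 UNIV = c"
    using eq[of 0] by (auto simp: c_def sp)
  show ?thesis
  proof (cases "c = 0")
    case True
    have "emeasure M1 UNIV = 0" "emeasure M2 UNIV = 0"
      using mass True by (simp_all add: M1.emeasure_eq_measure M2.emeasure_eq_measure)
    then have "emeasure M1 A = 0" "emeasure M2 A = 0" for A
      by (metis emeasure_mono sets sets.top sp subset_UNIV le_zero_eq)+
    then show ?thesis by (intro measure_eqI) (simp_all add: sets)
  next
    case False
    then have c: "c > 0" using mass(1) measure_nonneg[of M1 UNIV] by linarith
    define D where "D M = density M (\<lambda>_. ennreal (1 / c))" for M :: "real measure"
    have rd: "real_distribution (D M)"
      if M: "finite_measure M" "sets M = sets borel" "measure M UNIV = c" for M
    proof -
      have "space M = UNIV" using sets_eq_imp_space_eq[OF M(2)] by simp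
      then have "emeasure (D M) (space (D M)) = 1"
        using c M by (simp add: D_def emeasure_density nn_integral_cmult finite_measure.emeasure_eq_measure
            flip: ennreal_mult)
      then show ?thesis
        using M(2) by (auto simp: real_distribution_def real_distribution_axioms_def D_def
            intro!: prob_spaceI)
    qed
    have "char (D M1) = char (D M2)"
    proof
      fix t
      have D: "char (D M) t = complex_of_real (1 / c) * (CLINT x|M. iexp (t * x))"
        if "sets M = sets borel" for M
        unfolding char_def D_def using that c
        by (subst integral_density) (auto simp: measurable_cong_sets[OF that refl] scaleR_conv_of_real)
      show "char (D M1) t = char (D M2) t"
        by (simp only: D sets eq)
    qed
    then have "D M1 = D M2"
      by (intro Levy_uniqueness rd fin sets mass)
    moreover have "emeasure (D M) A = ennreal (1 / c) * emeasure M A"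
      if "sets M = sets borel" "A \<in> sets borel" for M A
      using that by (simp add: D_def emeasure_density nn_integral_cmult_indicator)
    ultimately have "ennreal (1 / c) * emeasure M1 A = ennreal (1 / c) * emeasure M2 A"
      if "A \<in> sets borel" for A
      by (metis sets that)
    then show ?thesis
      using c by (intro measure_eqI) (auto simp: sets ennreal_mult_cancel_left)
  qed
qed

lemma weighted_char_determines:
  fixes w :: "'a \<Rightarrow> real" and w' :: "'b \<Rightarrow> real"
  assumes "prob_space M" "prob_space N"
    and meas: "X \<in> borel_measurable M" "w \<in> borel_measurable M"
      "Y \<in> borel_measurable N" "w' \<in> borel_measurable N"
    and w: "\<And>x. 0 \<le> w x" "\<And>x. w x \<le> 2" "\<And>x. 0 \<le> w' x" "\<And>x. w' x \<le> 2"
    and eq: "\<And>t. (CLINT x|M. w x * iexp (t * X x)) = (CLINT x|N. w' x * iexp (t * Y x))"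
    and B: "B \<in> sets borel"
  shows "(LINT x|M. w x * indicator B (X x)) = (LINT x|N. w' x * indicator B (Y x))"
proof -
  interpret M: prob_space M by fact
  interpret N: prob_space N by fact
  let ?D = "distr (density M w) borel X" and ?E = "distr (density N w') borel Y"
  note [measurable] = meas B
  have fM: "finite_measure (density M w)"
  proof
    have "(\<integral>\<^sup>+x. w x \<partial>M) \<le> (\<integral>\<^sup>+x. ennreal 2 \<partial>M)"
      using w by (intro nn_integral_mono ennreal_leI)
    then have "emeasure (density M w) (space (density M w)) \<le> ennreal 2"
      by (simp add: emeasure_density M.emeasure_space_1)
    then show "emeasure (density M w) (space (density M w)) \<noteq> \<infinity>"
      by (auto simp: M.emeasure_space_1 top_unique)
  qed
  have fN: "finite_measure (density N w')"
  proof
    have "(\<integral>\<^sup>+x. w' x \<partial>N) \<le> (\<integral>\<^sup>+x. ennreal 2 \<partial>N)"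
      using w by (intro nn_integral_mono ennreal_leI)
    then have "emeasure (density N w') (space (density N w')) \<le> ennreal 2"
      by (simp add: emeasure_density N.emeasure_space_1)
    then show "emeasure (density N w') (space (density N w')) \<noteq> \<infinity>"
      by (auto simp: N.emeasure_space_1 top_unique)
  qed
  have "?D = ?E"
  proof (rule finite_borel_measure_eq_by_char)
    show "finite_measure ?D" by (rule finite_measure.finite_measure_distr[OF fM]) simp
    show "finite_measure ?E" by (rule finite_measure.finite_measure_distr[OF fN]) simp
    fix t
    show "(CLINT x|?D. iexp (t * x)) = (CLINT x|?E. iexp (t * x))"
      using w eq[of t] by (simp add: integral_distr integral_density scaleR_conv_of_real)
  qed simp_all
  moreover have "(LINT x|?D. indicator B x) = (LINT x|M. w x * indicator B (X x))"
    using w by (subst integral_distr, measurable) (subst integral_density, auto)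
  moreover have "(LINT x|?E. indicator B x) = (LINT x|N. w' x * indicator B (Y x))"
    using w by (subst integral_distr, measurable) (subst integral_density, auto)
  ultimately show ?thesis by simp
qed

lemma integral_complex_parts:
  assumes "integrable L f" "integrable L g"
  shows "(CLINT x|L. complex_of_real (f x) + \<i> * complex_of_real (g x))
      = complex_of_real (LINT x|L. f x) + \<i> * complex_of_real (LINT x|L. g x)"
  using assms by simp

text \<open>The weights \<open>w (1 + cos S)\<close> and \<open>w (1 + sin S)\<close> are nonnegative, so that one-dimensional uniqueness applies to
\<open>X\<close> under each of them. Subtracting the case of the weight \<open>w\<close> recovers the complex weight \<open>w exp(i S)\<close>. This allows one
coordinate at a time to pass from exponentials to indicators.\<close>
lemma char_determines_indicator_step:
  fixes w S X :: "'a \<Rightarrow> real" and w' S' Y :: "'b \<Rightarrow> real"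
  assumes M: "prob_space M" and N: "prob_space N"
    and meas[measurable]: "X \<in> borel_measurable M" "w \<in> borel_measurable M" "S \<in> borel_measurable M"
      "Y \<in> borel_measurable N" "w' \<in> borel_measurable N" "S' \<in> borel_measurable N"
    and w: "\<And>x. 0 \<le> w x" "\<And>x. w x \<le> 1" "\<And>x. 0 \<le> w' x" "\<And>x. w' x \<le> 1"
    and eq: "\<And>k t. (CLINT x|M. w x * iexp (k * S x + t * X x))
              = (CLINT x|N. w' x * iexp (k * S' x + t * Y x))"
    and B[measurable]: "B \<in> sets borel"
  shows "(CLINT x|M. w x * indicator B (X x) * iexp (S x))
       = (CLINT x|N. w' x * indicator B (Y x) * iexp (S' x))"
proof -
  interpret M: prob_space M by fact
  interpret N: prob_space N by fact
  have bw: "\<bar>w x\<bar> \<le> 1" "\<bar>w' y\<bar> \<le> 1" for x y using w by (simp_all add: abs_le_iff order_trans[of _ 0])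
  have intM[simp]: "complex_integrable M (\<lambda>x. w x * iexp (f x))"
    if [measurable]: "f \<in> borel_measurable M" for f
    by (rule M.integrable_const_bound[where B=1]) (auto simp: norm_mult bw)
  have intN[simp]: "complex_integrable N (\<lambda>x. w' x * iexp (f x))"
    if [measurable]: "f \<in> borel_measurable N" for f
    by (rule N.integrable_const_bound[where B=1]) (auto simp: norm_mult bw)
  \<comment> \<open>the phase \<open>p\<close> gives the cosine for \<open>p = 0\<close> and the sine for \<open>p = \<pi>/2\<close>\<close>
  have ind: "(LINT x|M. (w x * (1 + a * cos (S x - p))) * indicator B (X x))
           = (LINT x|N. (w' x * (1 + a * cos (S' x - p))) * indicator B (Y x))" if a: "a = 0 \<or> a = 1" for a p
  proof (rule weighted_char_determines[OF M N])
    have "w x * (1 + a * cos (S x - p)) \<le> 1 * 2" "w' y * (1 + a * cos (S' y - p)) \<le> 1 * 2"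
      "0 \<le> w x * (1 + a * cos (S x - p))" "0 \<le> w' y * (1 + a * cos (S' y - p))" for x y
      using a w cos_ge_minus_one[of "S x - p"] cos_ge_minus_one[of "S' y - p"]
      by (intro mult_mono mult_nonneg_nonneg; auto; smt (verit))+
    then show "0 \<le> w x * (1 + a * cos (S x - p))" "w x * (1 + a * cos (S x - p)) \<le> 2"
      "0 \<le> w' y * (1 + a * cos (S' y - p))" "w' y * (1 + a * cos (S' y - p)) \<le> 2" for x y
      by simp_all
    fix t
    have ex: "complex_of_real (u * (1 + a * cos (s - p))) * iexp (t * z)
       = u * iexp (0 * s + t * z) + complex_of_real a / 2 * iexp (- p) * (u * iexp (1 * s + t * z))
           + complex_of_real a / 2 * iexp p * (u * iexp ((-1) * s + t * z))" for u s z
    proof -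
      have "complex_of_real (cos (s - p)) = (iexp s * iexp (- p) + iexp (- s) * iexp p) / 2"
        unfolding exp_add[symmetric] by (simp add: cos_of_real[symmetric] cos_exp_eq algebra_simps)
      moreover have "iexp (0 * s + t * z) = iexp (t * z)"
        "iexp (1 * s + t * z) = iexp s * iexp (t * z)" "iexp ((-1) * s + t * z) = iexp (- s) * iexp (t * z)"
        by (simp_all add: exp_add[symmetric] algebra_simps)
      ultimately show ?thesis
        by (simp only: of_real_mult of_real_add of_real_1) (simp add: field_simps)
    qed
    show "(CLINT x|M. (w x * (1 + a * cos (S x - p))) * iexp (t * X x))
        = (CLINT x|N. (w' x * (1 + a * cos (S' x - p))) * iexp (t * Y x))"
      unfolding ex by (simp only: Bochner_Integration.integral_add Bochner_Integration.integral_mult_right_zero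
          Bochner_Integration.integrable_add Bochner_Integration.integrable_mult_right intM intN eq
          borel_measurable_add borel_measurable_times borel_measurable_const meas)
  qed measurable
  have i1: "integrable M (\<lambda>x. w x * indicator B (X x))" "integrable N (\<lambda>x. w' x * indicator B (Y x))"
    using bw by (auto intro!: M.integrable_const_bound[where B=1] N.integrable_const_bound[where B=1]
        simp: indicator_def)
  have i2: "integrable M (\<lambda>x. w x * cos (S x - p) * indicator B (X x))"
       "integrable N (\<lambda>x. w' x * cos (S' x - p) * indicator B (Y x))" for p
    using mult_le_one[OF bw(1) _ abs_cos_le_one] mult_le_one[OF bw(2) _ abs_cos_le_one]
    by (auto intro!: M.integrable_const_bound[where B=1] N.integrable_const_bound[where B=1]
        simp: indicator_def abs_mult)
  have trig: "(LINT x|M. w x * cos (S x - p) * indicator B (X x))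
           = (LINT x|N. w' x * cos (S' x - p) * indicator B (Y x))" for p
    using ind[of 0 p] ind[of 1 p] i1 i2[of p] by (simp add: algebra_simps)
  have dec: "complex_of_real (u * indicator B z) * iexp s
     = complex_of_real (u * cos (s - 0) * indicator B z) + \<i> * complex_of_real (u * cos (s - pi/2) * indicator B z)"
    for u s z
    by (simp add: cis_conv_exp[symmetric] complex_eq_iff indicator_def cos_diff)
  show ?thesis
    unfolding dec integral_complex_parts[OF i2(1) i2(1)] integral_complex_parts[OF i2(2) i2(2)] trig ..
qed

text \<open>Induction on the set \<open>K\<close> of coordinates that carry indicators; the exponential of the remaining linear
combination must stay arbitrary, since the step consumes the exponentials in the coordinate that is added.\<close>
lemma char_determines_rectangles:
  fixes A :: "'i \<Rightarrow> 'a \<Rightarrow> real" and A' :: "'i \<Rightarrow> 'b \<Rightarrow> real"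
  assumes M: "prob_space M" and N: "prob_space N"
    and meas[measurable]: "\<And>i. A i \<in> borel_measurable M" "\<And>i. A' i \<in> borel_measurable N"
    and eq: "\<And>J c. finite J \<Longrightarrow> (CLINT x|M. iexp (\<Sum>i\<in>J. c i * A i x)) = (CLINT x|N. iexp (\<Sum>i\<in>J. c i * A' i x))"
    and "finite K" "finite J" and B: "\<And>i. i \<in> K \<Longrightarrow> B i \<in> sets borel"
  shows "(CLINT x|M. complex_of_real (\<Prod>k\<in>K. indicator (B k) (A k x)) * iexp (\<Sum>i\<in>J. c i * A i x))
       = (CLINT x|N. complex_of_real (\<Prod>k\<in>K. indicator (B k) (A' k x)) * iexp (\<Sum>i\<in>J. c i * A' i x))"
  using \<open>finite K\<close> \<open>finite J\<close> B
proof (induction K arbitrary: J c)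
  case empty
  then show ?case using eq[of J c] by simp
next
  case (insert k K)
  have [measurable]: "B k \<in> sets borel" "\<And>i. i \<in> K \<Longrightarrow> B i \<in> sets borel" using insert by auto
  have w01: "0 \<le> (\<Prod>k\<in>K. indicator (B k) (f k) :: real) \<and> (\<Prod>k\<in>K. indicator (B k) (f k)) \<le> (1::real)" for f
    by (auto intro!: prod_nonneg prod_le_1)
  have "(CLINT x|M. complex_of_real ((\<Prod>k\<in>K. indicator (B k) (A k x)) * indicator (B k) (A k x)) * iexp (\<Sum>i\<in>J. c i * A i x))
      = (CLINT x|N. complex_of_real ((\<Prod>k\<in>K. indicator (B k) (A' k x)) * indicator (B k) (A' k x)) * iexp (\<Sum>i\<in>J. c i * A' i x))"
  proof (rule char_determines_indicator_step[OF M N])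
    fix u t :: real
    \<comment> \<open>absorbs the exponential in the new coordinate \<open>k\<close>, which may or may not belong to \<open>J\<close>\<close>
    define c' where "c' i = u * (if i \<in> J then c i else 0) + (if i = k then t else 0)" for i
    have c': "u * (\<Sum>i\<in>J. c i * f i) + t * f k = (\<Sum>i\<in>insert k J. c' i * f i)" for f :: "'i \<Rightarrow> real"
    proof -
      have "(\<Sum>i\<in>insert k J. c' i * f i)
        = (\<Sum>i\<in>insert k J. (if i \<in> J then u * (c i * f i) else 0)) + (\<Sum>i\<in>insert k J. (if i = k then t * f k else 0))"
        unfolding sum.distrib[symmetric] by (intro sum.cong) (auto simp: c'_def algebra_simps)
      also have "(\<Sum>i\<in>insert k J. (if i = k then t * f k else 0)) = t * f k"
        using insert.prems by simp
      also have "(\<Sum>i\<in>insert k J. (if i \<in> J then u * (c i * f i) else 0)) = (\<Sum>i\<in>J. u * (c i * f i))"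
        using insert.prems by (intro sum.mono_neutral_cong_right) auto
      finally show ?thesis by (simp add: sum_distrib_left)
    qed
    show "(CLINT x|M. complex_of_real (\<Prod>k\<in>K. indicator (B k) (A k x)) * iexp (u * (\<Sum>i\<in>J. c i * A i x) + t * A k x))
      = (CLINT x|N. complex_of_real (\<Prod>k\<in>K. indicator (B k) (A' k x)) * iexp (u * (\<Sum>i\<in>J. c i * A' i x) + t * A' k x))"
      unfolding c'[of "\<lambda>i. A i _"] c'[of "\<lambda>i. A' i _"]
      using insert.prems by (intro insert.IH) auto
  qed (use w01 in auto)
  then show ?case using insert.hyps by (simp add: mult_ac)
qed

abbreviation path_space :: "('i \<Rightarrow> real) measure" where
  "path_space \<equiv> Pi\<^sub>M UNIV (\<lambda>_. borel)"

theorem char_determines_law: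
  fixes A :: "'i \<Rightarrow> 'a \<Rightarrow> real" and A' :: "'i \<Rightarrow> 'b \<Rightarrow> real"
  assumes M: "prob_space M" and N: "prob_space N"
    and meas[measurable]: "\<And>i. A i \<in> borel_measurable M" "\<And>i. A' i \<in> borel_measurable N"
    and eq: "\<And>J c. finite J \<Longrightarrow> (CLINT x|M. iexp (\<Sum>i\<in>J. c i * A i x)) = (CLINT x|N. iexp (\<Sum>i\<in>J. c i * A' i x))"
  shows "distr M path_space (\<lambda>x i. A i x) = distr N path_space (\<lambda>x i. A' i x)"
proof (rule measure_eqI_PiM_infinite)
  interpret M: prob_space M by fact
  interpret N: prob_space N by fact
  have [measurable]: "(\<lambda>x i. A i x) \<in> measurable M path_space"
      "(\<lambda>x i. A' i x) \<in> measurable N path_space"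
    by (auto intro!: measurable_PiM_single')
  show "finite_measure (distr M path_space (\<lambda>x i. A i x))"
    by (rule M.finite_measure_distr) simp
  fix B and J :: "'i set" assume J: "finite J" and B: "\<And>i. i \<in> J \<Longrightarrow> B i \<in> sets (borel :: real measure)"
  let ?P = "prod_emb UNIV (\<lambda>_. borel :: real measure) J (Pi\<^sub>E J B)"
  have [measurable]: "?P \<in> sets path_space"
    using J B by (intro sets_PiM_I) auto
  have ind: "indicator ?P f = complex_of_real (\<Prod>k\<in>J. indicator (B k) (f k))" for f
  proof -
    have "f \<in> ?P \<longleftrightarrow> (\<forall>k\<in>J. f k \<in> B k)"
      by (auto simp: prod_emb_def space_PiM PiE_iff)
    then show ?thesis
      using J by (cases "f \<in> ?P") (auto simp: indicator_def)
  qed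
  have eqJ: "(CLINT x|M. indicator ?P (\<lambda>i. A i x)) = (CLINT x|N. indicator ?P (\<lambda>i. A' i x))"
    unfolding ind
    using char_determines_rectangles[OF M N meas eq J finite.emptyI B, where c="\<lambda>_. 0"] by simp
  have "(CLINT x|distr M path_space (\<lambda>x i. A i x). indicator ?P x)
      = (CLINT x|distr N path_space (\<lambda>x i. A' i x). indicator ?P x)"
    using eqJ by (simp add: integral_distr)
  moreover have "indicator ?P = (\<lambda>f. complex_of_real (indicator ?P f))"
    by (auto simp: indicator_def)
  ultimately have "measure (distr M path_space (\<lambda>x i. A i x)) ?P
    = measure (distr N path_space (\<lambda>x i. A' i x)) ?P"
    by (simp add: space_PiM)
  then show "emeasure (distr M path_space (\<lambda>x i. A i x)) ?P
    = emeasure (distr N path_space (\<lambda>x i. A' i x)) ?P"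
    by (simp add: emeasure_distr M.emeasure_eq_measure N.emeasure_eq_measure measure_distr)
qed (simp_all)

section \<open>Minimum, leftmost minimizer and supremum norm of a path\<close>

text \<open>Only rational times occur, and the infimum is taken in the extended reals, so that this is a measurable
functional on the product space of all functions; on continuous paths it is the minimum.\<close>
definition path_inf :: "real \<Rightarrow> (real \<Rightarrow> real) \<Rightarrow> real" where
  "path_inf b x = real_of_ereal (INF q\<in>{0..b} \<inter> \<rat>. ereal (x q))"

text \<open>The supremum of \<open>\<bar>x\<bar>\<close>, through the infima of \<open>x\<close> and \<open>- x\<close> in order to inherit their measurability.\<close>
definition path_norm :: "real \<Rightarrow> (real \<Rightarrow> real) \<Rightarrow> real" where
  "path_norm b x = max (- path_inf b x) (- path_inf b (\<lambda>t. - x t))"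

lemma measurable_path_inf[measurable]: "path_inf b \<in> borel_measurable path_space"
proof -
  have "countable ({0..b} \<inter> \<rat>)" using countable_rat by (rule countable_subset[rotated]) auto
  then show ?thesis unfolding path_inf_def by measurable
qed

lemma measurable_path_norm[measurable]: "path_norm b \<in> borel_measurable path_space"
proof -
  have "(\<lambda>(x::real \<Rightarrow> real) t. - x t) \<in> measurable path_space path_space"
    by (rule measurable_PiM_single') (auto simp: space_PiM)
  then show ?thesis unfolding path_norm_def
    using measurable_compose[OF _ measurable_path_inf] by measurable
qed

lemma min_on_attained:
  fixes f :: "real \<Rightarrow> real"
  assumes "continuous_on {0..b} f" "0 \<le> b"
  shows "\<exists>t\<in>{0..b}. f t = min_on b f" "\<And>s. s \<in> {0..b} \<Longrightarrow> min_on b f \<le> f s"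
proof -
  obtain t where t: "t \<in> {0..b}" "\<forall>s\<in>{0..b}. f t \<le> f s"
    using continuous_attains_inf[OF compact_Icc _ assms(1)] assms(2) by auto
  have "min_on b f = f t"
    unfolding min_on_def using t by (intro cInf_eq_minimum) auto
  then show "\<exists>t\<in>{0..b}. f t = min_on b f" "\<And>s. s \<in> {0..b} \<Longrightarrow> min_on b f \<le> f s"
    using t by auto
qed

lemma argmin_on_correct:
  fixes f :: "real \<Rightarrow> real"
  assumes "continuous_on {0..b} f" "0 \<le> b"
  shows "argmin_on b f \<in> {0..b}" "f (argmin_on b f) = min_on b f"
    "\<And>s. s \<in> {0..b} \<Longrightarrow> f s = min_on b f \<Longrightarrow> argmin_on b f \<le> s"
proof -
  note m = min_on_attained[OF assms]
  define S where "S = {t\<in>{0..b}. f t = min_on b f}"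
  have "closed S"
    unfolding S_def using assms(1) by (intro continuous_closed_preimage_constant) auto
  then have "compact S"
    unfolding compact_eq_bounded_closed
    by (auto simp: S_def intro: bounded_subset[OF bounded_closed_interval])
  moreover have "S \<noteq> {}" using m(1) by (auto simp: S_def)
  ultimately obtain t where t: "t \<in> S" "\<forall>s\<in>S. t \<le> s"
    using compact_attains_inf by metis
  have "argmin_on b f = t"
    unfolding argmin_on_def
  proof (rule Least_equality)
    show "t \<in> {0..b} \<and> (\<forall>s\<in>{0..b}. f t \<le> f s)"
      using t m(2) by (auto simp: S_def)
    fix y assume y: "y \<in> {0..b} \<and> (\<forall>s\<in>{0..b}. f y \<le> f s)"
    then have "f y = min_on b f"
      using m by (intro antisym) (metis, simp)
    then show "t \<le> y" using y t(2) by (auto simp: S_def)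
  qed
  then show "argmin_on b f \<in> {0..b}" "f (argmin_on b f) = min_on b f"
    "\<And>s. s \<in> {0..b} \<Longrightarrow> f s = min_on b f \<Longrightarrow> argmin_on b f \<le> s"
    using t by (auto simp: S_def)
qed

lemma path_inf_eq_min_on:
  fixes f :: "real \<Rightarrow> real"
  assumes f: "continuous_on {0..b} f" and b: "0 \<le> b"
  shows "path_inf b f = min_on b f"
proof -
  note m = min_on_attained[OF assms]
  obtain t where t: "t \<in> {0..b}" "f t = min_on b f" using m(1) by auto
  have "(INF q\<in>{0..b} \<inter> \<rat>. ereal (f q)) = ereal (min_on b f)"
  proof (rule antisym)
    show "ereal (min_on b f) \<le> (INF q\<in>{0..b} \<inter> \<rat>. ereal (f q))"
      using m(2) by (intro INF_greatest) auto
    show "(INF q\<in>{0..b} \<inter> \<rat>. ereal (f q)) \<le> ereal (min_on b f)"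
    proof (rule ereal_le_epsilon2)
      fix e' :: real assume e': "0 < e'"
      obtain d where d: "d > 0" "\<And>s. s \<in> {0..b} \<Longrightarrow> dist s t < d \<Longrightarrow> dist (f s) (f t) < e'"
        using f t(1) e' by (metis continuous_on_iff)
      obtain q where q: "q \<in> \<rat>" "q \<in> {0..b}" "\<bar>q - t\<bar> < d"
      proof (cases "b = 0")
        case True then show ?thesis using t d that[of 0] by auto
      next
        case False
        then have "max 0 (t - d) < min b (t + d)" using t b d by auto
        then obtain q where "q \<in> \<rat>" "max 0 (t - d) < q" "q < min b (t + d)"
          using Rats_dense_in_real by blast
        then show ?thesis by (intro that[of q]) auto
      qed
      have "(INF q\<in>{0..b} \<inter> \<rat>. ereal (f q)) \<le> ereal (f q)" using q by (intro INF_lower) auto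
      also have "\<dots> \<le> ereal (min_on b f) + ereal e'" using d(2)[OF q(2)] q(3) t by (auto simp: dist_real_def)
      finally show "(INF q\<in>{0..b} \<inter> \<rat>. ereal (f q)) \<le> ereal (min_on b f) + ereal e'" .
    qed
  qed
  then show ?thesis by (simp add: path_inf_def)
qed

lemma path_norm_bound:
  fixes f :: "real \<Rightarrow> real"
  assumes f: "continuous_on {0..b} f" and b: "0 \<le> b"
  shows "\<And>t. t \<in> {0..b} \<Longrightarrow> \<bar>f t\<bar> \<le> path_norm b f" "\<exists>t\<in>{0..b}. \<bar>f t\<bar> = path_norm b f" "0 \<le> path_norm b f"
    "\<bar>min_on b f\<bar> \<le> path_norm b f"
proof -
  have f': "continuous_on {0..b} (\<lambda>t. - f t)" using f by (intro continuous_intros)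
  have eq: "path_norm b f = max (- min_on b f) (- min_on b (\<lambda>t. - f t))"
    unfolding path_norm_def using path_inf_eq_min_on[OF f b] path_inf_eq_min_on[OF f' b] by simp
  show *: "\<And>t. t \<in> {0..b} \<Longrightarrow> \<bar>f t\<bar> \<le> path_norm b f"
    using min_on_attained(2)[OF f b] min_on_attained(2)[OF f' b] unfolding eq by fastforce
  then show "0 \<le> path_norm b f" using b by (metis abs_ge_zero atLeastAtMost_iff order_refl order_trans)
  show "\<bar>min_on b f\<bar> \<le> path_norm b f" using min_on_attained(1)[OF f b] * by force
  obtain t where t: "t \<in> {0..b}" "f t = min_on b f" using min_on_attained(1)[OF f b] by auto
  obtain s where s: "s \<in> {0..b}" "- f s = min_on b (\<lambda>t. - f t)" using min_on_attained(1)[OF f' b] by auto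
  have "\<bar>f t\<bar> = path_norm b f \<or> \<bar>f s\<bar> = path_norm b f"
    using *[OF t(1)] *[OF s(1)] t s unfolding eq by linarith
  then show "\<exists>t\<in>{0..b}. \<bar>f t\<bar> = path_norm b f" using t(1) s(1) by blast
qed

text \<open>Expresses the leftmost minimizer by minima over intervals, which are measurable functions of the path.\<close>
lemma argmin_on_le_iff:
  fixes f :: "real \<Rightarrow> real"
  assumes f: "continuous_on {0..b} f" and a: "0 \<le> a" "a \<le> b"
  shows "argmin_on b f \<le> a \<longleftrightarrow> min_on a f \<le> min_on b f"
proof -
  have b: "0 \<le> b" using a by simp
  have fa: "continuous_on {0..a} f" using f a by (auto intro: continuous_on_subset)
  show ?thesis
  proof
    assume "argmin_on b f \<le> a"
    then show "min_on a f \<le> min_on b f"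
      using argmin_on_correct[OF f b] min_on_attained(2)[OF fa a(1), of "argmin_on b f"] by auto
  next
    assume *: "min_on a f \<le> min_on b f"
    obtain s where "s \<in> {0..a}" "f s = min_on a f" using min_on_attained(1)[OF fa a(1)] by auto
    then show "argmin_on b f \<le> a"
      using * argmin_on_correct(3)[OF f b, of s] min_on_attained(2)[OF f b, of s] a by auto
  qed
qed

section \<open>The normal law\<close>

lemma integrable_return_borel:
  fixes f :: "real \<Rightarrow> real"
  assumes "f \<in> borel_measurable borel"
  shows "integrable (return borel m) f"
proof -
  interpret prob_space "return borel m" by (rule prob_space_return) simp
  show ?thesis
    using assms by (intro integrable_const_bound[where B="\<bar>f m\<bar>"]) (auto simp: AE_return)
qed

lemma gaussian_law_moments:
  assumes "0 \<le> s"
  shows "integrable (gaussian_law m s) (\<lambda>x. x)" "(LINT x|gaussian_law m s. x) = m"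
    "integrable (gaussian_law 0 s) (\<lambda>x. x\<^sup>2)" "(LINT x|gaussian_law 0 s. x\<^sup>2) = s\<^sup>2"
proof -
  show "integrable (gaussian_law m s) (\<lambda>x. x)"
    using integrable_normal_moment_nz_1[of s m] assms
    by (cases "s = 0") (auto simp: gaussian_law_def integrable_density integrable_return_borel)
  show "(LINT x|gaussian_law m s. x) = m"
    using integral_normal_moment_nz_1[of s m] assms
    by (cases "s = 0") (auto simp: gaussian_law_def integral_density integral_return)
  show "integrable (gaussian_law 0 s) (\<lambda>x. x\<^sup>2)"
    using integrable_normal_moment[of s 0 2] assms
    by (cases "s = 0") (auto simp: gaussian_law_def integrable_density integrable_return_borel)
  show "(LINT x|gaussian_law 0 s. x\<^sup>2) = s\<^sup>2"
    using integral_normal_moment_even[of s 0 1] assms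
    by (cases "s = 0") (auto simp: gaussian_law_def integral_density integral_return fact_2)
qed

lemma gaussian_law_char:
  assumes "0 \<le> s"
  shows "(CLINT x|gaussian_law 0 s. iexp (t * x)) = exp (- (t\<^sup>2 * s\<^sup>2) / 2)"
proof (cases "s = 0")
  case True
  then show ?thesis by (simp add: gaussian_law_def integral_return)
next
  case False
  with assms have s: "0 < s" by simp
  let ?D = "density lborel (normal_density 0 s)"
  interpret D: prob_space ?D using s by (rule prob_space_normal_density)
  have "distributed ?D lborel (\<lambda>x. x) (normal_density 0 s)"
    by (auto simp: distributed_def distr_id2)
  then have "distributed ?D lborel (\<lambda>x. (x - 0) / s) std_normal_density"
    using D.normal_standard_normal_convert[OF s, of "\<lambda>x. x" 0] by simp
  then have st: "distr ?D lborel (\<lambda>x. x / s) = std_normal_distribution"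
    by (simp add: distributed_def)
  have "(CLINT x|gaussian_law 0 s. iexp (t * x)) = (CLINT x|?D. iexp ((t * s) * (x / s)))"
    using s by (simp add: gaussian_law_def)
  also have "\<dots> = (CLINT x|distr ?D lborel (\<lambda>x. x / s). iexp ((t * s) * x))"
    by (subst integral_distr) auto
  also have "\<dots> = char std_normal_distribution (t * s)"
    by (simp only: st char_def)
  also have "\<dots> = exp (- (t * s)\<^sup>2 / 2)"
    unfolding char_std_normal_distribution by (simp flip: exp_of_real)
  finally show ?thesis by (simp add: power_mult_distrib flip: exp_of_real)
qed

section \<open>Gaussian paths and their covariance\<close>

locale gaussian_path = prob_space M
  for M :: "'w measure" +
  fixes X :: "real \<Rightarrow> 'w \<Rightarrow> real" and R :: "real \<Rightarrow> real" and b :: real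
  assumes b_pos: "0 < b"
    and gaussian: "gaussian_process M X"
    and centered: "centered_process M X"
    and paths: "\<And>\<omega>. \<omega> \<in> space M \<Longrightarrow> continuous_on UNIV (\<lambda>t. X t \<omega>)"
    and cov: "\<And>s t. R t = (LINT \<omega>|M. X s \<omega> * X (s + t) \<omega>)"
begin

lemma b_nonneg: "0 \<le> b"
  using b_pos by simp

lemma X_measurable[measurable]: "X t \<in> borel_measurable M"
  using gaussian by (auto simp: gaussian_process_def)

lemma path_continuous: "\<omega> \<in> space M \<Longrightarrow> continuous_on {0..b} (\<lambda>t. X t \<omega>)"
  using paths by (rule continuous_on_subset) auto

lemma cov_eq: "R (t - s) = (LINT \<omega>|M. X s \<omega> * X t \<omega>)"
  using cov[of "t - s" s] by simp

lemma R_sym: "R (- t) = R t"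
  using cov[of t 0] cov[of "- t" t] by (simp add: mult.commute)

text \<open>The times \<open>\<tau> k\<close> may repeat, so the coefficients are first collected over the distinct times.\<close>
lemma lincomb_law:
  fixes c \<tau> :: "'k \<Rightarrow> real"
  assumes K: "finite K"
  shows "\<exists>s\<ge>0. distr M borel (\<lambda>\<omega>. \<Sum>k\<in>K. c k * X (\<tau> k) \<omega>) = gaussian_law 0 s"
proof -
  have "(\<Sum>k\<in>K. c k * X (\<tau> k) \<omega>) = (\<Sum>t\<in>\<tau> ` K. (\<Sum>k\<in>{k\<in>K. \<tau> k = t}. c k) * X t \<omega>)" for \<omega>
    by (subst sum.image_gen[OF K, of _ \<tau>]) (auto simp: sum_distrib_right intro!: sum.cong)
  then obtain m s where s: "0 \<le> s" "distr M borel (\<lambda>\<omega>. \<Sum>k\<in>K. c k * X (\<tau> k) \<omega>) = gaussian_law m s"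
    using gaussian K unfolding gaussian_process_def
    by (auto dest!: spec[of _ "\<tau> ` K"] dest: spec[of _ "\<lambda>t. \<Sum>k\<in>{k\<in>K. \<tau> k = t}. c k"])
  have "m = (LINT x|distr M borel (\<lambda>\<omega>. \<Sum>k\<in>K. c k * X (\<tau> k) \<omega>). x)"
    using gaussian_law_moments(2)[OF s(1)] s(2) by simp
  also have "\<dots> = (LINT \<omega>|M. (\<Sum>k\<in>K. c k * X (\<tau> k) \<omega>))"
    by (subst integral_distr) auto
  also have "\<dots> = 0"
    using centered by (subst Bochner_Integration.integral_sum) (auto simp: centered_process_def)
  finally show ?thesis using s by auto
qed

lemma lincomb_square:
  fixes c \<tau> :: "'k \<Rightarrow> real"
  assumes K: "finite K"
  defines "Y \<equiv> \<lambda>\<omega>. \<Sum>k\<in>K. c k * X (\<tau> k) \<omega>"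
  shows "integrable M (\<lambda>\<omega>. (Y \<omega>)\<^sup>2)" "(CLINT \<omega>|M. iexp (Y \<omega>)) = exp (- (LINT \<omega>|M. (Y \<omega>)\<^sup>2) / 2)"
proof -
  have [measurable]: "Y \<in> borel_measurable M" unfolding Y_def by measurable
  obtain s where s: "0 \<le> s" and D: "distr M borel Y = gaussian_law 0 s"
    using lincomb_law[OF K, of c \<tau>] unfolding Y_def by auto
  show "integrable M (\<lambda>\<omega>. (Y \<omega>)\<^sup>2)"
    using gaussian_law_moments(3)[OF s] unfolding D[symmetric]
    by (subst (asm) integrable_distr_eq) auto
  have sq: "(LINT \<omega>|M. (Y \<omega>)\<^sup>2) = s\<^sup>2"
    using gaussian_law_moments(4)[OF s] unfolding D[symmetric]
    by (subst (asm) integral_distr) auto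
  have "(CLINT \<omega>|M. iexp (Y \<omega>)) = (CLINT x|distr M borel Y. iexp (1 * x))"
    by (subst integral_distr) auto
  also have "\<dots> = exp (- (LINT \<omega>|M. (Y \<omega>)\<^sup>2) / 2)"
    unfolding D using gaussian_law_char[OF s, of 1] by (simp only: sq) simp
  finally show "(CLINT \<omega>|M. iexp (Y \<omega>)) = exp (- (LINT \<omega>|M. (Y \<omega>)\<^sup>2) / 2)" .
qed

lemma integrable_X_sq: "integrable M (\<lambda>\<omega>. (X t \<omega>)\<^sup>2)"
  using lincomb_square(1)[of "{t}" "\<lambda>_. 1" "\<lambda>t. t"] by simp

lemma integrable_X_mult: "integrable M (\<lambda>\<omega>. X s \<omega> * X t \<omega>)"
proof (rule Bochner_Integration.integrable_bound)
  show "integrable M (\<lambda>\<omega>. (X s \<omega>)\<^sup>2 + (X t \<omega>)\<^sup>2)" by (intro Bochner_Integration.integrable_add integrable_X_sq)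
  have "\<bar>x * y\<bar> \<le> x\<^sup>2 + y\<^sup>2" for x y :: real
    using sum_squares_bound[of "\<bar>x\<bar>" "\<bar>y\<bar>"] mult_nonneg_nonneg[of "\<bar>x\<bar>" "\<bar>y\<bar>"]
    unfolding abs_mult power2_abs mult.assoc by linarith
  then show "AE \<omega> in M. norm (X s \<omega> * X t \<omega>) \<le> norm ((X s \<omega>)\<^sup>2 + (X t \<omega>)\<^sup>2)" by auto
qed measurable

lemma lincomb_mult:
  assumes "finite K" "finite L"
  shows "integrable M (\<lambda>\<omega>. (\<Sum>k\<in>K. c k * X (\<tau> k) \<omega>) * (\<Sum>l\<in>L. d l * X (\<sigma> l) \<omega>))"
    "(LINT \<omega>|M. (\<Sum>k\<in>K. c k * X (\<tau> k) \<omega>) * (\<Sum>l\<in>L. d l * X (\<sigma> l) \<omega>))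
       = (\<Sum>k\<in>K. \<Sum>l\<in>L. c k * d l * R (\<tau> k - \<sigma> l))"
proof -
  have eq: "(\<Sum>k\<in>K. c k * X (\<tau> k) \<omega>) * (\<Sum>l\<in>L. d l * X (\<sigma> l) \<omega>)
      = (\<Sum>k\<in>K. \<Sum>l\<in>L. c k * d l * (X (\<sigma> l) \<omega> * X (\<tau> k) \<omega>))" for \<omega>
    by (simp add: sum_product mult_ac)
  show "integrable M (\<lambda>\<omega>. (\<Sum>k\<in>K. c k * X (\<tau> k) \<omega>) * (\<Sum>l\<in>L. d l * X (\<sigma> l) \<omega>))"
    unfolding eq by (intro Bochner_Integration.integrable_sum integrable_mult_right integrable_X_mult)
  show "(LINT \<omega>|M. (\<Sum>k\<in>K. c k * X (\<tau> k) \<omega>) * (\<Sum>l\<in>L. d l * X (\<sigma> l) \<omega>))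
       = (\<Sum>k\<in>K. \<Sum>l\<in>L. c k * d l * R (\<tau> k - \<sigma> l))"
    unfolding eq
    by (simp add: Bochner_Integration.integral_sum integrable_X_mult cov_eq[symmetric]
        Bochner_Integration.integrable_sum)
qed

text \<open>The variance of \<open>\<Sum>k\<in>K. c k * X (\<tau> k)\<close>.\<close>
abbreviation covsum :: "'k set \<Rightarrow> ('k \<Rightarrow> real) \<Rightarrow> ('k \<Rightarrow> real) \<Rightarrow> real" where
  "covsum K c \<tau> \<equiv> (\<Sum>k\<in>K. \<Sum>l\<in>K. c k * c l * R (\<tau> k - \<tau> l))"

lemma lincomb_char:
  assumes "finite K"
  shows "(CLINT \<omega>|M. iexp (\<Sum>k\<in>K. c k * X (\<tau> k) \<omega>)) = exp (- covsum K c \<tau> / 2)"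
  unfolding lincomb_square(2)[OF assms] power2_eq_square lincomb_mult(2)[OF assms assms] ..

lemma R_abs_le: "\<bar>R t\<bar> \<le> R 0"
proof -
  have *: "0 \<le> (LINT \<omega>|M. (X 0 \<omega> + a * X t \<omega>)\<^sup>2)" for a
    by (rule integral_nonneg_AE) auto
  have "(LINT \<omega>|M. (X 0 \<omega> + a * X t \<omega>)\<^sup>2) = R 0 + 2 * a * R t + a\<^sup>2 * R 0" for a
  proof -
    have eq: "(X 0 \<omega> + a * X t \<omega>)\<^sup>2 = X 0 \<omega> * X 0 \<omega> + 2 * a * (X 0 \<omega> * X t \<omega>) + a\<^sup>2 * (X t \<omega> * X t \<omega>)" for \<omega>
      by (simp add: power2_eq_square algebra_simps)
    show ?thesis unfolding eq
      by (simp add: integrable_X_mult cov_eq[symmetric])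
  qed
  from *[of 1, unfolded this] *[of "- 1", unfolded this] show ?thesis by simp
qed

text \<open>Path continuity makes \<open>E cos(X\<^sub>0 + X\<^sub>t) = exp(-(R(0) + R(t)))\<close> continuous in \<open>t\<close> by dominated convergence.\<close>
lemma R_continuous: "continuous_on UNIV R"
proof -
  define f where "f t = (LINT \<omega>|M. cos (X 0 \<omega> + X t \<omega>))" for t
  have int: "complex_integrable M (\<lambda>\<omega>. iexp (X 0 \<omega> + X t \<omega>))" for t
    by (rule integrable_const_bound[where B=1]) auto
  have f: "f t = exp (- (R 0 + R t))" for t
  proof -
    have "(CLINT \<omega>|M. iexp (X 0 \<omega> + X t \<omega>)) = exp (- covsum UNIV (\<lambda>_. 1) (\<lambda>k. if k then t else 0) / 2)"
      using lincomb_char[of "UNIV :: bool set" "\<lambda>_. 1" "\<lambda>k. if k then t else 0"]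
      by (simp add: UNIV_bool add.commute)
    also have "\<dots> = exp (- (R 0 + R t))" using R_sym[of t] by (simp add: UNIV_bool)
    finally have "Re (CLINT \<omega>|M. iexp (X 0 \<omega> + X t \<omega>)) = exp (- (R 0 + R t))" by simp
    then show ?thesis using int by (simp add: f_def integral_Re[symmetric] Re_exp)
  qed
  have "continuous_on UNIV f"
    unfolding continuous_on_sequentially
  proof (intro allI ballI impI, elim conjE)
    fix x :: "nat \<Rightarrow> real" and a assume x: "x \<longlonglongrightarrow> a"
    show "(f \<circ> x) \<longlonglongrightarrow> f a"
      unfolding f_def comp_def
    proof (rule integral_dominated_convergence[where w="\<lambda>_. 1"])
      show "AE \<omega> in M. (\<lambda>n. cos (X 0 \<omega> + X (x n) \<omega>)) \<longlonglongrightarrow> cos (X 0 \<omega> + X a \<omega>)"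
      proof (rule AE_I2)
        fix \<omega> assume "\<omega> \<in> space M"
        then have "(\<lambda>n. X (x n) \<omega>) \<longlonglongrightarrow> X a \<omega>"
          by (intro continuous_on_tendsto_compose[OF paths x]) auto
        then show "(\<lambda>n. cos (X 0 \<omega> + X (x n) \<omega>)) \<longlonglongrightarrow> cos (X 0 \<omega> + X a \<omega>)"
          by (intro tendsto_intros)
      qed
    qed auto
  qed
  then have "continuous_on UNIV (\<lambda>t. - ln (f t) - R 0)"
    by (intro continuous_intros) (auto simp: f)
  then show ?thesis by (simp add: f)
qed

lemma path_measurable: "(\<lambda>\<omega> t. X t \<omega>) \<in> measurable M path_space"
  by (rule measurable_PiM_single') auto

text \<open>A rotation of the plane, applied at each time to the pair formed by two independent copies of the process, preserves
the joint law, because it preserves the covariances of the pair. The Boolean index selects the component of the pair.\<close>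

abbreviation "MM \<equiv> M \<Otimes>\<^sub>M M"

sublocale P: pair_prob_space M M ..

lemma product_char:
  fixes f :: "'a \<Rightarrow> real" and g :: "'b \<Rightarrow> real"
  assumes "prob_space A" "prob_space B"
  assumes [measurable]: "f \<in> borel_measurable A" "g \<in> borel_measurable B"
  shows "(CLINT z|A \<Otimes>\<^sub>M B. iexp (f (fst z) + g (snd z))) = (CLINT x|A. iexp (f x)) * (CLINT y|B. iexp (g y))"
proof -
  interpret A: prob_space A by fact
  interpret B: prob_space B by fact
  interpret AB: pair_prob_space A B ..
  have "integrable (A \<Otimes>\<^sub>M B) (\<lambda>z. iexp (f (fst z) + g (snd z)))"
    by (rule AB.P.integrable_const_bound[where B=1]) auto
  from AB.integral_fst'[OF this]
  show ?thesis by (simp add: exp_add distrib_left)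
qed

lemma pair_lincomb_char:
  assumes "finite K"
  shows "(CLINT z|MM. iexp ((\<Sum>k\<in>K. c k * X (\<tau> k) (fst z)) + (\<Sum>k\<in>K. d k * X (\<tau> k) (snd z))))
    = exp (- (covsum K c \<tau> + covsum K d \<tau>) / 2)"
proof -
  have "(CLINT z|MM. iexp ((\<Sum>k\<in>K. c k * X (\<tau> k) (fst z)) + (\<Sum>k\<in>K. d k * X (\<tau> k) (snd z))))
    = complex_of_real (exp (- covsum K c \<tau> / 2)) * complex_of_real (exp (- covsum K d \<tau> / 2))"
    by (subst product_char) (simp_all only: prob_space_axioms lincomb_char[OF assms], measurable)
  then show ?thesis
    by (simp only: of_real_mult[symmetric] exp_add[symmetric] add_divide_distrib[symmetric] minus_add_distrib)
qed

definition rotate_pair :: "real \<Rightarrow> real \<Rightarrow> 'w \<times> 'w \<Rightarrow> real \<times> bool \<Rightarrow> real" where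
  "rotate_pair \<alpha> \<beta> z i = (if snd i then - \<beta> * X (fst i) (fst z) + \<alpha> * X (fst i) (snd z)
                      else \<alpha> * X (fst i) (fst z) + \<beta> * X (fst i) (snd z))"

lemma rotate_measurable[measurable]:
  "(\<lambda>z. rotate_pair \<alpha> \<beta> z i) \<in> borel_measurable MM"
  "rotate_pair \<alpha> \<beta> \<in> measurable MM path_space"
proof -
  show *: "(\<lambda>z. rotate_pair \<alpha> \<beta> z i) \<in> borel_measurable MM" for i unfolding rotate_pair_def by measurable
  show "rotate_pair \<alpha> \<beta> \<in> measurable MM path_space"
    by (rule measurable_PiM_single') (auto intro: *)
qed

lemma rotate_char:
  fixes c :: "real \<times> bool \<Rightarrow> real"
  assumes J: "finite J" and ab: "\<alpha>\<^sup>2 + \<beta>\<^sup>2 = 1"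
  defines "c0 \<equiv> \<lambda>j. if snd j then 0 else c j" and "c1 \<equiv> \<lambda>j. if snd j then c j else 0"
  shows "(CLINT z|MM. iexp (\<Sum>j\<in>J. c j * rotate_pair \<alpha> \<beta> z j)) = exp (- (covsum J c0 fst + covsum J c1 fst) / 2)"
proof -
  define d where "d j = \<alpha> * c0 j - \<beta> * c1 j" for j
  define e where "e j = \<beta> * c0 j + \<alpha> * c1 j" for j
  have "(\<Sum>j\<in>J. c j * rotate_pair \<alpha> \<beta> z j) = (\<Sum>j\<in>J. d j * X (fst j) (fst z)) + (\<Sum>j\<in>J. e j * X (fst j) (snd z))" for z
    unfolding sum.distrib[symmetric]
    by (intro sum.cong) (auto simp: rotate_pair_def d_def e_def c0_def c1_def algebra_simps)
  moreover have "covsum J d fst + covsum J e fst = covsum J c0 fst + covsum J c1 fst"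
  proof -
    have "d j * d k * r + e j * e k * r = (\<alpha>\<^sup>2 + \<beta>\<^sup>2) * (c0 j * c0 k * r + c1 j * c1 k * r)" for j k r
      by (simp add: d_def e_def power2_eq_square algebra_simps)
    then show ?thesis unfolding sum.distrib[symmetric] ab by simp
  qed
  ultimately show ?thesis using pair_lincomb_char[OF J, of d fst e] by simp
qed

theorem rotation_invariance:
  assumes "\<alpha>\<^sup>2 + \<beta>\<^sup>2 = 1"
  shows "distr MM path_space (rotate_pair \<alpha> \<beta>) = distr MM path_space (rotate_pair 1 0)"
proof (rule char_determines_law[OF P.prob_space_axioms P.prob_space_axioms])
  fix J :: "(real \<times> bool) set" and c assume J: "finite J"
  have "(1::real)\<^sup>2 + 0\<^sup>2 = 1" by simp
  from rotate_char[OF J assms, of c] rotate_char[OF J this, of c]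
  show "(CLINT z|MM. iexp (\<Sum>j\<in>J. c j * rotate_pair \<alpha> \<beta> z j)) = (CLINT z|MM. iexp (\<Sum>j\<in>J. c j * rotate_pair 1 0 z j))"
    by (rule trans[OF _ sym])
qed measurable

corollary rotation_nn_integral:
  assumes "\<alpha>\<^sup>2 + \<beta>\<^sup>2 = 1" and [measurable]: "F \<in> borel_measurable path_space"
  shows "(\<integral>\<^sup>+z. F (rotate_pair \<alpha> \<beta> z) \<partial>MM) = (\<integral>\<^sup>+z. F (rotate_pair 1 0 z) \<partial>MM)"
  using arg_cong[OF rotation_invariance[OF assms(1)], of "\<lambda>D. \<integral>\<^sup>+x. F x \<partial>D"]
  by (simp add: nn_integral_distr)

end

section \<open>A growth lemma for functions supermultiplicative on circles\<close>

text \<open>With \<open>L = - ln p\<close>, the hypothesis \<open>L(\<alpha>u + \<beta>v) \<le> L(u) + L(v)\<close> iterates to \<open>L(\<surd>n u) \<le> n L(u)\<close>. By monotonicity,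
\<open>L(v)/v\<^sup>2\<close> then converges to its infimum \<open>l\<close> over \<open>v \<ge> 1\<close>, as in Fekete's lemma, so \<open>L(\<surd>2 v)\<close> and \<open>2 L(v)\<close> both are
\<open>2 l v\<^sup>2 + o(v\<^sup>2)\<close>.\<close>
lemma supermultiplicative_square_growth:
  fixes p :: "real \<Rightarrow> real"
  assumes pos: "\<And>v. 0 < p v" and le1: "\<And>v. p v \<le> 1" and anti: "\<And>u v. u \<le> v \<Longrightarrow> p v \<le> p u"
    and mult: "\<And>\<alpha> \<beta> u v. 0 \<le> \<alpha> \<Longrightarrow> 0 \<le> \<beta> \<Longrightarrow> \<alpha>\<^sup>2 + \<beta>\<^sup>2 = 1 \<Longrightarrow> p u * p v \<le> p (\<alpha> * u + \<beta> * v)"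
    and \<eta>: "0 < \<eta>"
  shows "\<forall>\<^sub>F v in at_top. p (sqrt 2 * v) \<le> exp (\<eta> * v\<^sup>2) * (p v)\<^sup>2"
proof -
  define L where "L v = - ln (p v)" for v
  have L0: "0 \<le> L v" for v using pos[of v] le1[of v] by (simp add: L_def)
  have Lmono: "L u \<le> L v" if "u \<le> v" for u v using anti[OF that] pos by (simp add: L_def)
  have Ladd: "L (\<alpha> * u + \<beta> * v) \<le> L u + L v" if "0 \<le> \<alpha>" "0 \<le> \<beta>" "\<alpha>\<^sup>2 + \<beta>\<^sup>2 = 1" for \<alpha> \<beta> u v
  proof -
    have "ln (p u) + ln (p v) = ln (p u * p v)" using pos[of u] pos[of v] by (simp add: ln_mult)
    also have "\<dots> \<le> ln (p (\<alpha> * u + \<beta> * v))"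
      using mult[OF that, of u v] pos[of u] pos[of v] by (intro ln_mono) auto
    finally show ?thesis by (simp add: L_def)
  qed
  have Lsqrt: "L (sqrt (real (Suc n)) * u) \<le> real (Suc n) * L u" for n u
  proof (induction n)
    case (Suc n)
    \<comment> \<open>chosen so that \<open>\<alpha> \<surd>(n + 1) + \<beta> = \<surd>(n + 2)\<close>\<close>
    define \<alpha> where "\<alpha> = sqrt (real (Suc n) / real (Suc (Suc n)))"
    define \<beta> where "\<beta> = sqrt (1 / real (Suc (Suc n)))"
    have sq: "\<alpha>\<^sup>2 + \<beta>\<^sup>2 = 1" by (simp add: \<alpha>_def \<beta>_def field_simps)
    have "\<alpha> * sqrt (real (Suc n)) + \<beta> = sqrt (real (Suc (Suc n)))"
    proof -
      have "\<alpha> * sqrt (real (Suc n)) = real (Suc n) / sqrt (real (Suc (Suc n)))"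
        by (simp add: \<alpha>_def real_sqrt_divide)
      moreover have "\<beta> = 1 / sqrt (real (Suc (Suc n)))" by (simp add: \<beta>_def real_sqrt_divide)
      ultimately have "\<alpha> * sqrt (real (Suc n)) + \<beta> = real (Suc (Suc n)) / sqrt (real (Suc (Suc n)))"
        by (simp add: add_divide_distrib)
      then show ?thesis by (simp only: real_div_sqrt[OF of_nat_0_le_iff])
    qed
    then have "L (sqrt (real (Suc (Suc n))) * u) = L (\<alpha> * (sqrt (real (Suc n)) * u) + \<beta> * u)"
      by (simp only: mult.assoc[symmetric] distrib_right[symmetric])
    also have "\<dots> \<le> L (sqrt (real (Suc n)) * u) + L u"
      by (rule Ladd[OF _ _ sq]) (simp_all add: \<alpha>_def \<beta>_def)
    also have "\<dots> \<le> real (Suc (Suc n)) * L u" using Suc.IH by (simp add: algebra_simps)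
    finally show ?case .
  qed simp
  define S where "S = (\<lambda>v. L v / v\<^sup>2) ` {1..}"
  define l where "l = Inf S"
  have bdd: "bdd_below S" unfolding S_def by (rule bdd_belowI[of _ 0]) (auto simp: L0)
  have lower: "l * v\<^sup>2 \<le> L v" if "1 \<le> v" for v
  proof -
    have "l \<le> L v / v\<^sup>2" unfolding l_def by (rule cInf_lower[OF _ bdd]) (use that in \<open>auto simp: S_def\<close>)
    then show ?thesis using that by (simp add: field_simps)
  qed
  \<comment> \<open>a level at which the infimum is almost attained; larger \<open>v\<close> are compared with \<open>\<surd>n u\<close> for the integer part \<open>n - 1\<close> of \<open>v\<^sup>2/u\<^sup>2\<close>\<close>
  obtain u where u: "1 \<le> u" "L u / u\<^sup>2 < l + \<eta> / 4"
  proof -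
    have "\<exists>x\<in>S. x < l + \<eta> / 4"
      unfolding l_def using \<eta> bdd by (subst cInf_less_iff[symmetric]) (auto simp: S_def)
    then show ?thesis using that by (auto simp: S_def)
  qed
  have upper: "L v \<le> (l + \<eta> / 4) * v\<^sup>2 + L u" if v: "u \<le> v" for v
  proof -
    define n where "n = nat \<lfloor>v\<^sup>2 / u\<^sup>2\<rfloor>"
    have n: "real n \<le> v\<^sup>2 / u\<^sup>2" "v\<^sup>2 / u\<^sup>2 \<le> real (Suc n)"
      unfolding n_def using v u by (auto; linarith)+
    have "v = sqrt (v\<^sup>2 / u\<^sup>2) * u" using u v by (simp add: real_sqrt_divide)
    also have "\<dots> \<le> sqrt (real (Suc n)) * u" using n(2) u by (intro mult_right_mono) auto
    finally have "L v \<le> L (sqrt (real (Suc n)) * u)" by (rule Lmono)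
    also have "\<dots> \<le> real (Suc n) * L u" by (rule Lsqrt)
    also have "\<dots> = real n * L u + L u" by (simp add: algebra_simps)
    also have "real n * L u \<le> v\<^sup>2 / u\<^sup>2 * L u" using n(1) L0 by (intro mult_right_mono) auto
    also have "v\<^sup>2 / u\<^sup>2 * L u = (L u / u\<^sup>2) * v\<^sup>2" by simp
    also have "\<dots> \<le> (l + \<eta> / 4) * v\<^sup>2" using u(2) by (intro mult_right_mono) auto
    finally show ?thesis by simp
  qed
  have ev: "p (sqrt 2 * v) \<le> exp (\<eta> * v\<^sup>2) * (p v)\<^sup>2" if v: "u \<le> v" "4 * L u / \<eta> + 1 \<le> v" for v
  proof -
    have "1 \<le> v" using u v by simp
    have "1 \<le> sqrt 2 * v" using \<open>1 \<le> v\<close> by (meson less_eq_real_def mult_le_cancel_right1 order_trans real_sqrt_ge_1_iff one_le_numeral zero_less_one not_le)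
    from lower[OF this] have "2 * (l * v\<^sup>2) \<le> L (sqrt 2 * v)" by (simp add: power_mult_distrib)
    moreover have "L u \<le> \<eta> / 4 * v\<^sup>2"
    proof -
      have "4 * L u / \<eta> \<le> v" using v by simp
      also have "v \<le> v\<^sup>2" using \<open>1 \<le> v\<close> by (simp add: power2_eq_square)
      finally show ?thesis using \<eta> by (simp add: field_simps)
    qed
    moreover have "L v \<le> l * v\<^sup>2 + \<eta> / 4 * v\<^sup>2 + L u" using upper[OF v(1)] by (simp add: algebra_simps)
    ultimately have "- L (sqrt 2 * v) \<le> \<eta> * v\<^sup>2 + 2 * (- L v)" by linarith
    then have "exp (- L (sqrt 2 * v)) \<le> exp (\<eta> * v\<^sup>2 + 2 * (- L v))" by simp
    also have "\<dots> = exp (\<eta> * v\<^sup>2) * (exp (- L v))\<^sup>2" by (simp add: power2_eq_square flip: exp_add)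
    finally show ?thesis by (simp add: L_def pos)
  qed
  show ?thesis
    using eventually_ge_at_top[of u] eventually_ge_at_top[of "4 * L u / \<eta> + 1"]
    by eventually_elim (rule ev)
qed

section \<open>The tail of the minimum\<close>

context gaussian_path
begin

abbreviation path_min :: "'w \<Rightarrow> real" where "path_min \<omega> \<equiv> min_on b (\<lambda>t. X t \<omega>)"
abbreviation path_sup :: "'w \<Rightarrow> real" where "path_sup \<omega> \<equiv> path_norm b (\<lambda>t. X t \<omega>)"
abbreviation argmin_time :: "'w \<Rightarrow> real" where "argmin_time \<omega> \<equiv> argmin_on b (\<lambda>t. X t \<omega>)"

lemmas path_min_attained = min_on_attained[OF path_continuous b_nonneg]
lemmas argmin_time_correct = argmin_on_correct[OF path_continuous b_nonneg]
lemmas path_sup_bound = path_norm_bound[OF path_continuous b_nonneg]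
lemmas path_inf_eq_path_min = path_inf_eq_min_on[OF path_continuous b_nonneg]

lemma functional_measurable:
  assumes "F \<in> borel_measurable path_space"
  shows "(\<lambda>\<omega>. F (\<lambda>t. X t \<omega>)) \<in> borel_measurable M"
  using measurable_compose[OF path_measurable assms] .

lemma path_sup_measurable[measurable]: "path_sup \<in> borel_measurable M"
  by (rule functional_measurable) measurable

lemma min_measurable:
  assumes "0 \<le> a" "a \<le> b" shows "(\<lambda>\<omega>. min_on a (\<lambda>t. X t \<omega>)) \<in> borel_measurable M"
proof -
  have "(\<lambda>\<omega>. path_inf a (\<lambda>t. X t \<omega>)) \<in> borel_measurable M" by (rule functional_measurable) measurable
  moreover have "path_inf a (\<lambda>t. X t \<omega>) = min_on a (\<lambda>t. X t \<omega>)" if "\<omega> \<in> space M" for \<omega>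
    using assms by (intro path_inf_eq_min_on continuous_on_subset[OF path_continuous[OF that]]) auto
  ultimately show ?thesis by (simp cong: measurable_cong)
qed

lemma path_min_measurable[measurable]: "path_min \<in> borel_measurable M"
  using b_pos by (intro min_measurable) auto

lemma argmin_time_measurable[measurable]: "argmin_time \<in> borel_measurable M"
proof (rule borel_measurableI_le)
  fix a
  have "{\<omega>\<in>space M. argmin_time \<omega> \<le> a} \<in> sets M" if "0 \<le> a" "a \<le> b"
  proof -
    have [measurable]: "(\<lambda>\<omega>. min_on a (\<lambda>t. X t \<omega>)) \<in> borel_measurable M" by (rule min_measurable[OF that])
    have "{\<omega>\<in>space M. argmin_time \<omega> \<le> a} = {\<omega>\<in>space M. min_on a (\<lambda>t. X t \<omega>) \<le> path_min \<omega>}"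
      using argmin_on_le_iff[OF path_continuous that] by auto
    then show ?thesis by simp
  qed
  moreover have "{\<omega>\<in>space M. argmin_time \<omega> \<le> a} = {}" if "a < 0"
    using that argmin_time_correct(1) by fastforce
  moreover have "{\<omega>\<in>space M. argmin_time \<omega> \<le> a} = space M" if "b < a"
    using that argmin_time_correct(1) by fastforce
  ultimately show "{\<omega>\<in>space M. argmin_time \<omega> \<le> a} \<in> sets M"
    by (metis linorder_not_le sets.empty_sets sets.top)
qed

text \<open>The rotated pair \<open>(\<alpha>X + \<beta>X', -\<beta>X + \<alpha>X')\<close> consists of independent copies of \<open>X\<close>. This is the form in which rotation
invariance is applied below.\<close>
lemma rotation_product:
  fixes G H :: "(real \<Rightarrow> real) \<Rightarrow> ennreal"
  assumes ab: "\<alpha>\<^sup>2 + \<beta>\<^sup>2 = 1"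
    and G: "G \<in> borel_measurable path_space" and H: "H \<in> borel_measurable path_space"
  shows "(\<integral>\<^sup>+z. G (\<lambda>t. \<alpha> * X t (fst z) + \<beta> * X t (snd z)) * H (\<lambda>t. - \<beta> * X t (fst z) + \<alpha> * X t (snd z)) \<partial>MM)
    = (\<integral>\<^sup>+\<omega>. G (\<lambda>t. X t \<omega>) \<partial>M) * (\<integral>\<^sup>+\<omega>. H (\<lambda>t. X t \<omega>) \<partial>M)"
proof -
  have [measurable]: "(\<lambda>(x :: real \<times> bool \<Rightarrow> real) t. x (t, c)) \<in> measurable path_space path_space" for c
    by (rule measurable_PiM_single') (auto simp: space_PiM)
  have GH: "(\<lambda>x. G (\<lambda>t. x (t, False)) * H (\<lambda>t. x (t, True))) \<in> borel_measurable path_space"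
    by (intro borel_measurable_times_ennreal measurable_compose[OF _ G] measurable_compose[OF _ H]) measurable
  have mG[measurable]: "(\<lambda>\<omega>. G (\<lambda>t. X t \<omega>)) \<in> borel_measurable M" by (rule functional_measurable[OF G])
  have mH[measurable]: "(\<lambda>\<omega>. H (\<lambda>t. X t \<omega>)) \<in> borel_measurable M" by (rule functional_measurable[OF H])
  have "(\<integral>\<^sup>+z. G (\<lambda>t. \<alpha> * X t (fst z) + \<beta> * X t (snd z)) * H (\<lambda>t. - \<beta> * X t (fst z) + \<alpha> * X t (snd z)) \<partial>MM)
     = (\<integral>\<^sup>+z. G (\<lambda>t. X t (fst z)) * H (\<lambda>t. X t (snd z)) \<partial>MM)"
    using rotation_nn_integral[OF ab GH] by (simp add: rotate_pair_def)
  also have "\<dots> = (\<integral>\<^sup>+\<omega>. (\<integral>\<^sup>+\<omega>'. G (\<lambda>t. X t \<omega>) * H (\<lambda>t. X t \<omega>') \<partial>M) \<partial>M)"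
    by (subst nn_integral_fst[symmetric]) auto
  also have "\<dots> = (\<integral>\<^sup>+\<omega>. G (\<lambda>t. X t \<omega>) \<partial>M) * (\<integral>\<^sup>+\<omega>. H (\<lambda>t. X t \<omega>) \<partial>M)"
    by (simp add: nn_integral_cmult nn_integral_multc)
  finally show ?thesis .
qed

lemma product_functionals:
  fixes G H :: "'w \<Rightarrow> ennreal"
  assumes [measurable]: "G \<in> borel_measurable M" "H \<in> borel_measurable M"
  shows "(\<integral>\<^sup>+z. G (fst z) * H (snd z) \<partial>MM) = (\<integral>\<^sup>+\<omega>. G \<omega> \<partial>M) * (\<integral>\<^sup>+\<omega>. H \<omega> \<partial>M)"
  by (subst nn_integral_fst[symmetric]) (auto simp: nn_integral_cmult nn_integral_multc)

definition min_tail :: "real \<Rightarrow> real" where "min_tail v = measure M (exceed_event M X b v)"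

lemma exceed_sets[measurable]: "exceed_event M X b v \<in> sets M"
  unfolding exceed_event_def by measurable

lemma min_tail_nn: "ennreal (min_tail v) = (\<integral>\<^sup>+\<omega>. indicator {v<..} (path_min \<omega>) \<partial>M)"
proof -
  have "(\<integral>\<^sup>+\<omega>. indicator {v<..} (path_min \<omega>) \<partial>M) = (\<integral>\<^sup>+\<omega>. indicator (exceed_event M X b v) \<omega> \<partial>M)"
    by (intro nn_integral_cong) (auto simp: exceed_event_def indicator_def)
  then show ?thesis by (simp add: min_tail_def emeasure_eq_measure)
qed

lemma min_tail_antimono: "u \<le> v \<Longrightarrow> min_tail v \<le> min_tail u"
  unfolding min_tail_def by (intro finite_measure_mono) (auto simp: exceed_event_def)

lemma path_continuous2:
  assumes "z \<in> space MM"
  shows "continuous_on {0..b} (\<lambda>t. \<alpha> * X t (fst z) + \<beta> * X t (snd z))"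
  using assms by (intro continuous_intros path_continuous) (auto simp: space_pair_measure)

text \<open>If \<open>X > u\<close> and \<open>X' > v\<close> on the interval, then \<open>\<alpha>X + \<beta>X' > \<alpha>u + \<beta>v\<close>, and \<open>\<alpha>X + \<beta>X'\<close> is a copy of \<open>X\<close>.\<close>
lemma min_tail_mult:
  assumes "0 \<le> \<alpha>" "0 \<le> \<beta>" "\<alpha>\<^sup>2 + \<beta>\<^sup>2 = 1"
  shows "min_tail u * min_tail v \<le> min_tail (\<alpha> * u + \<beta> * v)"
proof -
  let ?w = "\<alpha> * u + \<beta> * v"
  let ?G = "\<lambda>x. indicator {?w<..} (path_inf b x) :: ennreal"
  have "ennreal (min_tail u * min_tail v) = (\<integral>\<^sup>+z. indicator {u<..} (path_min (fst z)) * indicator {v<..} (path_min (snd z)) \<partial>MM)"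
  proof -
    have "(\<lambda>\<omega>. indicator {u<..} (path_min \<omega>) :: ennreal) \<in> borel_measurable M" for u by measurable
    from product_functionals[OF this this, of u v] show ?thesis
      by (simp add: ennreal_mult min_tail_nn[symmetric] min_tail_def)
  qed
  also have "\<dots> \<le> (\<integral>\<^sup>+z. ?G (\<lambda>t. \<alpha> * X t (fst z) + \<beta> * X t (snd z)) * 1 \<partial>MM)"
  proof (rule nn_integral_mono)
    fix z assume z: "z \<in> space MM"
    then have z': "fst z \<in> space M" "snd z \<in> space M" by (auto simp: space_pair_measure)
    note c = path_continuous2[OF z, of \<alpha> \<beta>]
    have "?w < min_on b (\<lambda>t. \<alpha> * X t (fst z) + \<beta> * X t (snd z))" if "u < path_min (fst z)" "v < path_min (snd z)"
    proof -
      obtain t where t: "t \<in> {0..b}" "\<alpha> * X t (fst z) + \<beta> * X t (snd z) = min_on b (\<lambda>t. \<alpha> * X t (fst z) + \<beta> * X t (snd z))"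
        using min_on_attained(1)[OF c] b_pos by auto
      have 1: "u < X t (fst z)" "v < X t (snd z)"
        using path_min_attained(2)[OF z'(1) t(1)] path_min_attained(2)[OF z'(2) t(1)] that by auto
      have "\<alpha> \<noteq> 0 \<or> \<beta> \<noteq> 0" using assms by auto
      then have "?w < \<alpha> * X t (fst z) + \<beta> * X t (snd z)"
        using 1 assms(1,2)
        by (metis (no_types, lifting) add_less_le_mono add_le_less_mono less_imp_le mult_left_mono mult_strict_left_mono order_le_less)
      then show ?thesis using t(2) by simp
    qed
    then show "indicator {u<..} (path_min (fst z)) * indicator {v<..} (path_min (snd z))
        \<le> ?G (\<lambda>t. \<alpha> * X t (fst z) + \<beta> * X t (snd z)) * 1"
      using path_inf_eq_min_on[OF c] b_pos by (auto simp: indicator_def)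
  qed
  also have "\<dots> = (\<integral>\<^sup>+\<omega>. ?G (\<lambda>t. X t \<omega>) \<partial>M) * (\<integral>\<^sup>+\<omega>. 1 \<partial>M)"
    using rotation_product[OF assms(3), of ?G "\<lambda>_. 1"] by simp
  also have "\<dots> = ennreal (min_tail ?w)"
    by (simp add: min_tail_nn emeasure_space_1 path_inf_eq_path_min cong: nn_integral_cong)
  finally show ?thesis by (simp add: min_tail_def)
qed

definition sup_tail :: "real \<Rightarrow> real" where "sup_tail t = measure M {\<omega>\<in>space M. t < path_sup \<omega>}"

lemma sup_tail_nn: "ennreal (sup_tail v) = (\<integral>\<^sup>+\<omega>. indicator {v<..} (path_sup \<omega>) \<partial>M)"
proof -
  have "(\<integral>\<^sup>+\<omega>. indicator {v<..} (path_sup \<omega>) \<partial>M) = (\<integral>\<^sup>+\<omega>. indicator {\<omega>\<in>space M. v < path_sup \<omega>} \<omega> \<partial>M)"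
    by (intro nn_integral_cong) (auto simp: indicator_def)
  then show ?thesis by (simp add: sup_tail_def emeasure_eq_measure)
qed

text \<open>If \<open>(X + X')/\<surd>2\<close> exceeds \<open>t\<close> in absolute value at some time while \<open>(X' - X)/\<surd>2\<close> is bounded by \<open>s\<close>, then at that time
both \<open>X\<close> and \<open>X'\<close> exceed \<open>(t - s)/\<surd>2\<close> in absolute value.\<close>
lemma fernique_step: "(1 - sup_tail s) * sup_tail t \<le> (sup_tail ((t - s) / sqrt 2))\<^sup>2"
proof -
  let ?r = "(t - s) / sqrt 2" and ?a = "1 / sqrt 2 :: real"
  let ?G = "\<lambda>x. indicator {t<..} (path_norm b x) :: ennreal" and ?H = "\<lambda>x. indicator {..s} (path_norm b x) :: ennreal"
  have ab: "?a\<^sup>2 + ?a\<^sup>2 = 1" by (simp add: power_divide)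
  have H: "(\<integral>\<^sup>+\<omega>. ?H (\<lambda>t. X t \<omega>) \<partial>M) = ennreal (1 - sup_tail s)"
  proof -
    have "(\<integral>\<^sup>+\<omega>. ?H (\<lambda>t. X t \<omega>) \<partial>M) = (\<integral>\<^sup>+\<omega>. indicator (space M - {\<omega>\<in>space M. s < path_sup \<omega>}) \<omega> \<partial>M)"
      by (intro nn_integral_cong) (auto simp: indicator_def)
    then show ?thesis by (simp add: emeasure_eq_measure prob_compl sup_tail_def)
  qed
  have "ennreal ((1 - sup_tail s) * sup_tail t) = (\<integral>\<^sup>+\<omega>. ?G (\<lambda>t. X t \<omega>) \<partial>M) * (\<integral>\<^sup>+\<omega>. ?H (\<lambda>t. X t \<omega>) \<partial>M)"
    unfolding H sup_tail_nn[symmetric] by (simp add: ennreal_mult sup_tail_def mult.commute)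
  also have "\<dots> = (\<integral>\<^sup>+z. ?G (\<lambda>t. ?a * X t (fst z) + ?a * X t (snd z)) * ?H (\<lambda>t. - ?a * X t (fst z) + ?a * X t (snd z)) \<partial>MM)"
    by (rule rotation_product[OF ab, symmetric]) measurable
  also have "\<dots> \<le> (\<integral>\<^sup>+z. indicator {?r<..} (path_sup (fst z)) * indicator {?r<..} (path_sup (snd z)) \<partial>MM)"
  proof (rule nn_integral_mono)
    fix z assume z: "z \<in> space MM"
    then have z': "fst z \<in> space M" "snd z \<in> space M" by (auto simp: space_pair_measure)
    let ?U = "\<lambda>t. ?a * X t (fst z) + ?a * X t (snd z)" and ?V = "\<lambda>t. - ?a * X t (fst z) + ?a * X t (snd z)"
    note cU = path_norm_bound[OF path_continuous2[OF z, of ?a ?a] b_nonneg]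
    note cV = path_norm_bound[OF path_continuous2[OF z, of "- ?a" ?a] b_nonneg]
    have "?r < path_sup (fst z) \<and> ?r < path_sup (snd z)" if *: "t < path_norm b ?U" "path_norm b ?V \<le> s"
    proof -
      obtain q where q: "q \<in> {0..b}" "\<bar>?U q\<bar> = path_norm b ?U" using cU(2) by blast
      have V: "\<bar>?V q\<bar> \<le> s" using cV(1)[OF q(1)] * by linarith
      define x y where "x = X q (fst z)" and "y = X q (snd z)"
      have "x = (?U q - ?V q) / sqrt 2" "y = (?U q + ?V q) / sqrt 2"
        by (simp_all add: field_simps x_def y_def)
      then have "\<bar>x\<bar> = \<bar>?U q - ?V q\<bar> / sqrt 2" "\<bar>y\<bar> = \<bar>?U q + ?V q\<bar> / sqrt 2"
        by (simp_all only: abs_divide abs_of_pos[OF real_sqrt_gt_zero] zero_less_numeral)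
      moreover have "t - s < \<bar>?U q - ?V q\<bar>" "t - s < \<bar>?U q + ?V q\<bar>" using q * V by linarith+
      ultimately have "?r < \<bar>x\<bar>" "?r < \<bar>y\<bar>"
        by (simp_all only: divide_strict_right_mono real_sqrt_gt_zero zero_less_numeral)
      then have "?r < \<bar>X q (fst z)\<bar>" "?r < \<bar>X q (snd z)\<bar>" by (simp_all add: x_def y_def)
      then show ?thesis using path_sup_bound(1)[OF z'(1) q(1)] path_sup_bound(1)[OF z'(2) q(1)] by linarith
    qed
    then show "?G ?U * ?H ?V \<le> indicator {?r<..} (path_sup (fst z)) * indicator {?r<..} (path_sup (snd z))"
      by (auto simp: indicator_def)
  qed
  also have "\<dots> = ennreal (sup_tail ?r * sup_tail ?r)"
  proof -
    have "(\<lambda>\<omega>. indicator {u<..} (path_sup \<omega>) :: ennreal) \<in> borel_measurable M" for u by measurable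
    from product_functionals[OF this this, of ?r ?r] show ?thesis
      by (simp add: ennreal_mult sup_tail_nn[symmetric] sup_tail_def)
  qed
  finally show ?thesis by (simp add: power2_eq_square sup_tail_def)
qed

end

section \<open>Gaussian tail of the supremum norm\<close>

context gaussian_path
begin

lemma sup_tail_bounds: "0 \<le> sup_tail t" "sup_tail t \<le> 1" "s \<le> t \<Longrightarrow> sup_tail t \<le> sup_tail s"
  unfolding sup_tail_def by (auto intro!: finite_measure_mono)

lemma sup_tail_small: "0 < e \<Longrightarrow> \<exists>s\<ge>1. sup_tail s < e"
proof -
  assume e: "0 < e"
  have "(\<lambda>n. measure M {\<omega>\<in>space M. real n < path_sup \<omega>}) \<longlonglongrightarrow> measure M (\<Inter>n. {\<omega>\<in>space M. real n < path_sup \<omega>})"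
    by (rule finite_Lim_measure_decseq) (auto simp: decseq_def)
  moreover have "(\<Inter>n. {\<omega>\<in>space M. real n < path_sup \<omega>}) = {}"
  proof -
    have "\<exists>n. \<not> real n < path_sup \<omega>" for \<omega> using reals_Archimedean2[of "path_sup \<omega>"] by (auto intro: less_asym)
    then show ?thesis by blast
  qed
  ultimately have "(\<lambda>n. sup_tail (real n)) \<longlonglongrightarrow> 0" by (simp add: sup_tail_def)
  from order_tendstoD(2)[OF this e] have "\<forall>\<^sub>F n in sequentially. sup_tail (real n) < e" .
  from eventually_conj[OF this eventually_ge_at_top[of 1]]
  obtain n where "sup_tail (real n) < e" "1 \<le> n" by (auto dest: eventually_happens)
  then show ?thesis by (intro exI[of _ "real n"]) auto
qed

text \<open>Iterates the previous inequality along \<open>t\<^sub>0 = s\<close>, \<open>t\<^sub>n\<^sub>+\<^sub>1 = s + \<surd>2 t\<^sub>n\<close>, where the ratio of the two probabilities is squared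
at each step and \<open>t\<^sub>n\<close> grows like \<open>\<surd>2\<^sup>n\<close>.\<close>
lemma fernique_tail: "\<exists>K>0. \<forall>n. sup_tail (K * sqrt 2 ^ n) \<le> (1/2) ^ (2 ^ n)"
proof -
  obtain s where s: "1 \<le> s" "sup_tail s < 1/4" using sup_tail_small[of "1/4"] by auto
  \<comment> \<open>the fixed point of \<open>t \<mapsto> s + \<surd>2 t\<close> is \<open>- c\<close>, so \<open>t n + c\<close> is geometric\<close>
  define c where "c = s / (sqrt 2 - 1)"
  have c: "s + c = sqrt 2 * c" "0 \<le> c" using s by (auto simp: c_def field_simps)
  define t where "t n = sqrt 2 ^ n * (s + c) - c" for n
  have step: "(t (Suc n) - s) / sqrt 2 = t n" for n
  proof -
    have "t (Suc n) - s = sqrt 2 * (sqrt 2 ^ n * (s + c)) - (s + c)" by (simp add: t_def mult.assoc)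
    also have "\<dots> = sqrt 2 * t n" unfolding t_def by (simp only: c(1) right_diff_distrib)
    finally show ?thesis by simp
  qed
  define r where "r u = sup_tail u / (1 - sup_tail s)" for u
  have r: "r (t n) \<le> (1/2) ^ (2 ^ n)" for n
  proof (induction n)
    case 0
    then show ?case using s by (simp add: r_def t_def field_simps)
  next
    case (Suc n)
    have "r (t (Suc n)) = (1 - sup_tail s) * sup_tail (t (Suc n)) / (1 - sup_tail s)\<^sup>2"
      using s by (simp add: r_def power2_eq_square)
    also have "\<dots> \<le> (sup_tail (t n))\<^sup>2 / (1 - sup_tail s)\<^sup>2"
      using fernique_step[of s "t (Suc n)"] unfolding step by (intro divide_right_mono) auto
    also have "\<dots> = (r (t n))\<^sup>2" by (simp add: r_def power_divide)
    also have "\<dots> \<le> ((1/2) ^ (2 ^ n))\<^sup>2"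
      using s sup_tail_bounds(1)[of "t n"] by (intro power_mono Suc.IH) (auto simp: r_def)
    also have "\<dots> = (1/2) ^ (2 ^ Suc n)" by (simp add: power_mult[symmetric] mult.commute)
    finally show ?case .
  qed
  have "sup_tail ((s + c) * sqrt 2 ^ n) \<le> (1/2) ^ (2 ^ n)" for n
  proof -
    have "sup_tail ((s + c) * sqrt 2 ^ n) \<le> sup_tail (t n)"
      using c by (intro sup_tail_bounds) (simp add: t_def mult.commute)
    also have "\<dots> \<le> r (t n)"
      unfolding r_def using s sup_tail_bounds[of s] sup_tail_bounds(1)[of "t n"]
      by (intro mult_imp_le_div_pos) (auto intro: mult_left_le)
    also have "\<dots> \<le> (1/2) ^ (2 ^ n)" by (rule r)
    finally show ?thesis .
  qed
  moreover have "0 < s + c" using s c by linarith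
  ultimately show ?thesis by blast
qed

text \<open>The dyadic tail bound is summable against \<open>exp(\<alpha>x\<^sup>2)\<close> when \<open>exp(2\<alpha>K\<^sup>2) = 3/2\<close>: the \<open>n\<close>-th shell contributes
\<open>(3/2 \<cdot> 1/2)\<close> to the power \<open>2\<^sup>n\<close>.\<close>
theorem fernique: "\<exists>\<alpha>>0. integrable M (\<lambda>\<omega>. exp (\<alpha> * (path_sup \<omega>)\<^sup>2))"
proof -
  obtain K where K: "0 < K" "\<And>n. sup_tail (K * sqrt 2 ^ n) \<le> (1/2) ^ (2 ^ n)" using fernique_tail by auto
  define \<alpha> where "\<alpha> = ln (3/2) / (2 * K\<^sup>2)"
  have \<alpha>: "0 < \<alpha>" using K by (simp add: \<alpha>_def)
  have base: "exp (\<alpha> * (K * sqrt 2 ^ Suc n)\<^sup>2) = (3/2) ^ (2 ^ n)" for n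
  proof -
    have "(K * sqrt 2 ^ Suc n)\<^sup>2 = K\<^sup>2 * 2 * 2 ^ n"
      by (simp add: power_mult_distrib power_mult[symmetric] mult.commute[of _ 2] del: power_Suc)
         (simp add: power_mult)
    then have "\<alpha> * (K * sqrt 2 ^ Suc n)\<^sup>2 = ln (3/2) * (2 ^ n)" using K by (simp add: \<alpha>_def)
    then have "exp (\<alpha> * (K * sqrt 2 ^ Suc n)\<^sup>2) = exp (of_nat (2 ^ n) * ln (3/2))" by (simp add: mult.commute)
    also have "\<dots> = exp (ln (3/2)) ^ (2 ^ n)" by (rule exp_of_nat_mult)
    finally show ?thesis by simp
  qed
  have single_le_suminf: "f n \<le> (\<Sum>n. f n)" for f :: "nat \<Rightarrow> ennreal" and n
    using sum_le_suminf[OF summableI, of "{n}" f] by simp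
  have pt: "ennreal (exp (\<alpha> * x\<^sup>2)) \<le> ennreal (exp (\<alpha> * K\<^sup>2))
      + (\<Sum>n. ennreal ((3/2) ^ (2 ^ n)) * indicator {K * sqrt 2 ^ n<..} x)" if "0 \<le> x" for x
  proof (cases "x \<le> K")
    case True
    then have "exp (\<alpha> * x\<^sup>2) \<le> exp (\<alpha> * K\<^sup>2)" using that \<alpha> by (simp add: power_mono)
    then show ?thesis by (meson add_increasing2 ennreal_leI zero_le)
  next
    case False
    have "\<exists>n. x / K < sqrt 2 ^ n" by (rule real_arch_pow) simp
    then obtain n0 where n0: "x \<le> K * sqrt 2 ^ n0" using K by (auto simp: field_simps intro: less_imp_le)
    define k where "k = (LEAST n. x \<le> K * sqrt 2 ^ n)"
    have k: "x \<le> K * sqrt 2 ^ k" unfolding k_def using n0 by (rule LeastI)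
    with False obtain n where n: "k = Suc n" by (cases k) auto
    have n': "K * sqrt 2 ^ n < x" using not_less_Least[of n "\<lambda>n. x \<le> K * sqrt 2 ^ n"] n unfolding k_def by auto
    have "exp (\<alpha> * x\<^sup>2) \<le> exp (\<alpha> * (K * sqrt 2 ^ Suc n)\<^sup>2)"
      using k that \<alpha> unfolding n by (simp add: power_mono del: power_Suc)
    then have "ennreal (exp (\<alpha> * x\<^sup>2)) \<le> ennreal ((3/2) ^ (2 ^ n)) * indicator {K * sqrt 2 ^ n<..} x"
      unfolding base using n' by (simp add: ennreal_leI)
    also have "\<dots> \<le> (\<Sum>n. ennreal ((3/2) ^ (2 ^ n)) * indicator {K * sqrt 2 ^ n<..} x)"
      by (rule single_le_suminf)
    finally show ?thesis by (simp add: add_increasing)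
  qed
  have "(\<integral>\<^sup>+\<omega>. ennreal (exp (\<alpha> * (path_sup \<omega>)\<^sup>2)) \<partial>M) \<le>
     (\<integral>\<^sup>+\<omega>. (ennreal (exp (\<alpha> * K\<^sup>2)) + (\<Sum>n. ennreal ((3/2) ^ (2 ^ n)) * indicator {K * sqrt 2 ^ n<..} (path_sup \<omega>))) \<partial>M)"
    by (intro nn_integral_mono pt path_sup_bound)
  also have "\<dots> = ennreal (exp (\<alpha> * K\<^sup>2)) + (\<Sum>n. ennreal ((3/2) ^ (2 ^ n)) * ennreal (sup_tail (K * sqrt 2 ^ n)))"
    by (simp add: nn_integral_add nn_integral_suminf nn_integral_cmult emeasure_space_1 sup_tail_nn)
  also have "\<dots> \<le> ennreal (exp (\<alpha> * K\<^sup>2)) + (\<Sum>n. ennreal ((3/4) ^ n))"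
  proof (intro add_left_mono suminf_le summableI)
    fix n
    have "(3/2) ^ (2 ^ n) * sup_tail (K * sqrt 2 ^ n) \<le> (3/2) ^ (2 ^ n) * (1/2) ^ (2 ^ n)"
      by (intro mult_left_mono K) auto
    also have "\<dots> = (3/4 :: real) ^ (2 ^ n)" by (simp add: power_mult_distrib[symmetric])
    also have "\<dots> \<le> (3/4) ^ n" by (intro power_decreasing less_imp_le[OF less_exp]) auto
    finally show "ennreal ((3/2) ^ (2 ^ n)) * ennreal (sup_tail (K * sqrt 2 ^ n)) \<le> ennreal ((3/4) ^ n)"
      by (simp add: ennreal_mult[symmetric] sup_tail_bounds ennreal_leI)
  qed
  also have "(\<Sum>n. ennreal ((3/4) ^ n)) = ennreal (\<Sum>n. (3/4) ^ n)"
    by (rule suminf_ennreal2) (auto intro: summable_geometric)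
  finally have "(\<integral>\<^sup>+\<omega>. ennreal (exp (\<alpha> * (path_sup \<omega>)\<^sup>2)) \<partial>M) < \<infinity>"
    by (metis ennreal_add_eq_top ennreal_neq_top infinity_ennreal_def le_less_trans top.not_eq_extremum)
  then have "integrable M (\<lambda>\<omega>. exp (\<alpha> * (path_sup \<omega>)\<^sup>2))"
    by (intro integrableI_nonneg) auto
  then show ?thesis using \<alpha> by blast
qed

lemma path_sup_square_integrable: "integrable M (\<lambda>\<omega>. (path_sup \<omega>)\<^sup>2)"
proof -
  obtain \<alpha> where \<alpha>: "0 < \<alpha>" "integrable M (\<lambda>\<omega>. exp (\<alpha> * (path_sup \<omega>)\<^sup>2))" using fernique by auto
  have "integrable M (\<lambda>\<omega>. exp (\<alpha> * (path_sup \<omega>)\<^sup>2) / \<alpha>)" using \<alpha> by simp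
  then show ?thesis
  proof (rule Bochner_Integration.integrable_bound)
    have "\<alpha> * x\<^sup>2 \<le> exp (\<alpha> * x\<^sup>2)" for x
      using exp_ge_add_one_self[of "\<alpha> * x\<^sup>2"] by linarith
    then have "x\<^sup>2 \<le> exp (\<alpha> * x\<^sup>2) / \<alpha>" for x
      using \<alpha>(1) by (simp add: field_simps)
    then show "AE \<omega> in M. norm ((path_sup \<omega>)\<^sup>2) \<le> norm (exp (\<alpha> * (path_sup \<omega>)\<^sup>2) / \<alpha>)" using \<alpha>(1) by simp
  qed measurable
qed

lemma path_sup_integrable: "integrable M path_sup"
  by (rule square_integrable_imp_integrable[OF _ path_sup_square_integrable]) measurable

text \<open>Chernoff's bound for the moment of Fernique's theorem, half of whose exponent absorbs the factor \<open>\<parallel>X\<parallel>\<close>.\<close>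
lemma path_sup_tail: "\<exists>\<gamma>>0. \<exists>C\<ge>0. \<forall>t\<ge>0. (\<integral>\<^sup>+\<omega>. ennreal (path_sup \<omega>) * indicator {t<..} (path_sup \<omega>) \<partial>M) \<le> ennreal (C * exp (- \<gamma> * t\<^sup>2))"
proof -
  obtain \<alpha> where \<alpha>: "0 < \<alpha>" "integrable M (\<lambda>\<omega>. exp (\<alpha> * (path_sup \<omega>)\<^sup>2))" using fernique by auto
  define E where "E = (LINT \<omega>|M. exp (\<alpha> * (path_sup \<omega>)\<^sup>2))"
  have E0: "0 \<le> E" unfolding E_def by (rule integral_nonneg_AE) auto
  have pt: "x * indicator {t<..} x \<le> (1 + 2 / \<alpha>) * exp (- (\<alpha> / 2) * t\<^sup>2) * exp (\<alpha> * x\<^sup>2)" if "0 \<le> x" "0 \<le> t" for x t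
  proof (cases "t < x")
    case True
    have "x \<le> 1 + x\<^sup>2" using sum_squares_bound[of x 1] that by simp
    also have "\<dots> \<le> (1 + 2 / \<alpha>) * exp (\<alpha> / 2 * x\<^sup>2)"
    proof -
      have "1 \<le> exp (\<alpha> / 2 * x\<^sup>2)" using \<alpha> by simp
      moreover have "x\<^sup>2 \<le> 2 / \<alpha> * exp (\<alpha> / 2 * x\<^sup>2)"
        using exp_ge_add_one_self[of "\<alpha> / 2 * x\<^sup>2"] \<alpha> by (simp add: field_simps)
      ultimately show ?thesis by (simp only: distrib_right mult_1)
    qed
    also have "\<dots> \<le> (1 + 2 / \<alpha>) * (exp (- (\<alpha> / 2) * t\<^sup>2) * exp (\<alpha> * x\<^sup>2))"
    proof (rule mult_left_mono)
      have "exp (\<alpha> / 2 * x\<^sup>2) = exp (- (\<alpha> / 2) * x\<^sup>2) * exp (\<alpha> * x\<^sup>2)" by (simp flip: exp_add)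
      also have "\<dots> \<le> exp (- (\<alpha> / 2) * t\<^sup>2) * exp (\<alpha> * x\<^sup>2)"
        using True \<alpha> that by (intro mult_right_mono) (auto simp: power_mono)
      finally show "exp (\<alpha> / 2 * x\<^sup>2) \<le> exp (- (\<alpha> / 2) * t\<^sup>2) * exp (\<alpha> * x\<^sup>2)" .
    qed (use \<alpha> in simp)
    finally show ?thesis using True by (simp add: mult.assoc)
  qed (use \<alpha> in auto)
  have "(\<integral>\<^sup>+\<omega>. ennreal (path_sup \<omega>) * indicator {t<..} (path_sup \<omega>) \<partial>M) \<le> ennreal (((1 + 2 / \<alpha>) * E) * exp (- (\<alpha> / 2) * t\<^sup>2))"
    if t: "0 \<le> t" for t
  proof -
    have "(\<integral>\<^sup>+\<omega>. ennreal (path_sup \<omega>) * indicator {t<..} (path_sup \<omega>) \<partial>M)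
       = (\<integral>\<^sup>+\<omega>. ennreal (path_sup \<omega> * indicator {t<..} (path_sup \<omega>)) \<partial>M)"
      by (intro nn_integral_cong) (auto simp: indicator_def)
    also have "\<dots> \<le> (\<integral>\<^sup>+\<omega>. ennreal ((1 + 2 / \<alpha>) * exp (- (\<alpha> / 2) * t\<^sup>2) * exp (\<alpha> * (path_sup \<omega>)\<^sup>2)) \<partial>M)"
      by (intro nn_integral_mono ennreal_leI pt path_sup_bound t)
    also have "\<dots> = ennreal (LINT \<omega>|M. (1 + 2 / \<alpha>) * exp (- (\<alpha> / 2) * t\<^sup>2) * exp (\<alpha> * (path_sup \<omega>)\<^sup>2))"
      using \<alpha> by (intro nn_integral_eq_integral) auto
    finally show ?thesis by (simp add: E_def mult_ac)
  qed
  then show ?thesis using \<alpha>(1) E0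
    by (intro exI[of _ "\<alpha> / 2"] conjI exI[of _ "(1 + 2 / \<alpha>) * E"]) auto
qed

section \<open>The distance of two independent exceeding paths\<close>

definition excess :: "real \<Rightarrow> real" where "excess v = (LINT \<omega>|M. max 0 (path_min \<omega> - v))"

lemma path_min_integrable: "integrable M path_min"
  by (rule Bochner_Integration.integrable_bound[OF path_sup_integrable]) (use path_sup_bound in auto)

lemma excess_integrable: "integrable M (\<lambda>\<omega>. max 0 (path_min \<omega> - v))"
  using path_min_integrable by (intro integrable_max Bochner_Integration.integrable_diff) auto

lemma excess_nn: "(\<integral>\<^sup>+\<omega>. ennreal (max 0 (path_min \<omega> - v)) \<partial>M) = ennreal (excess v)" "0 \<le> excess v"
  unfolding excess_def by (rule nn_integral_eq_integral[OF excess_integrable]) (auto intro!: integral_nonneg_AE)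

abbreviation path_gap :: "'w \<times> 'w \<Rightarrow> real" where "path_gap z \<equiv> path_norm b (\<lambda>t. - 1 * X t (fst z) + 1 * X t (snd z))"

lemma path_gap_measurable[measurable]: "path_gap \<in> borel_measurable MM"
proof -
  have "(\<lambda>z t. - 1 * X t (fst z) + 1 * X t (snd z)) \<in> measurable MM path_space"
    by (rule measurable_PiM_single') (auto simp: space_PiM)
  from measurable_compose[OF this measurable_path_norm] show ?thesis .
qed

text \<open>Two independent paths that both exceed \<open>v\<close> are far apart only at a price: if their distance is more than
\<open>\<delta>\<close>, then \<open>U = (X + X')/\<surd>2\<close> has minimum at least \<open>(m + m')/\<surd>2 > \<surd>2 v\<close> and the independent copy \<open>V = (X' - X)/\<surd>2\<close> has norm
above \<open>\<delta>/\<surd>2\<close>. The two terms on the right are the contributions of close and of distant pairs.\<close>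
lemma discrepancy_bound:
  assumes \<delta>: "0 \<le> \<delta>"
  shows "(\<integral>\<^sup>+z. indicator {v<..} (path_min (fst z)) * ennreal (max 0 (path_min (snd z) - v)) * ennreal (path_gap z) \<partial>MM)
    \<le> ennreal (\<delta> * min_tail v * excess v)
      + ennreal (2 * excess (sqrt 2 * v)) * (\<integral>\<^sup>+\<omega>. ennreal (path_sup \<omega>) * indicator {\<delta> / sqrt 2<..} (path_sup \<omega>) \<partial>M)"
proof -
  let ?a = "1 / sqrt 2 :: real"
  let ?G = "\<lambda>x. ennreal (2 * max 0 (path_inf b x - sqrt 2 * v))"
  let ?H = "\<lambda>x. ennreal (path_norm b x) * indicator {\<delta> / sqrt 2<..} (path_norm b x)"
  let ?U = "\<lambda>z t. ?a * X t (fst z) + ?a * X t (snd z)" and ?V = "\<lambda>z t. - ?a * X t (fst z) + ?a * X t (snd z)"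
  have ab: "?a\<^sup>2 + ?a\<^sup>2 = 1" by (simp add: power_divide)
  have GH[measurable]: "?G \<in> borel_measurable path_space" "?H \<in> borel_measurable path_space"
    by measurable
  have UV[measurable]: "?U \<in> measurable MM path_space" "?V \<in> measurable MM path_space"
    by (rule measurable_PiM_single'; auto simp: space_PiM)+
  have mGH: "(\<lambda>z. ?G (?U z)) \<in> borel_measurable MM" "(\<lambda>z. ?H (?V z)) \<in> borel_measurable MM"
    by (rule measurable_compose[OF UV(1) GH(1)], rule measurable_compose[OF UV(2) GH(2)])
  have "(\<integral>\<^sup>+z. indicator {v<..} (path_min (fst z)) * ennreal (max 0 (path_min (snd z) - v)) * ennreal (path_gap z) \<partial>MM)
    \<le> (\<integral>\<^sup>+z. (ennreal \<delta> * (indicator {v<..} (path_min (fst z)) * ennreal (max 0 (path_min (snd z) - v))) + ?G (?U z) * ?H (?V z)) \<partial>MM)"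
  proof (rule nn_integral_mono)
    fix z assume z: "z \<in> space MM"
    then have z': "fst z \<in> space M" "snd z \<in> space M" by (auto simp: space_pair_measure)
    note cU = path_continuous2[OF z, of ?a ?a] and cV = path_continuous2[OF z, of "- ?a" ?a]
    note cD = path_continuous2[OF z, of "- 1" 1]
    note bU = min_on_attained(1)[OF cU b_nonneg] path_inf_eq_min_on[OF cU b_nonneg]
    note bV = path_norm_bound[OF cV b_nonneg]
    note bD = path_norm_bound[OF cD b_nonneg]
    show "indicator {v<..} (path_min (fst z)) * ennreal (max 0 (path_min (snd z) - v)) * ennreal (path_gap z)
      \<le> ennreal \<delta> * (indicator {v<..} (path_min (fst z)) * ennreal (max 0 (path_min (snd z) - v))) + ?G (?U z) * ?H (?V z)"
    proof (cases "v < path_min (fst z) \<and> v < path_min (snd z) \<and> \<delta> < path_gap z")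
      case False
      have "indicator {v<..} (path_min (fst z)) * ennreal (max 0 (path_min (snd z) - v)) * ennreal (path_gap z)
        \<le> ennreal \<delta> * (indicator {v<..} (path_min (fst z)) * ennreal (max 0 (path_min (snd z) - v)))"
      proof (cases "v < path_min (fst z) \<and> v < path_min (snd z)")
        case True
        with False have "path_gap z \<le> \<delta>" by auto
        then show ?thesis using True by (simp add: mult.commute[of "ennreal \<delta>"] mult_left_mono ennreal_leI)
      qed (auto simp: ennreal_neg indicator_def)
      then show ?thesis by (rule order_trans) simp
    next
      case True
      obtain t where t: "t \<in> {0..b}" "\<bar>- 1 * X t (fst z) + 1 * X t (snd z)\<bar> = path_gap z" using bD(2) by blast
      have "path_gap z = sqrt 2 * \<bar>?V z t\<bar>"
      proof -
        have "- 1 * X t (fst z) + 1 * X t (snd z) = sqrt 2 * ?V z t" by (simp add: field_simps)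
        then show ?thesis unfolding t(2)[symmetric] by (simp only: abs_mult abs_of_pos[OF real_sqrt_gt_zero] zero_less_numeral)
      qed
      also have "\<dots> \<le> sqrt 2 * path_norm b (?V z)" by (intro mult_left_mono bV t) auto
      finally have D: "path_gap z \<le> sqrt 2 * path_norm b (?V z)" .
      then have V: "\<delta> / sqrt 2 < path_norm b (?V z)" using True by (simp add: field_simps)
      obtain s where s: "s \<in> {0..b}" "?U z s = min_on b (?U z)" using bU(1) by blast
      have "sqrt 2 * ?U z s = X s (fst z) + X s (snd z)" by (simp add: field_simps)
      then have "sqrt 2 * path_inf b (?U z) = X s (fst z) + X s (snd z)" unfolding bU(2) s(2) .
      moreover have "path_min (fst z) \<le> X s (fst z)" "path_min (snd z) \<le> X s (snd z)"
        using path_min_attained(2)[OF _ s(1)] z' by auto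
      ultimately have "path_min (snd z) - v \<le> sqrt 2 * path_inf b (?U z) - 2 * v"
        using True by linarith
      also have "\<dots> = sqrt 2 * (path_inf b (?U z) - sqrt 2 * v)" by (simp add: algebra_simps)
      also have "\<dots> \<le> sqrt 2 * max 0 (path_inf b (?U z) - sqrt 2 * v)" by (intro mult_left_mono) auto
      finally have U: "path_min (snd z) - v \<le> sqrt 2 * max 0 (path_inf b (?U z) - sqrt 2 * v)" .
      have "(path_min (snd z) - v) * path_gap z \<le> (sqrt 2 * max 0 (path_inf b (?U z) - sqrt 2 * v)) * (sqrt 2 * path_norm b (?V z))"
        using True \<delta> by (intro mult_mono U D) auto
      also have "\<dots> = (2 * max 0 (path_inf b (?U z) - sqrt 2 * v)) * path_norm b (?V z)" by simp
      finally have "ennreal (path_min (snd z) - v) * ennreal (path_gap z) \<le> ?G (?U z) * ennreal (path_norm b (?V z))"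
        using True \<delta> bV(3) by (simp add: ennreal_mult[symmetric] ennreal_leI)
      then have "indicator {v<..} (path_min (fst z)) * ennreal (max 0 (path_min (snd z) - v)) * ennreal (path_gap z) \<le> ?G (?U z) * ?H (?V z)"
        using True V by simp
      then show ?thesis by (rule order_trans) simp
    qed
  qed
  also have "\<dots> = (\<integral>\<^sup>+z. ennreal \<delta> * (indicator {v<..} (path_min (fst z)) * ennreal (max 0 (path_min (snd z) - v))) \<partial>MM)
      + (\<integral>\<^sup>+z. ?G (?U z) * ?H (?V z) \<partial>MM)"
    by (intro nn_integral_add borel_measurable_times_ennreal mGH) measurable
  also have "(\<integral>\<^sup>+z. ennreal \<delta> * (indicator {v<..} (path_min (fst z)) * ennreal (max 0 (path_min (snd z) - v))) \<partial>MM)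
      = ennreal \<delta> * ((\<integral>\<^sup>+\<omega>. indicator {v<..} (path_min \<omega>) \<partial>M) * (\<integral>\<^sup>+\<omega>. ennreal (max 0 (path_min \<omega> - v)) \<partial>M))"
    by (subst product_functionals[symmetric]) (auto intro!: nn_integral_cmult)
  also have "\<dots> = ennreal (\<delta> * min_tail v * excess v)"
    unfolding min_tail_nn[symmetric] excess_nn(1) using \<delta> excess_nn(2)[of v] measure_nonneg[of M]
    by (simp add: ennreal_mult min_tail_def mult.assoc)
  also have "(\<integral>\<^sup>+z. ?G (?U z) * ?H (?V z) \<partial>MM) = (\<integral>\<^sup>+\<omega>. ?G (\<lambda>t. X t \<omega>) \<partial>M) * (\<integral>\<^sup>+\<omega>. ?H (\<lambda>t. X t \<omega>) \<partial>M)"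
    by (rule rotation_product[OF ab GH])
  also have "(\<integral>\<^sup>+\<omega>. ?G (\<lambda>t. X t \<omega>) \<partial>M) = (\<integral>\<^sup>+\<omega>. ennreal 2 * ennreal (max 0 (path_min \<omega> - sqrt 2 * v)) \<partial>M)"
    by (intro nn_integral_cong) (simp add: path_inf_eq_path_min ennreal_mult)
  also have "\<dots> = ennreal (2 * excess (sqrt 2 * v))"
    by (subst nn_integral_cmult, measurable) (simp only: excess_nn ennreal_mult zero_le_numeral)
  finally show ?thesis .
qed

end

section \<open>The Cameron--Martin shift\<close>

context gaussian_path
begin

text \<open>The path with its value at time \<open>s\<close> replaced by \<open>w\<close>: the residual \<open>X\<^sub>t - R(t - s) X\<^sub>s / R(0)\<close> is uncorrelated with \<open>X\<^sub>s\<close>,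
hence independent of it, so an independent normal \<open>w\<close> restores the law of the path.\<close>
definition resampled :: "real \<Rightarrow> 'w \<times> real \<Rightarrow> real \<Rightarrow> real" where
  "resampled s z t = (X t (fst z) - R (t - s) / R 0 * X s (fst z)) + R (t - s) / R 0 * snd z"

abbreviation fresh :: "real measure" where "fresh \<equiv> density lborel (normal_density 0 (sqrt (R 0)))"

lemma resampled_measurable[measurable]:
  "(\<lambda>z. resampled s z t) \<in> borel_measurable (M \<Otimes>\<^sub>M fresh)"
  "resampled s \<in> measurable (M \<Otimes>\<^sub>M fresh) path_space"
proof -
  show *: "(\<lambda>z. resampled s z t) \<in> borel_measurable (M \<Otimes>\<^sub>M fresh)" for t unfolding resampled_def by measurable
  show "resampled s \<in> measurable (M \<Otimes>\<^sub>M fresh) path_space"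
    by (rule measurable_PiM_single') (auto intro: *)
qed

lemma resampled_law:
  assumes R0: "0 < R 0"
  shows "distr M path_space (\<lambda>\<omega> t. X t \<omega>) = distr (M \<Otimes>\<^sub>M fresh) path_space (resampled s)"
proof (rule char_determines_law[where A=X and A'="\<lambda>t z. resampled s z t"])
  interpret F: prob_space fresh using R0 by (intro prob_space_normal_density) simp
  interpret MF: pair_prob_space M fresh ..
  show "prob_space (M \<Otimes>\<^sub>M fresh)" by (rule MF.prob_space_axioms)
  fix J :: "real set" and c :: "real \<Rightarrow> real" assume J: "finite J"
  define a where "a = (\<Sum>t\<in>J. c t * R (t - s)) / R 0"
  \<comment> \<open>the residual part of the combination, as a combination over the times in \<open>J\<close> and the extra index \<open>None\<close> for time \<open>s\<close>\<close>
  define c' where "c' k = (case k of None \<Rightarrow> - a | Some t \<Rightarrow> c t)" for k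
  define \<tau> where "\<tau> k = (case k of None \<Rightarrow> s | Some t \<Rightarrow> t)" for k
  define K where "K = insert None (Some ` J)"
  have K: "finite K" using J by (simp add: K_def)
  have sumK: "(\<Sum>k\<in>K. h k) = h None + (\<Sum>t\<in>J. h (Some t))" for h :: "real option \<Rightarrow> real"
    using J by (simp add: K_def sum.reindex)
  have split: "(\<Sum>t\<in>J. c t * resampled s z t) = (\<Sum>k\<in>K. c' k * X (\<tau> k) (fst z)) + a * snd z" for z
    by (simp add: sumK c'_def \<tau>_def resampled_def a_def algebra_simps sum.distrib sum_subtractf
        sum_distrib_left sum_distrib_right sum_divide_distrib)
  have aR: "(\<Sum>t\<in>J. c t * R (t - s)) = a * R 0" using R0 by (simp add: a_def)
  have "covsum K c' \<tau> = a\<^sup>2 * R 0 - a * (\<Sum>t\<in>J. c t * R (s - t)) - a * (\<Sum>t\<in>J. c t * R (t - s)) + covsum J c (\<lambda>t. t)"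
    by (simp add: sumK c'_def \<tau>_def sum.distrib sum_distrib_left power2_eq_square algebra_simps sum_negf sum_subtractf)
  also have "(\<Sum>t\<in>J. c t * R (s - t)) = (\<Sum>t\<in>J. c t * R (t - s))" using R_sym by (metis minus_diff_eq)
  finally have VK: "covsum K c' \<tau> + a\<^sup>2 * R 0 = covsum J c (\<lambda>t. t)" unfolding aR by (simp add: power2_eq_square)
  have fr: "(CLINT w|fresh. iexp (a * w)) = exp (- (a\<^sup>2 * R 0) / 2)"
    using gaussian_law_char[of "sqrt (R 0)" a] R0 by (simp add: gaussian_law_def)
  have "(CLINT z|M \<Otimes>\<^sub>M fresh. iexp (\<Sum>t\<in>J. c t * resampled s z t))
     = (CLINT \<omega>|M. iexp (\<Sum>k\<in>K. c' k * X (\<tau> k) \<omega>)) * (CLINT w|fresh. iexp (a * w))"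
    unfolding split by (rule product_char[OF prob_space_axioms F.prob_space_axioms]) measurable
  also have "\<dots> = complex_of_real (exp (- covsum J c (\<lambda>t. t) / 2))"
    unfolding lincomb_char[OF K] fr VK[symmetric]
    by (simp only: of_real_mult[symmetric] exp_add[symmetric] add_divide_distrib[symmetric] minus_add_distrib)
  also have "\<dots> = (CLINT \<omega>|M. iexp (\<Sum>t\<in>J. c t * X t \<omega>))" by (rule lincomb_char[OF J, symmetric])
  finally show "(CLINT \<omega>|M. iexp (\<Sum>t\<in>J. c t * X t \<omega>)) = (CLINT z|M \<Otimes>\<^sub>M fresh. iexp (\<Sum>t\<in>J. c t * resampled s z t))" ..
qed (use prob_space_axioms in measurable)

lemma nn_integral_resampled:
  assumes R0: "0 < R 0" and H[measurable]: "H \<in> borel_measurable path_space"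
  shows "(\<integral>\<^sup>+\<omega>. H (\<lambda>t. X t \<omega>) \<partial>M)
    = (\<integral>\<^sup>+\<omega>. (\<integral>\<^sup>+w. ennreal (normal_density 0 (sqrt (R 0)) w) * H (resampled s (\<omega>, w)) \<partial>lborel) \<partial>M)"
proof -
  interpret F: prob_space fresh using R0 by (intro prob_space_normal_density) simp
  interpret MF: pair_prob_space M fresh ..
  have m: "(\<lambda>z. H (resampled s z)) \<in> borel_measurable (M \<Otimes>\<^sub>M fresh)"
    by (rule measurable_compose[OF resampled_measurable(2) H])
  have "(\<integral>\<^sup>+\<omega>. H (\<lambda>t. X t \<omega>) \<partial>M) = (\<integral>\<^sup>+z. H (resampled s z) \<partial>(M \<Otimes>\<^sub>M fresh))"
    using arg_cong[OF resampled_law[OF R0, of s], of "\<lambda>D. \<integral>\<^sup>+x. H x \<partial>D"]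
    by (simp add: nn_integral_distr path_measurable)
  also have "\<dots> = (\<integral>\<^sup>+\<omega>. (\<integral>\<^sup>+w. H (resampled s (\<omega>, w)) \<partial>fresh) \<partial>M)"
    by (rule F.nn_integral_fst[OF m, symmetric])
  also have "\<dots> = (\<integral>\<^sup>+\<omega>. (\<integral>\<^sup>+w. ennreal (normal_density 0 (sqrt (R 0)) w) * H (resampled s (\<omega>, w)) \<partial>lborel) \<partial>M)"
  proof (rule nn_integral_cong)
    fix \<omega> assume "\<omega> \<in> space M"
    then have "(\<lambda>w. H (resampled s (\<omega>, w))) \<in> borel_measurable fresh"
      using measurable_compose[OF measurable_Pair1' m] by simp
    then show "(\<integral>\<^sup>+w. H (resampled s (\<omega>, w)) \<partial>fresh)
        = (\<integral>\<^sup>+w. ennreal (normal_density 0 (sqrt (R 0)) w) * H (resampled s (\<omega>, w)) \<partial>lborel)"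
      by (intro nn_integral_density) simp_all
  qed
  finally show ?thesis .
qed

text \<open>In the resampled path, a shift by \<open>\<epsilon> R(t - s)\<close> is the translation of the normal variable \<open>w\<close> by \<open>\<epsilon> R(0)\<close>, so
the theorem reduces to a change of variables in one dimension.\<close>
theorem cameron_martin:
  assumes R0: "0 < R 0" and F[measurable]: "F \<in> borel_measurable path_space"
  shows "(\<integral>\<^sup>+\<omega>. F (\<lambda>t. X t \<omega> + \<epsilon> * R (t - s)) \<partial>M)
    = (\<integral>\<^sup>+\<omega>. F (\<lambda>t. X t \<omega>) * ennreal (exp (\<epsilon> * X s \<omega> - \<epsilon>\<^sup>2 * R 0 / 2)) \<partial>M)"
proof -
  let ?n = "normal_density 0 (sqrt (R 0))"
  have [measurable]: "(\<lambda>(x :: real \<Rightarrow> real) t. x t + \<epsilon> * R (t - s)) \<in> measurable path_space path_space"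
    by (rule measurable_PiM_single') (auto simp: space_PiM)
  have shift: "resampled s (\<omega>, w) t + \<epsilon> * R (t - s) = resampled s (\<omega>, w + \<epsilon> * R 0) t" for \<omega> w t
    using R0 by (simp add: resampled_def field_simps)
  have tilt: "?n w = ?n (w + \<epsilon> * R 0) * exp (\<epsilon> * (w + \<epsilon> * R 0) - \<epsilon>\<^sup>2 * R 0 / 2)" for w
  proof -
    have "- w\<^sup>2 / (2 * R 0) = - (w + \<epsilon> * R 0)\<^sup>2 / (2 * R 0) + (\<epsilon> * (w + \<epsilon> * R 0) - \<epsilon>\<^sup>2 * R 0 / 2)"
      using R0 by (simp add: field_simps power2_eq_square)
    then show ?thesis using R0 unfolding normal_density_def
      by (simp add: exp_add[symmetric] mult.assoc)
  qed
  have at_s: "resampled s (\<omega>, w) s = w" for \<omega> w using R0 by (simp add: resampled_def)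
  have "(\<integral>\<^sup>+\<omega>. F (\<lambda>t. X t \<omega> + \<epsilon> * R (t - s)) \<partial>M)
     = (\<integral>\<^sup>+\<omega>. (\<integral>\<^sup>+w. ennreal (?n w) * F (\<lambda>t. resampled s (\<omega>, w) t + \<epsilon> * R (t - s)) \<partial>lborel) \<partial>M)"
    by (rule nn_integral_resampled[OF R0, where H="\<lambda>x. F (\<lambda>t. x t + \<epsilon> * R (t - s))"]) measurable
  also have "\<dots> = (\<integral>\<^sup>+\<omega>. (\<integral>\<^sup>+w. ennreal (?n w) * (F (resampled s (\<omega>, w)) * ennreal (exp (\<epsilon> * resampled s (\<omega>, w) s - \<epsilon>\<^sup>2 * R 0 / 2))) \<partial>lborel) \<partial>M)"
  proof (rule nn_integral_cong)
    fix \<omega> assume \<omega>: "\<omega> \<in> space M"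
    have [measurable]: "(\<lambda>w. F (resampled s (\<omega>, w))) \<in> borel_measurable borel"
    proof -
      have "resampled s \<in> measurable (M \<Otimes>\<^sub>M borel) path_space"
        using resampled_measurable(2) by (simp cong: measurable_cong_sets)
      from measurable_compose[OF measurable_compose[OF measurable_Pair1'[OF \<omega>] this] F] show ?thesis .
    qed
    have "(\<integral>\<^sup>+w. ennreal (?n w) * (F (resampled s (\<omega>, w)) * ennreal (exp (\<epsilon> * resampled s (\<omega>, w) s - \<epsilon>\<^sup>2 * R 0 / 2))) \<partial>lborel)
      = (\<integral>\<^sup>+w. ennreal (?n (\<epsilon> * R 0 + 1 * w)) * (F (resampled s (\<omega>, \<epsilon> * R 0 + 1 * w)) * ennreal (exp (\<epsilon> * (\<epsilon> * R 0 + 1 * w) - \<epsilon>\<^sup>2 * R 0 / 2))) \<partial>lborel)"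
      unfolding at_s by (subst nn_integral_real_affine[where c=1 and t="\<epsilon> * R 0"]) simp_all
    also have "\<dots> = (\<integral>\<^sup>+w. ennreal (?n w) * F (\<lambda>t. resampled s (\<omega>, w) t + \<epsilon> * R (t - s)) \<partial>lborel)"
    proof (rule nn_integral_cong)
      fix w
      have "ennreal (?n w) = ennreal (?n (w + \<epsilon> * R 0)) * ennreal (exp (\<epsilon> * (w + \<epsilon> * R 0) - \<epsilon>\<^sup>2 * R 0 / 2))"
        by (subst tilt) (simp add: ennreal_mult)
      then show "ennreal (?n (\<epsilon> * R 0 + 1 * w)) * (F (resampled s (\<omega>, \<epsilon> * R 0 + 1 * w)) * ennreal (exp (\<epsilon> * (\<epsilon> * R 0 + 1 * w) - \<epsilon>\<^sup>2 * R 0 / 2)))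
        = ennreal (?n w) * F (\<lambda>t. resampled s (\<omega>, w) t + \<epsilon> * R (t - s))"
        unfolding shift by (simp only: mult_1 add.commute[of "\<epsilon> * R 0"] mult_ac)
    qed
    finally show "(\<integral>\<^sup>+w. ennreal (?n w) * F (\<lambda>t. resampled s (\<omega>, w) t + \<epsilon> * R (t - s)) \<partial>lborel)
      = (\<integral>\<^sup>+w. ennreal (?n w) * (F (resampled s (\<omega>, w)) * ennreal (exp (\<epsilon> * resampled s (\<omega>, w) s - \<epsilon>\<^sup>2 * R 0 / 2))) \<partial>lborel)" ..
  qed
  also have "\<dots> = (\<integral>\<^sup>+\<omega>. F (\<lambda>t. X t \<omega>) * ennreal (exp (\<epsilon> * X s \<omega> - \<epsilon>\<^sup>2 * R 0 / 2)) \<partial>M)"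
    by (rule nn_integral_resampled[OF R0, where H="\<lambda>x. F x * ennreal (exp (\<epsilon> * x s - \<epsilon>\<^sup>2 * R 0 / 2))", symmetric]) measurable
  finally show ?thesis .
qed

end

section \<open>Integration by parts for the minimum\<close>

lemma abs_exp_minus_one_le: "\<bar>exp y - 1\<bar> \<le> \<bar>y\<bar> * exp \<bar>y\<bar>" for y :: real
proof (cases "0 \<le> y")
  case True
  have "1 - y \<le> exp (- y)" using exp_ge_add_one_self[of "- y"] by simp
  then have "(1 - y) * exp y \<le> exp (- y) * exp y" by (rule mult_right_mono) simp
  then have "exp y - 1 \<le> y * exp y" by (simp add: exp_minus algebra_simps)
  then show ?thesis using True by simp
next
  case False
  then have "\<bar>exp y - 1\<bar> = 1 - exp y" by simp
  also have "\<dots> \<le> - y" using exp_ge_add_one_self[of y] by linarith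
  also have "- y = \<bar>y\<bar> * 1" using False by simp
  also have "\<dots> \<le> \<bar>y\<bar> * exp \<bar>y\<bar>" by (intro mult_left_mono) auto
  finally show ?thesis .
qed

lemma max0_diff_quotient_tendsto:
  fixes l v g :: real
  assumes e: "e \<longlonglongrightarrow> 0" "\<And>n. e n \<noteq> 0" and "l \<noteq> v"
  shows "(\<lambda>n. (max 0 (l + e n * g - v) - max 0 (l - v)) / e n) \<longlonglongrightarrow> g * indicator {v<..} l"
proof -
  have lim: "(\<lambda>n. l + e n * g - v) \<longlonglongrightarrow> l + 0 * g - v" by (intro tendsto_intros e)
  show ?thesis
  proof (cases "v < l")
    case True
    then have "\<forall>\<^sub>F n in sequentially. 0 < l + e n * g - v" using order_tendstoD(1)[OF lim, of 0] by simp
    then have "\<forall>\<^sub>F n in sequentially. (max 0 (l + e n * g - v) - max 0 (l - v)) / e n = g * indicator {v<..} l"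
      by eventually_elim (use True e(2) in simp)
    then show ?thesis by (rule tendsto_eventually)
  next
    case False
    then have "\<forall>\<^sub>F n in sequentially. l + e n * g - v < 0" using order_tendstoD(2)[OF lim, of 0] \<open>l \<noteq> v\<close> by simp
    then have "\<forall>\<^sub>F n in sequentially. (max 0 (l + e n * g - v) - max 0 (l - v)) / e n = g * indicator {v<..} l"
      by eventually_elim (use False in simp)
    then show ?thesis by (rule tendsto_eventually)
  qed
qed

context gaussian_path
begin

lemma path_sup_exp_integrable: "integrable M (\<lambda>\<omega>. exp (k * path_sup \<omega>))"
proof -
  obtain \<alpha> where \<alpha>: "0 < \<alpha>" "integrable M (\<lambda>\<omega>. exp (\<alpha> * (path_sup \<omega>)\<^sup>2))" using fernique by auto
  have "integrable M (\<lambda>\<omega>. exp (k\<^sup>2 / (4 * \<alpha>)) * exp (\<alpha> * (path_sup \<omega>)\<^sup>2))" using \<alpha> by simp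
  then show ?thesis
  proof (rule Bochner_Integration.integrable_bound)
    have "k * x \<le> k\<^sup>2 / (4 * \<alpha>) + \<alpha> * x\<^sup>2" for x
    proof -
      have "0 \<le> (k - 2 * \<alpha> * x)\<^sup>2 / (4 * \<alpha>)" using \<alpha> by simp
      also have "\<dots> = k\<^sup>2 / (4 * \<alpha>) + \<alpha> * x\<^sup>2 - k * x" using \<alpha> by (simp add: field_simps power2_eq_square)
      finally show ?thesis by simp
    qed
    then show "AE \<omega> in M. norm (exp (k * path_sup \<omega>)) \<le> norm (exp (k\<^sup>2 / (4 * \<alpha>)) * exp (\<alpha> * (path_sup \<omega>)\<^sup>2))"
      by (simp add: exp_add[symmetric])
  qed measurable
qed

lemma R_measurable[measurable]: "R \<in> borel_measurable borel"
  by (rule borel_measurable_continuous_onI[OF R_continuous])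

definition shifted_excess :: "real \<Rightarrow> real \<Rightarrow> real \<Rightarrow> 'w \<Rightarrow> real" where
  "shifted_excess v s \<epsilon> \<omega> = max 0 (path_inf b (\<lambda>t. X t \<omega> + \<epsilon> * R (t - s)) - v)"

lemma shifted_excess_measurable[measurable]: "shifted_excess v s \<epsilon> \<in> borel_measurable M"
proof -
  have "(\<lambda>\<omega> t. X t \<omega> + \<epsilon> * R (t - s)) \<in> measurable M path_space"
    by (rule measurable_PiM_single') (auto simp: space_PiM)
  from measurable_compose[OF this measurable_path_inf] show ?thesis unfolding shifted_excess_def by measurable
qed

lemma shifted_path_continuous: "\<omega> \<in> space M \<Longrightarrow> continuous_on {0..b} (\<lambda>t. X t \<omega> + \<epsilon> * R (t - s))"
  by (intro continuous_intros path_continuous continuous_on_compose2[OF R_continuous]) auto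

text \<open>The value at the old minimizer bounds the shifted minimum for \<open>\<epsilon>\<close> of either sign. This one-sided bound replaces
a derivative of the minimum, which need not exist when the minimizer is not unique.\<close>
lemma shifted_excess_le:
  assumes \<omega>: "\<omega> \<in> space M"
  shows "shifted_excess v s \<epsilon> \<omega> \<le> max 0 (path_min \<omega> + \<epsilon> * R (argmin_time \<omega> - s) - v)" "shifted_excess v s 0 \<omega> = max 0 (path_min \<omega> - v)"
    "0 \<le> shifted_excess v s \<epsilon> \<omega>"
proof -
  note c = shifted_path_continuous[OF \<omega>, of \<epsilon> s]
  have "min_on b (\<lambda>t. X t \<omega> + \<epsilon> * R (t - s)) \<le> X (argmin_time \<omega>) \<omega> + \<epsilon> * R (argmin_time \<omega> - s)"
    using min_on_attained(2)[OF c b_nonneg argmin_time_correct(1)[OF \<omega>]] .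
  then show "shifted_excess v s \<epsilon> \<omega> \<le> max 0 (path_min \<omega> + \<epsilon> * R (argmin_time \<omega> - s) - v)"
    using path_inf_eq_min_on[OF c b_nonneg] argmin_time_correct(2)[OF \<omega>] by (simp add: shifted_excess_def)
  show "shifted_excess v s 0 \<omega> = max 0 (path_min \<omega> - v)" using path_inf_eq_path_min[OF \<omega>] by (simp add: shifted_excess_def)
qed (simp add: shifted_excess_def)

lemma shifted_excess_integral:
  assumes "0 < R 0"
  shows "(LINT \<omega>|M. shifted_excess v s \<epsilon> \<omega>) = (LINT \<omega>|M. max 0 (path_min \<omega> - v) * exp (\<epsilon> * X s \<omega> - \<epsilon>\<^sup>2 * R 0 / 2))"
proof -
  have "(\<integral>\<^sup>+\<omega>. ennreal (shifted_excess v s \<epsilon> \<omega>) \<partial>M)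
    = (\<integral>\<^sup>+\<omega>. ennreal (max 0 (path_inf b (\<lambda>t. X t \<omega>) - v)) * ennreal (exp (\<epsilon> * X s \<omega> - \<epsilon>\<^sup>2 * R 0 / 2)) \<partial>M)"
    unfolding shifted_excess_def
    by (rule cameron_martin[OF assms, where F="\<lambda>x. ennreal (max 0 (path_inf b x - v))"]) measurable
  also have "\<dots> = (\<integral>\<^sup>+\<omega>. ennreal (max 0 (path_min \<omega> - v) * exp (\<epsilon> * X s \<omega> - \<epsilon>\<^sup>2 * R 0 / 2)) \<partial>M)"
    by (intro nn_integral_cong) (simp only: path_inf_eq_path_min ennreal_mult exp_ge_zero max.cobounded1)
  finally show ?thesis
    by (subst (1 2) integral_eq_nn_integral) (auto simp: shifted_excess_le(3))
qed

lemma shifted_excess_integrable: "integrable M (shifted_excess v s \<epsilon>)"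
proof (rule Bochner_Integration.integrable_bound)
  show "integrable M (\<lambda>\<omega>. path_sup \<omega> + (\<bar>\<epsilon>\<bar> * R 0 + \<bar>v\<bar>))" using path_sup_integrable by simp
  show "AE \<omega> in M. norm (shifted_excess v s \<epsilon> \<omega>) \<le> norm (path_sup \<omega> + (\<bar>\<epsilon>\<bar> * R 0 + \<bar>v\<bar>))"
  proof (rule AE_I2)
    fix \<omega> assume \<omega>: "\<omega> \<in> space M"
    have "\<epsilon> * R (argmin_time \<omega> - s) \<le> \<bar>\<epsilon>\<bar> * R 0"
      using R_abs_le[of "argmin_time \<omega> - s"] by (metis abs_ge_self abs_ge_zero abs_mult mult_left_mono order_trans)
    moreover have "0 \<le> \<bar>\<epsilon>\<bar> * R 0" using R_abs_le[of 0] by simp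
    ultimately show "norm (shifted_excess v s \<epsilon> \<omega>) \<le> norm (path_sup \<omega> + (\<bar>\<epsilon>\<bar> * R 0 + \<bar>v\<bar>))"
      using shifted_excess_le(1)[OF \<omega>, of v s \<epsilon>] shifted_excess_le(3)[OF \<omega>, of v s \<epsilon>] path_sup_bound(3,4)[OF \<omega>] by auto
  qed
qed measurable

text \<open>The derivative at \<open>\<epsilon> = 0\<close> of \<open>E (min(X + \<epsilon> R(\<cdot> - s)) - v)\<^sup>+\<close>, computed on the density side of the Cameron--Martin formula.
All difference quotients are dominated by a multiple of \<open>exp(3 \<parallel>X\<parallel>)\<close>.\<close>
lemma excess_derivative:
  assumes R0: "0 < R 0" and s: "s \<in> {0..b}" and e: "e \<longlonglongrightarrow> 0" "\<And>n. e n \<noteq> 0" "\<And>n. \<bar>e n\<bar> \<le> 1"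
  shows "(\<lambda>n. (LINT \<omega>|M. (shifted_excess v s (e n) \<omega> - shifted_excess v s 0 \<omega>) / e n))
    \<longlonglongrightarrow> (LINT \<omega>|M. X s \<omega> * max 0 (path_min \<omega> - v))"
proof -
  let ?x = "\<lambda>\<epsilon> \<omega>. exp (\<epsilon> * X s \<omega> - \<epsilon>\<^sup>2 * R 0 / 2)"
  define D where "D n \<omega> = max 0 (path_min \<omega> - v) * ((?x (e n) \<omega> - 1) / e n)" for n \<omega>
  have [measurable]: "D n \<in> borel_measurable M" for n unfolding D_def by measurable
  define w where "w \<omega> = exp (\<bar>v\<bar> + 2 * R 0) * exp (3 * path_sup \<omega>)" for \<omega>
  have w: "integrable M w" unfolding w_def using path_sup_exp_integrable by simp
  have bound: "\<bar>D n \<omega>\<bar> \<le> w \<omega>" if \<omega>: "\<omega> \<in> space M" for n \<omega>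
  proof -
    let ?N = "path_sup \<omega>"
    define y where "y = e n * X s \<omega> - (e n)\<^sup>2 * R 0 / 2"
    have "\<bar>y\<bar> \<le> \<bar>e n\<bar> * \<bar>X s \<omega>\<bar> + \<bar>e n\<bar>\<^sup>2 * R 0 / 2"
      using R0 by (auto simp: y_def abs_mult[symmetric] intro!: order_trans[OF abs_triangle_ineq4])
    also have "\<bar>e n\<bar>\<^sup>2 * R 0 / 2 \<le> \<bar>e n\<bar> * R 0"
    proof -
      have "\<bar>e n\<bar>\<^sup>2 \<le> \<bar>e n\<bar> * 1" unfolding power2_eq_square by (intro mult_left_mono e) auto
      then have "\<bar>e n\<bar>\<^sup>2 * R 0 \<le> \<bar>e n\<bar> * R 0" using R0 by simp
      moreover have "0 \<le> \<bar>e n\<bar>\<^sup>2 * R 0" using R0 by simp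
      ultimately show ?thesis by linarith
    qed
    also have "\<bar>e n\<bar> * \<bar>X s \<omega>\<bar> \<le> \<bar>e n\<bar> * ?N" by (intro mult_left_mono path_sup_bound(1)[OF \<omega> s]) auto
    finally have y: "\<bar>y\<bar> \<le> \<bar>e n\<bar> * (?N + R 0)" by (simp add: algebra_simps)
    have N: "0 \<le> ?N" by (rule path_sup_bound(3)[OF \<omega>])
    have y1: "\<bar>y\<bar> \<le> ?N + R 0"
    proof -
      have "\<bar>e n\<bar> * (?N + R 0) \<le> 1 * (?N + R 0)" by (intro mult_right_mono e(3)) (use N R0 in simp)
      then show ?thesis using y by simp
    qed
    have "\<bar>exp y - 1\<bar> \<le> \<bar>y\<bar> * exp \<bar>y\<bar>" by (rule abs_exp_minus_one_le)
    also have "\<dots> \<le> (\<bar>e n\<bar> * (?N + R 0)) * exp (?N + R 0)" using y y1 by (intro mult_mono) auto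
    finally have "\<bar>(exp y - 1) / e n\<bar> \<le> (?N + R 0) * exp (?N + R 0)"
      using e(2)[of n] by (simp add: field_simps)
    also have "\<dots> \<le> exp (?N + R 0) * exp (?N + R 0)"
    proof (rule mult_right_mono)
      show "?N + R 0 \<le> exp (?N + R 0)" using exp_ge_add_one_self[of "?N + R 0"] by linarith
    qed simp
    finally have 1: "\<bar>(exp y - 1) / e n\<bar> \<le> exp (?N + R 0) * exp (?N + R 0)" .
    have "\<bar>max 0 (path_min \<omega> - v)\<bar> \<le> ?N + \<bar>v\<bar>" using path_sup_bound(4)[OF \<omega>] by auto
    also have "\<dots> \<le> exp (?N + \<bar>v\<bar>)" using exp_ge_add_one_self[of "?N + \<bar>v\<bar>"] by linarith
    finally have 2: "\<bar>max 0 (path_min \<omega> - v)\<bar> \<le> exp (?N + \<bar>v\<bar>)" .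
    have "\<bar>D n \<omega>\<bar> = \<bar>max 0 (path_min \<omega> - v)\<bar> * \<bar>(exp y - 1) / e n\<bar>" by (simp add: D_def y_def abs_mult)
    also have "\<dots> \<le> exp (?N + \<bar>v\<bar>) * (exp (?N + R 0) * exp (?N + R 0))" by (intro mult_mono 1 2) auto
    also have "\<dots> = w \<omega>" by (simp add: w_def exp_add[symmetric])
    finally show ?thesis .
  qed
  have int: "integrable M (D n)" for n
    by (rule Bochner_Integration.integrable_bound[OF w]) (use bound in \<open>auto intro!: AE_I2 order_trans[OF _ abs_ge_self]\<close>)
  have eq: "(LINT \<omega>|M. (shifted_excess v s (e n) \<omega> - shifted_excess v s 0 \<omega>) / e n) = (LINT \<omega>|M. D n \<omega>)" for n
  proof -
    have "max 0 (path_min \<omega> - v) * ?x (e n) \<omega> = e n * D n \<omega> + max 0 (path_min \<omega> - v)" for \<omega>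
      using e(2)[of n] by (simp add: D_def field_simps)
    then have "(LINT \<omega>|M. shifted_excess v s (e n) \<omega>) = (LINT \<omega>|M. e n * D n \<omega> + max 0 (path_min \<omega> - v))"
      unfolding shifted_excess_integral[OF R0] by simp
    also have "\<dots> = e n * (LINT \<omega>|M. D n \<omega>) + (LINT \<omega>|M. max 0 (path_min \<omega> - v))"
      using int excess_integrable by simp
    also have "(LINT \<omega>|M. max 0 (path_min \<omega> - v)) = (LINT \<omega>|M. shifted_excess v s 0 \<omega>)"
      by (rule Bochner_Integration.integral_cong) (auto simp: shifted_excess_le(2))
    finally show ?thesis using e(2)[of n] shifted_excess_integrable by simp
  qed
  have "(\<lambda>n. LINT \<omega>|M. D n \<omega>) \<longlonglongrightarrow> (LINT \<omega>|M. max 0 (path_min \<omega> - v) * X s \<omega>)"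
  proof (rule integral_dominated_convergence[OF _ _ w])
    show "AE \<omega> in M. (\<lambda>n. D n \<omega>) \<longlonglongrightarrow> max 0 (path_min \<omega> - v) * X s \<omega>"
    proof (rule AE_I2)
      fix \<omega>
      have "((\<lambda>h. exp (h * X s \<omega> - h\<^sup>2 * R 0 / 2)) has_real_derivative X s \<omega>) (at 0)"
        by (auto intro!: derivative_eq_intros)
      then have "(\<lambda>h. (exp (h * X s \<omega> - h\<^sup>2 * R 0 / 2) - 1) / h) \<midarrow>0\<rightarrow> X s \<omega>"
        by (simp add: DERIV_def)
      moreover have "filterlim e (at 0) sequentially"
        using e by (simp add: filterlim_at)
      ultimately have "(\<lambda>n. (?x (e n) \<omega> - 1) / e n) \<longlonglongrightarrow> X s \<omega>" by (rule filterlim_compose)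
      then show "(\<lambda>n. D n \<omega>) \<longlonglongrightarrow> max 0 (path_min \<omega> - v) * X s \<omega>" unfolding D_def by (intro tendsto_intros)
    qed
    show "AE \<omega> in M. norm (D n \<omega>) \<le> w \<omega>" for n using bound by (auto intro!: AE_I2)
  qed measurable
  then show ?thesis unfolding eq by (simp add: mult.commute)
qed

text \<open>The same difference quotient for the upper bound in which the minimizer is kept fixed. The positive part is
Lipschitz, and differentiable away from the level \<open>v\<close>, which the minimum almost surely avoids.\<close>
lemma argmin_derivative:
  assumes e: "e \<longlonglongrightarrow> 0" "\<And>n. e n \<noteq> 0" and v: "AE \<omega> in M. path_min \<omega> \<noteq> v"
  shows "(\<lambda>n. (LINT \<omega>|M. (max 0 (path_min \<omega> + e n * R (argmin_time \<omega> - s) - v) - max 0 (path_min \<omega> - v)) / e n))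
    \<longlonglongrightarrow> (LINT \<omega>|M. R (argmin_time \<omega> - s) * indicator {v<..} (path_min \<omega>))"
    "integrable M (\<lambda>\<omega>. (max 0 (path_min \<omega> + e n * R (argmin_time \<omega> - s) - v) - max 0 (path_min \<omega> - v)) / e n)"
proof -
  have bound: "\<bar>(max 0 (l + e n * R x - v) - max 0 (l - v)) / e n\<bar> \<le> R 0" for l x n
  proof -
    have "\<bar>max 0 (l + e n * R x - v) - max 0 (l - v)\<bar> \<le> \<bar>e n * R x\<bar>" by (auto simp: max_def)
    also have "\<dots> \<le> \<bar>e n\<bar> * R 0" unfolding abs_mult by (intro mult_left_mono R_abs_le) auto
    finally show ?thesis using e(2)[of n] by (simp add: field_simps)
  qed
  show "(\<lambda>n. (LINT \<omega>|M. (max 0 (path_min \<omega> + e n * R (argmin_time \<omega> - s) - v) - max 0 (path_min \<omega> - v)) / e n))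
    \<longlonglongrightarrow> (LINT \<omega>|M. R (argmin_time \<omega> - s) * indicator {v<..} (path_min \<omega>))"
  proof (rule integral_dominated_convergence[where w="\<lambda>_. R 0"])
    show "AE \<omega> in M. (\<lambda>n. (max 0 (path_min \<omega> + e n * R (argmin_time \<omega> - s) - v) - max 0 (path_min \<omega> - v)) / e n)
       \<longlonglongrightarrow> R (argmin_time \<omega> - s) * indicator {v<..} (path_min \<omega>)"
      using v by eventually_elim (rule max0_diff_quotient_tendsto[OF e])
  qed (use bound in auto)
  show "integrable M (\<lambda>\<omega>. (max 0 (path_min \<omega> + e n * R (argmin_time \<omega> - s) - v) - max 0 (path_min \<omega> - v)) / e n)"
    by (rule integrable_const_bound[where B="R 0"]) (use bound in auto)
qed

text \<open>Comparing the two difference quotients for \<open>\<epsilon> > 0\<close> gives one inequality, for \<open>\<epsilon> < 0\<close> the other.\<close>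
lemma integration_by_parts_no_atom:
  assumes R0: "0 < R 0" and s: "s \<in> {0..b}" and v: "AE \<omega> in M. path_min \<omega> \<noteq> v"
  shows "(LINT \<omega>|M. X s \<omega> * max 0 (path_min \<omega> - v)) = (LINT \<omega>|M. R (argmin_time \<omega> - s) * indicator {v<..} (path_min \<omega>))"
proof -
  define e where "e n = 1 / real (Suc n)" for n
  have e: "e \<longlonglongrightarrow> 0" "\<And>n. 0 < e n" "\<And>n. \<bar>e n\<bar> \<le> 1"
    unfolding e_def using LIMSEQ_Suc[OF lim_1_over_n] by auto
  have e': "(\<lambda>n. - e n) \<longlonglongrightarrow> 0" using tendsto_minus[OF e(1)] by simp
  have ne: "e n \<noteq> 0" "- e n \<noteq> 0" for n using e(2)[of n] by auto
  have i: "integrable M (\<lambda>\<omega>. (shifted_excess v s \<epsilon> \<omega> - shifted_excess v s 0 \<omega>) / \<epsilon>)" for \<epsilon>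
    using shifted_excess_integrable by simp
  show ?thesis
  proof (rule antisym)
    show "(LINT \<omega>|M. X s \<omega> * max 0 (path_min \<omega> - v)) \<le> (LINT \<omega>|M. R (argmin_time \<omega> - s) * indicator {v<..} (path_min \<omega>))"
    proof (rule LIMSEQ_le[OF excess_derivative[OF R0 s e(1) ne(1) e(3)] argmin_derivative(1)[OF e(1) ne(1) v]], intro exI allI impI)
      fix n
      show "(LINT \<omega>|M. (shifted_excess v s (e n) \<omega> - shifted_excess v s 0 \<omega>) / e n)
        \<le> (LINT \<omega>|M. (max 0 (path_min \<omega> + e n * R (argmin_time \<omega> - s) - v) - max 0 (path_min \<omega> - v)) / e n)"
        using e(2)[of n]
        by (intro integral_mono[OF i argmin_derivative(2)[OF e(1) ne(1) v]])
           (simp add: shifted_excess_le divide_right_mono)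
    qed
    have e3: "\<bar>- e n\<bar> \<le> 1" for n using e(3)[of n] by simp
    show "(LINT \<omega>|M. R (argmin_time \<omega> - s) * indicator {v<..} (path_min \<omega>)) \<le> (LINT \<omega>|M. X s \<omega> * max 0 (path_min \<omega> - v))"
    proof (rule LIMSEQ_le[OF argmin_derivative(1)[OF e' ne(2) v] excess_derivative[OF R0 s e' ne(2) e3]], intro exI allI impI)
      fix n
      show "(LINT \<omega>|M. (max 0 (path_min \<omega> + (- e n) * R (argmin_time \<omega> - s) - v) - max 0 (path_min \<omega> - v)) / (- e n))
        \<le> (LINT \<omega>|M. (shifted_excess v s (- e n) \<omega> - shifted_excess v s 0 \<omega>) / (- e n))"
      proof (rule integral_mono[OF argmin_derivative(2)[OF e' ne(2) v] i])
        fix \<omega> assume "\<omega> \<in> space M"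
        then have "shifted_excess v s (- e n) \<omega> - shifted_excess v s 0 \<omega> \<le> max 0 (path_min \<omega> + (- e n) * R (argmin_time \<omega> - s) - v) - max 0 (path_min \<omega> - v)"
          using shifted_excess_le(1)[of \<omega> v s "- e n"] shifted_excess_le(2)[of \<omega> v s] by linarith
        then show "(max 0 (path_min \<omega> + (- e n) * R (argmin_time \<omega> - s) - v) - max 0 (path_min \<omega> - v)) / (- e n)
           \<le> (shifted_excess v s (- e n) \<omega> - shifted_excess v s 0 \<omega>) / (- e n)"
          using e(2)[of n] by (intro divide_right_mono_neg) auto
      qed
    qed
  qed
qed

text \<open>The law of the minimum has at most countably many atoms, so any \<open>v\<close> is a limit from the right of levels without
atom, and both sides are right-continuous in \<open>v\<close>.\<close>
theorem integration_by_parts: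
  assumes R0: "0 < R 0" and s: "s \<in> {0..b}"
  shows "(LINT \<omega>|M. X s \<omega> * max 0 (path_min \<omega> - v)) = (LINT \<omega>|M. R (argmin_time \<omega> - s) * indicator {v<..} (path_min \<omega>))"
proof -
  interpret L: real_distribution "distr M borel path_min" by (rule real_distribution_distr) measurable
  let ?C = "{x. measure (distr M borel path_min) {x} > 0}"
  have "\<exists>x. x \<in> {v<..<v + 1 / real (Suc n)} \<and> x \<notin> ?C" for n
  proof -
    have "uncountable {v<..<v + 1 / real (Suc n)}" by (subst uncountable_open_interval) simp
    then show ?thesis using L.countable_atoms by (metis countable_subset subsetI)
  qed
  then obtain u where u: "\<And>n. u n \<in> {v<..<v + 1 / real (Suc n)}" "\<And>n. u n \<notin> ?C" by metis
  have uv: "u \<longlonglongrightarrow> v"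
  proof (rule tendsto_sandwich[of "\<lambda>_. v" u _ "\<lambda>n. v + 1 / real (Suc n)"])
    show "(\<lambda>n. v + 1 / real (Suc n)) \<longlonglongrightarrow> v"
      using tendsto_add[OF tendsto_const LIMSEQ_Suc[OF lim_1_over_n], of v] by simp
  qed (use u(1) in \<open>auto intro!: always_eventually less_imp_le\<close>)
  have noatom: "AE \<omega> in M. path_min \<omega> \<noteq> u n" for n
  proof -
    have "measure (distr M borel path_min) {u n} = 0" using u(2)[of n] measure_nonneg[of "distr M borel path_min" "{u n}"] by simp
    then have "measure M {\<omega>\<in>space M. path_min \<omega> = u n} = 0"
      by (simp add: measure_distr vimage_def Int_def conj_commute)
    then show ?thesis by (subst (asm) prob_eq_0) auto
  qed
  have eq: "(LINT \<omega>|M. X s \<omega> * max 0 (path_min \<omega> - u n)) = (LINT \<omega>|M. R (argmin_time \<omega> - s) * indicator {u n<..} (path_min \<omega>))" for n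
    by (rule integration_by_parts_no_atom[OF R0 s noatom])
  have "(\<lambda>n. LINT \<omega>|M. X s \<omega> * max 0 (path_min \<omega> - u n)) \<longlonglongrightarrow> (LINT \<omega>|M. X s \<omega> * max 0 (path_min \<omega> - v))"
  proof (rule integral_dominated_convergence[where w="\<lambda>\<omega>. (path_sup \<omega>)\<^sup>2 + \<bar>v\<bar> * path_sup \<omega>"])
    show "integrable M (\<lambda>\<omega>. (path_sup \<omega>)\<^sup>2 + \<bar>v\<bar> * path_sup \<omega>)" using path_sup_square_integrable path_sup_integrable by simp
    show "AE \<omega> in M. (\<lambda>n. X s \<omega> * max 0 (path_min \<omega> - u n)) \<longlonglongrightarrow> X s \<omega> * max 0 (path_min \<omega> - v)"
      by (intro AE_I2 tendsto_intros uv)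
    show "AE \<omega> in M. norm (X s \<omega> * max 0 (path_min \<omega> - u n)) \<le> (path_sup \<omega>)\<^sup>2 + \<bar>v\<bar> * path_sup \<omega>" for n
    proof (rule AE_I2)
      fix \<omega> assume \<omega>: "\<omega> \<in> space M"
      have "\<bar>X s \<omega>\<bar> * \<bar>max 0 (path_min \<omega> - u n)\<bar> \<le> path_sup \<omega> * (path_sup \<omega> + \<bar>v\<bar>)"
        using path_sup_bound(1)[OF \<omega> s] path_sup_bound(3,4)[OF \<omega>] u(1)[of n] by (intro mult_mono) auto
      then show "norm (X s \<omega> * max 0 (path_min \<omega> - u n)) \<le> (path_sup \<omega>)\<^sup>2 + \<bar>v\<bar> * path_sup \<omega>"
        by (simp add: abs_mult power2_eq_square algebra_simps)
    qed
  qed measurable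
  moreover have "(\<lambda>n. LINT \<omega>|M. R (argmin_time \<omega> - s) * indicator {u n<..} (path_min \<omega>)) \<longlonglongrightarrow> (LINT \<omega>|M. R (argmin_time \<omega> - s) * indicator {v<..} (path_min \<omega>))"
  proof (rule integral_dominated_convergence[where w="\<lambda>_. R 0"])
    show "AE \<omega> in M. (\<lambda>n. R (argmin_time \<omega> - s) * indicator {u n<..} (path_min \<omega>)) \<longlonglongrightarrow> R (argmin_time \<omega> - s) * indicator {v<..} (path_min \<omega>)"
    proof (rule AE_I2)
      fix \<omega>
      have "\<forall>\<^sub>F n in sequentially. indicator {u n<..} (path_min \<omega>) = (indicator {v<..} (path_min \<omega>) :: real)"
      proof (cases "v < path_min \<omega>")
        case True
        then show ?thesis using order_tendstoD(2)[OF uv True] by (auto elim!: eventually_mono)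
      next
        case False
        have "\<not> u n < path_min \<omega>" for n using False u(1)[of n] by auto
        then show ?thesis using False by simp
      qed
      then have "(\<lambda>n. indicator {u n<..} (path_min \<omega>)) \<longlonglongrightarrow> (indicator {v<..} (path_min \<omega>) :: real)" by (rule tendsto_eventually)
      then show "(\<lambda>n. R (argmin_time \<omega> - s) * indicator {u n<..} (path_min \<omega>)) \<longlonglongrightarrow> R (argmin_time \<omega> - s) * indicator {v<..} (path_min \<omega>)"
        by (intro tendsto_intros)
    qed
    show "AE \<omega> in M. norm (R (argmin_time \<omega> - s) * indicator {u n<..} (path_min \<omega>)) \<le> R 0" for n
      using R_abs_le R_abs_le[of 0] by (auto simp: indicator_def)
  qed auto
  ultimately show ?thesis unfolding eq by (rule LIMSEQ_unique)
qed

end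

section \<open>Probability measures on an interval\<close>

abbreviation interval_space :: "real \<Rightarrow> real measure" where
  "interval_space b \<equiv> restrict_space borel {0..b}"

abbreviation unit_space :: "real measure" where
  "unit_space \<equiv> restrict_space lborel {0<..<1}"

lemma prob_space_unit_space: "prob_space unit_space"
  by (auto simp: emeasure_restrict_space space_restrict_space intro!: prob_spaceI)

lemma prob_measures_onD:
  assumes "\<nu> \<in> prob_measures_on b"
  shows "prob_space \<nu>" "sets \<nu> = sets (interval_space b)" "space \<nu> = {0..b}"
    "f \<in> borel_measurable borel \<Longrightarrow> f \<in> borel_measurable \<nu>"
    "continuous_on {0..b} g \<Longrightarrow> g \<in> borel_measurable \<nu>"
    "(\<lambda>x. x) \<in> measurable \<nu> borel"
proof -
  show ps: "prob_space \<nu>" and s: "sets \<nu> = sets (interval_space b)"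
    using assms by (auto simp: prob_measures_on_def)
  show "space \<nu> = {0..b}" using sets_eq_imp_space_eq[OF s] by (simp add: space_restrict_space)
  show "f \<in> borel_measurable borel \<Longrightarrow> f \<in> borel_measurable \<nu>"
    unfolding measurable_cong_sets[OF s refl] by (rule measurable_restrict_space1)
  show "continuous_on {0..b} g \<Longrightarrow> g \<in> borel_measurable \<nu>"
    unfolding measurable_cong_sets[OF s refl] by (rule borel_measurable_continuous_on_restrict)
  show "(\<lambda>x. x) \<in> measurable \<nu> borel"
    unfolding measurable_cong_sets[OF s refl] by (rule measurable_restrict_space1) simp
qed

lemma distr_in_prob_measures_on:
  assumes "prob_space N" "f \<in> measurable N (interval_space b)"
  shows "distr N (interval_space b) f \<in> prob_measures_on b"
  using assms by (auto simp: prob_measures_on_def prob_space.prob_space_distr)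

lemma measurable_interval_space_iff:
  "f \<in> measurable N (interval_space b) \<longleftrightarrow> f \<in> borel_measurable N \<and> (\<forall>x\<in>space N. f x \<in> {0..b})"
  by (auto simp: measurable_restrict_space2_iff)

text \<open>The quantile function is the pseudo-inverse of the distribution function; it takes values in \<open>[0,b]\<close> because the
distribution function vanishes left of \<open>0\<close> and equals \<open>1\<close> at \<open>b\<close>.\<close>
theorem quantile_representation:
  assumes \<nu>: "\<nu> \<in> prob_measures_on b"
  obtains q where "q \<in> measurable unit_space (interval_space b)" "mono_on {0<..<1} q"
    "\<nu> = distr unit_space (interval_space b) q"
proof -
  note N = prob_measures_onD[OF \<nu>]
  interpret N: prob_space \<nu> by (rule N(1))
  define D where "D = distr \<nu> borel (\<lambda>x. x)"
  interpret D: real_distribution D unfolding D_def by (rule N.real_distribution_distr[OF N(6)])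
  interpret D: cdf_distribution D ..
  have I_range: "D.I u \<in> {0..b}" if u: "u \<in> {0<..<1}" for u
  proof -
    have cdf: "D.C x = measure \<nu> ({..x} \<inter> {0..b})" for x
      unfolding cdf_def D_def by (simp add: measure_distr N(6) N(3))
    have "D.C b = 1" using N.prob_space unfolding cdf N(3) by (metis Int_absorb1 atMost_iff atLeastAtMost_iff subsetI)
    then have "D.I u \<le> b" using D.pseudoinverse[of u b] u by simp
    moreover have "0 \<le> D.I u"
    proof (rule ccontr)
      define i where "i = D.I u"
      assume "\<not> 0 \<le> D.I u"
      then have "{..i} \<inter> {0..b} = {}" by (auto simp: i_def)
      then have "D.C i = 0" using cdf[of i] by simp
      moreover have "u \<le> D.C i" using D.pseudoinverse[of u i] u by (simp add: i_def)
      ultimately show False using u by simp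
    qed
    ultimately show ?thesis by simp
  qed
  have mI: "D.I \<in> borel_measurable unit_space"
    using D.measurable_CI by (simp add: measurable_cong_sets[OF sets_restrict_space_cong[OF sets_lborel] refl])
  have q: "D.I \<in> measurable unit_space (interval_space b)"
    unfolding measurable_interval_space_iff using mI I_range by (auto simp: space_restrict_space)
  have "\<nu> = distr unit_space (interval_space b) D.I"
  proof (rule measure_eqI)
    fix A assume "A \<in> sets \<nu>"
    then have A: "A \<in> sets (interval_space b)" by (simp add: N(2))
    then have A': "A \<in> sets borel" "A \<subseteq> {0..b}" by (auto simp: sets_restrict_space)
    have "emeasure \<nu> A = emeasure D A"
      unfolding D_def using A' N(3,6) by (subst emeasure_distr) (auto simp: Int_absorb2)
    also have "\<dots> = emeasure (distr unit_space borel D.I) A" by (simp only: D.distr_I_eq_M)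
    also have "\<dots> = emeasure unit_space (D.I -` A \<inter> space unit_space)" using A' mI by (simp add: emeasure_distr)
    also have "\<dots> = emeasure (distr unit_space (interval_space b) D.I) A" using A q by (simp add: emeasure_distr)
    finally show "emeasure \<nu> A = emeasure (distr unit_space (interval_space b) D.I) A" .
  qed (simp add: N(2))
  with q D.mono_I show ?thesis by (rule that)
qed

lemma integral_interval_distr:
  assumes "f \<in> measurable N (interval_space b)" "g \<in> borel_measurable (interval_space b)"
  shows "(LINT x|distr N (interval_space b) f. g x) = (LINT u|N. (g (f u) :: real))"
  using assms by (rule integral_distr)

text \<open>Helly's selection theorem followed by Skorohod's representation. The latter gives variables that lie in \<open>[0,b]\<close>
only almost surely, so they are projected onto the interval.\<close>
theorem prob_measures_on_coupling:
  assumes b: "0 < b" and \<nu>: "\<And>n. \<nu> n \<in> prob_measures_on b"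
  obtains r :: "nat \<Rightarrow> nat" and \<Omega> :: "real measure" and Y and Y' where
    "strict_mono r" "prob_space \<Omega>" "\<And>n. Y n \<in> measurable \<Omega> (interval_space b)" "Y' \<in> measurable \<Omega> (interval_space b)"
    "\<And>n. \<nu> (r n) = distr \<Omega> (interval_space b) (Y n)" "\<And>x. x \<in> space \<Omega> \<Longrightarrow> (\<lambda>n. Y n x) \<longlonglongrightarrow> Y' x"
proof -
  define D where "D n = distr (\<nu> n) borel (\<lambda>x. x)" for n
  have rd: "real_distribution (D n)" for n
    unfolding D_def by (rule prob_space.real_distribution_distr[OF prob_measures_onD(1,6)[OF \<nu>]])
  have D1: "measure (D n) {-1<..b} = 1" for n
  proof -
    have "{-1<..b} \<inter> {0..b} = {0..b}" by auto
    then show ?thesis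
      using prob_space.prob_space[OF prob_measures_onD(1)[OF \<nu>[of n]]] prob_measures_onD(3,6)[OF \<nu>[of n]]
      by (simp add: D_def measure_distr)
  qed
  have "tight D" unfolding tight_def
  proof (intro conjI allI impI rd)
    fix \<epsilon> :: real assume "0 < \<epsilon>"
    then have "- 1 < b \<and> (\<forall>n. 1 - \<epsilon> < measure (D n) {- 1<..b})" using D1 b by simp
    then show "\<exists>a c. a < c \<and> (\<forall>n. 1 - \<epsilon> < measure (D n) {a<..c})" by blast
  qed
  from tight_imp_convergent_subsubsequence[OF this strict_mono_id]
  obtain r L where r: "strict_mono r" and L: "real_distribution L" and conv: "weak_conv_m (D \<circ> id \<circ> r) L" by blast
  have rd': "real_distribution ((D \<circ> id \<circ> r) n)" for n using rd by simp
  from Skorohod[OF rd' L conv]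
  obtain \<Omega> :: "real measure" and Z Z' where S: "prob_space \<Omega> \<and> (\<forall>n. Z n \<in> borel_measurable \<Omega>) \<and>
      (\<forall>n. distr \<Omega> borel (Z n) = (D \<circ> id \<circ> r) n) \<and> Z' \<in> measurable \<Omega> lborel \<and> distr \<Omega> borel Z' = L \<and>
      (\<forall>x\<in>space \<Omega>. (\<lambda>n. Z n x) \<longlonglongrightarrow> Z' x)"
    by blast
  then have \<Omega>: "prob_space \<Omega>" and Z[measurable]: "\<And>n. Z n \<in> borel_measurable \<Omega>"
    and D: "\<And>n. distr \<Omega> borel (Z n) = D (r n)" and Z'[measurable]: "Z' \<in> borel_measurable \<Omega>"
    and lim: "\<And>x. x \<in> space \<Omega> \<Longrightarrow> (\<lambda>n. Z n x) \<longlonglongrightarrow> Z' x"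
    by simp_all
  define cl where "cl x = max 0 (min b x)" for x :: real
  have cl[measurable]: "cl \<in> borel_measurable borel" unfolding cl_def by measurable
  have cl': "cl \<in> measurable borel (interval_space b)"
    unfolding measurable_interval_space_iff using b by (auto simp: cl_def)
  have Zcl: "(\<lambda>x. cl (Z n x)) \<in> measurable \<Omega> (interval_space b)" for n
    using measurable_compose[OF Z cl'] .
  have "distr \<Omega> (interval_space b) (\<lambda>x. cl (Z n x)) = \<nu> (r n)" for n
  proof -
    note N = prob_measures_onD[OF \<nu>[of "r n"]]
    have "distr \<Omega> (interval_space b) (\<lambda>x. cl (Z n x)) = distr (distr \<Omega> borel (Z n)) (interval_space b) cl"
      by (simp add: distr_distr[OF cl' Z] comp_def)
    also have "\<dots> = distr (\<nu> (r n)) (interval_space b) (\<lambda>x. cl x)"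
      unfolding D D_def by (simp add: distr_distr[OF cl' N(6)] comp_def)
    also have "\<dots> = distr (\<nu> (r n)) (\<nu> (r n)) (\<lambda>x. x)"
      by (rule distr_cong) (auto simp: N cl_def)
    finally show ?thesis by simp
  qed
  moreover have "(\<lambda>n. cl (Z n x)) \<longlonglongrightarrow> cl (Z' x)" if "x \<in> space \<Omega>" for x
    unfolding cl_def by (intro tendsto_intros lim that)
  ultimately show ?thesis
    using that[OF r \<Omega> Zcl measurable_compose[OF Z' cl']] by simp
qed

section \<open>Rearrangement and compactness for convex kernels\<close>

text \<open>If the intervals \<open>[x1,y1]\<close> and \<open>[x2,y2]\<close> are strictly nested, passing to minima and maxima of the endpoints replaces the
lengths by two lengths with the same sum strictly between them. Otherwise the same two lengths result. All lengths are
nonnegative, so convexity on \<open>[0,b]\<close> suffices although \<open>R\<close> may have a peak at \<open>0\<close>.\<close>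
lemma strictly_convex_rearrangement:
  fixes R :: "real \<Rightarrow> real"
  assumes conv: "strictly_convex_on {0..b} R"
    and le: "x1 \<le> y1" "x2 \<le> y2" "y1 - x1 \<le> b" "y2 - x2 \<le> b"
  shows "R (min y1 y2 - min x1 x2) + R (max y1 y2 - max x1 x2) \<le> R (y1 - x1) + R (y2 - x2)"
    "(x1 < x2 \<and> y2 < y1) \<or> (x2 < x1 \<and> y1 < y2) \<Longrightarrow>
      R (min y1 y2 - min x1 x2) + R (max y1 y2 - max x1 x2) < R (y1 - x1) + R (y2 - x2)"
proof -
  have cross: "R (v - x) + R (y - u) < R (y - x) + R (v - u)" if "x < u" "u \<le> v" "v < y" "y - x \<le> b" for x y u v
  proof -
    define c where "c = (u - x) / (y - x - (v - u))"
    have D: "0 < y - x - (v - u)" using that by linarith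
    then have c: "0 < c" "c < 1" unfolding c_def using that by (auto simp: field_simps)
    have "c * (y - x - (v - u)) = u - x" using D by (simp add: c_def)
    then have eq: "v - x = (1 - c) * (v - u) + c * (y - x)" "y - u = (1 - (1 - c)) * (v - u) + (1 - c) * (y - x)"
      by (simp_all add: algebra_simps)
    have 1: "R ((1 - d) * (v - u) + d * (y - x)) < (1 - d) * R (v - u) + d * R (y - x)" if "0 < d" "d < 1" for d
      using conv \<open>x < u\<close> \<open>u \<le> v\<close> \<open>v < y\<close> \<open>y - x \<le> b\<close> that unfolding strictly_convex_on_def by auto
    from 1[OF c] 1[of "1 - c"] c show ?thesis unfolding eq[symmetric] by (simp add: algebra_simps)
  qed
  have strict: "R (min y1 y2 - min x1 x2) + R (max y1 y2 - max x1 x2) < R (y1 - x1) + R (y2 - x2)"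
    if "(x1 < x2 \<and> y2 < y1) \<or> (x2 < x1 \<and> y1 < y2)"
    using that cross[of x1 x2 y2 y1] cross[of x2 x1 y1 y2] le by (auto simp: min_def max_def)
  then show "(x1 < x2 \<and> y2 < y1) \<or> (x2 < x1 \<and> y1 < y2) \<Longrightarrow>
      R (min y1 y2 - min x1 x2) + R (max y1 y2 - max x1 x2) < R (y1 - x1) + R (y2 - x2)" .
  show "R (min y1 y2 - min x1 x2) + R (max y1 y2 - max x1 x2) \<le> R (y1 - x1) + R (y2 - x2)"
  proof (cases "(x1 < x2 \<and> y2 < y1) \<or> (x2 < x1 \<and> y1 < y2)")
    case False
    then show ?thesis by (auto simp: min_def max_def)
  qed (use strict in auto)
qed

locale energy_kernel =
  fixes b :: real and R :: "real \<Rightarrow> real" and C :: real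
  assumes b_pos: "0 < b" and R_continuous: "continuous_on UNIV R" and R_bound: "\<And>t. \<bar>R t\<bar> \<le> C"
    and R_sym: "\<And>t. R (- t) = R t" and R_convex: "strictly_convex_on {0..b} R"
begin

definition cross :: "real measure \<Rightarrow> real measure \<Rightarrow> real" where
  "cross \<mu> \<nu> = (LINT t|\<mu>. (LINT s|\<nu>. R (t - s)))"

lemma energy_eq_cross: "energy R \<nu> = cross \<nu> \<nu>" by (simp add: energy_def cross_def)

lemma R_measurable[measurable]: "R \<in> borel_measurable borel"
  by (rule borel_measurable_continuous_onI[OF R_continuous])

lemma abs_integral_le:
  fixes f :: "'x \<Rightarrow> real"
  assumes "prob_space N" "\<And>x. \<bar>f x\<bar> \<le> B" shows "\<bar>LINT x|N. f x\<bar> \<le> B"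
proof -
  interpret prob_space N by fact
  have B: "0 \<le> B" using assms(2) abs_ge_zero order_trans by blast
  show ?thesis
  proof (cases "integrable N f")
    case True
    have "\<bar>LINT x|N. f x\<bar> \<le> (LINT x|N. \<bar>f x\<bar>)" by (rule integral_abs_bound)
    also have "\<dots> \<le> (LINT x|N. B)" using True assms(2) by (intro integral_mono) auto
    finally show ?thesis by (simp add: prob_space)
  qed (use B in \<open>simp add: not_integrable_integral_eq\<close>)
qed

lemma potential_measurable:
  assumes "prob_space N" and [measurable]: "f \<in> borel_measurable N"
  shows "(\<lambda>t. LINT s|N. R (t - f s)) \<in> borel_measurable borel"
proof -
  interpret prob_space N by fact
  show ?thesis by measurable
qed

lemma cross_distr:
  assumes N: "prob_space N" "prob_space L" and f: "f \<in> measurable N (interval_space b)" and g: "g \<in> measurable L (interval_space b)"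
  shows "cross (distr N (interval_space b) f) (distr L (interval_space b) g) = (LINT u|N. (LINT v|L. R (f u - g v)))"
proof -
  have [measurable]: "g \<in> borel_measurable L" using g by (simp add: measurable_interval_space_iff)
  have inner: "(LINT s|distr L (interval_space b) g. R (t - s)) = (LINT v|L. R (t - g v))" for t
    by (rule integral_interval_distr[OF g]) (intro measurable_restrict_space1, measurable)
  show ?thesis unfolding cross_def inner
    by (rule integral_interval_distr[OF f]) (intro measurable_restrict_space1 potential_measurable N, measurable)
qed

lemma double_integrable:
  assumes N: "prob_space N" and [measurable]: "f \<in> borel_measurable N"
  shows "integrable N (\<lambda>v. R (t - f v))" "integrable N (\<lambda>u. LINT v|N. R (f u - f v))"
proof -
  interpret N: prob_space N by fact
  show "integrable N (\<lambda>v. R (t - f v))" by (rule N.integrable_const_bound[where B=C]) (auto simp: R_bound)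
  have "(\<lambda>u. LINT v|N. R (f u - f v)) \<in> borel_measurable N" by measurable
  then show "integrable N (\<lambda>u. LINT v|N. R (f u - f v))"
    by (intro N.integrable_const_bound[where B=C]) (auto intro!: abs_integral_le[OF N] R_bound)
qed

theorem prob_measures_on_compact:
  assumes \<nu>: "\<And>n. \<nu> n \<in> prob_measures_on b"
  obtains r :: "nat \<Rightarrow> nat" and \<nu>' where "strict_mono r" "\<nu>' \<in> prob_measures_on b"
    "\<And>f. continuous_on {0..b} f \<Longrightarrow> (\<lambda>n. LINT t|\<nu> (r n). f t) \<longlonglongrightarrow> (LINT t|\<nu>'. f t :: real)"
    "(\<lambda>n. energy R (\<nu> (r n))) \<longlonglongrightarrow> energy R \<nu>'"
proof -
  obtain r :: "nat \<Rightarrow> nat" and \<Omega> :: "real measure" and Y and Y' where r: "strict_mono r" and \<Omega>: "prob_space \<Omega>"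
    and Y: "\<And>n. Y n \<in> measurable \<Omega> (interval_space b)" and Y': "Y' \<in> measurable \<Omega> (interval_space b)"
    and eq: "\<And>n. \<nu> (r n) = distr \<Omega> (interval_space b) (Y n)" and lim: "\<And>x. x \<in> space \<Omega> \<Longrightarrow> (\<lambda>n. Y n x) \<longlonglongrightarrow> Y' x"
    by (rule prob_measures_on_coupling[where \<nu>=\<nu>, OF b_pos \<nu>]) (rule that; assumption)
  interpret \<Omega>: prob_space \<Omega> by fact
  have [measurable]: "\<And>n. Y n \<in> borel_measurable \<Omega>" "Y' \<in> borel_measurable \<Omega>"
    using Y Y' by (auto simp: measurable_interval_space_iff)
  have range: "x \<in> space \<Omega> \<Longrightarrow> Y n x \<in> {0..b}" "x \<in> space \<Omega> \<Longrightarrow> Y' x \<in> {0..b}" for n x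
    using Y Y' by (auto simp: measurable_interval_space_iff)
  let ?\<nu>' = "distr \<Omega> (interval_space b) Y'"
  have 1: "(\<lambda>n. LINT t|\<nu> (r n). f t) \<longlonglongrightarrow> (LINT t|?\<nu>'. f t)" if f: "continuous_on {0..b} f" for f :: "real \<Rightarrow> real"
  proof -
    have mf: "f \<in> borel_measurable (interval_space b)" by (rule borel_measurable_continuous_on_restrict[OF f])
    obtain B where "\<forall>y\<in>f ` {0..b}. norm y \<le> B"
      using compact_imp_bounded[OF compact_continuous_image[OF f compact_Icc]] unfolding bounded_iff by blast
    then have B: "\<bar>f t\<bar> \<le> B" if "t \<in> {0..b}" for t using that by simp
    have "(\<lambda>n. LINT u|\<Omega>. f (Y n u)) \<longlonglongrightarrow> (LINT u|\<Omega>. f (Y' u))"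
    proof (rule integral_dominated_convergence[where w="\<lambda>_. B"])
      show "AE u in \<Omega>. (\<lambda>n. f (Y n u)) \<longlonglongrightarrow> f (Y' u)"
        using range by (intro AE_I2 continuous_on_tendsto_compose[OF f lim]) auto
      show "AE u in \<Omega>. norm (f (Y n u)) \<le> B" for n using B range by auto
    qed (auto intro: measurable_compose[OF Y mf] measurable_compose[OF Y' mf])
    then show ?thesis unfolding eq integral_interval_distr[OF Y mf] integral_interval_distr[OF Y' mf] .
  qed
  have Rlim: "(\<lambda>n. R (x n)) \<longlonglongrightarrow> R y" if "x \<longlonglongrightarrow> y" for x y
    using continuous_on_tendsto_compose[OF R_continuous that] by simp
  have "(\<lambda>n. LINT u|\<Omega>. (LINT v|\<Omega>. R (Y n u - Y n v))) \<longlonglongrightarrow> (LINT u|\<Omega>. (LINT v|\<Omega>. R (Y' u - Y' v)))"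
  proof (rule integral_dominated_convergence[where w="\<lambda>_. C"])
    show "AE u in \<Omega>. (\<lambda>n. LINT v|\<Omega>. R (Y n u - Y n v)) \<longlonglongrightarrow> (LINT v|\<Omega>. R (Y' u - Y' v))"
    proof (rule AE_I2)
      fix u assume u: "u \<in> space \<Omega>"
      show "(\<lambda>n. LINT v|\<Omega>. R (Y n u - Y n v)) \<longlonglongrightarrow> (LINT v|\<Omega>. R (Y' u - Y' v))"
        by (rule integral_dominated_convergence[where w="\<lambda>_. C"])
           (auto intro!: AE_I2 Rlim tendsto_diff lim u simp: R_bound)
    qed
    show "AE u in \<Omega>. norm (LINT v|\<Omega>. R (Y n u - Y n v)) \<le> C" for n
      by (auto intro!: abs_integral_le[OF \<Omega>] R_bound)
  qed measurable
  then have 2: "(\<lambda>n. energy R (\<nu> (r n))) \<longlonglongrightarrow> energy R ?\<nu>'"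
    unfolding energy_eq_cross eq cross_distr[OF \<Omega> \<Omega> Y Y] cross_distr[OF \<Omega> \<Omega> Y' Y'] .
  show ?thesis by (rule that[OF r distr_in_prob_measures_on[OF \<Omega> Y'] 1 2])
qed

end

section \<open>Existence and uniqueness of the optimal measure\<close>

locale psd_energy_kernel = energy_kernel +
  assumes psd: "\<And>\<mu> \<nu>. \<mu> \<in> prob_measures_on b \<Longrightarrow> \<nu> \<in> prob_measures_on b \<Longrightarrow>
    2 * cross \<mu> \<nu> \<le> energy R \<mu> + energy R \<nu>"
begin

lemma optimal_measure_iff:
  "optimal_measure b R \<nu> \<longleftrightarrow> \<nu> \<in> prob_measures_on b \<and> (\<forall>\<mu>\<in>prob_measures_on b. energy R \<nu> \<le> energy R \<mu>)"
  by (auto simp: optimal_measure_def is_arg_min_linorder)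

lemma bounded_integrable_interval:
  assumes \<nu>: "\<nu> \<in> prob_measures_on b" and [measurable]: "g \<in> borel_measurable borel"
    and B: "\<And>x. x \<in> {0..b} \<Longrightarrow> \<bar>g x\<bar> \<le> (B::real)"
  shows "integrable \<nu> g"
proof -
  note N = prob_measures_onD[OF \<nu>]
  interpret prob_space \<nu> by (rule N)
  show ?thesis by (rule integrable_const_bound[where B=B]) (use B N in auto)
qed

text \<open>The measure \<open>(\<mu> + \<nu>)/2\<close>, described through its integrals.\<close>
definition midpoint_measure :: "real measure \<Rightarrow> real measure \<Rightarrow> real measure \<Rightarrow> bool" where
  "midpoint_measure \<mu> \<nu> \<rho> \<longleftrightarrow> \<rho> \<in> prob_measures_on b \<and>
     (\<forall>g B. g \<in> borel_measurable borel \<longrightarrow> (\<forall>x\<in>{0..b}. \<bar>g x\<bar> \<le> (B::real)) \<longrightarrow>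
        (LINT x|\<rho>. g x) = ((LINT x|\<mu>. g x) + (LINT x|\<nu>. g x)) / 2)"

lemma midpoint_measureD:
  assumes "midpoint_measure \<mu> \<nu> \<rho>" "g \<in> borel_measurable borel" "\<And>x. x \<in> {0..b} \<Longrightarrow> \<bar>g x\<bar> \<le> (B::real)"
  shows "(LINT x|\<rho>. g x) = ((LINT x|\<mu>. g x) + (LINT x|\<nu>. g x)) / 2"
  using assms unfolding midpoint_measure_def by blast

text \<open>A fair coin decides from which of the two measures to sample.\<close>
lemma midpoint_measure_exists:
  assumes \<mu>: "\<mu> \<in> prob_measures_on b" and \<nu>: "\<nu> \<in> prob_measures_on b"
  shows "\<exists>\<rho>. midpoint_measure \<mu> \<nu> \<rho>"
proof -
  obtain p where p: "p \<in> measurable unit_space (interval_space b)" "\<mu> = distr unit_space (interval_space b) p"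
    by (rule quantile_representation[OF \<mu>]) (rule that; assumption)
  obtain q where q: "q \<in> measurable unit_space (interval_space b)" "\<nu> = distr unit_space (interval_space b) q"
    by (rule quantile_representation[OF \<nu>]) (rule that; assumption)
  interpret U: prob_space unit_space by (rule prob_space_unit_space)
  interpret P: pair_prob_space "measure_pmf (bernoulli_pmf (1/2))" unit_space ..
  let ?P = "measure_pmf (bernoulli_pmf (1/2)) \<Otimes>\<^sub>M unit_space"
  define f where "f z = (if fst z then p (snd z) else q (snd z))" for z :: "bool \<times> real"
  have [measurable]: "p \<in> borel_measurable unit_space" "q \<in> borel_measurable unit_space"
    using p q by (auto simp: measurable_interval_space_iff)
  have [measurable]: "Measurable.pred ?P fst"
    by (rule measurable_compose[OF measurable_fst]) simp
  have f: "f \<in> measurable ?P (interval_space b)"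
    unfolding measurable_interval_space_iff
  proof
    show "f \<in> borel_measurable ?P" unfolding f_def by measurable
    show "\<forall>x\<in>space ?P. f x \<in> {0..b}"
      using p(1) q(1) by (auto simp: f_def space_pair_measure measurable_interval_space_iff)
  qed
  show ?thesis
    unfolding midpoint_measure_def
  proof (intro exI conjI allI impI)
    show "distr ?P (interval_space b) f \<in> prob_measures_on b"
      by (rule distr_in_prob_measures_on[OF P.prob_space_axioms f])
    fix g :: "real \<Rightarrow> real" and B assume [measurable]: "g \<in> borel_measurable borel" and B: "\<forall>x\<in>{0..b}. \<bar>g x\<bar> \<le> B"
    have g': "g \<in> borel_measurable (interval_space b)" by (rule measurable_restrict_space1) simp
    have "integrable ?P (\<lambda>z. g (f z))"
    proof (rule P.P.integrable_const_bound[where B=B])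
      show "AE z in ?P. norm (g (f z)) \<le> B"
        using f B by (auto simp: measurable_interval_space_iff)
    qed (rule measurable_compose[OF f g'])
    from P.integral_fst'[OF this]
    have "(LINT z|?P. g (f z)) = (LINT c|measure_pmf (bernoulli_pmf (1/2)). (LINT u|unit_space. g (f (c, u))))" ..
    also have "\<dots> = ((LINT u|unit_space. g (p u)) + (LINT u|unit_space. g (q u))) / 2"
      by (simp add: f_def)
    finally show "(LINT x|distr ?P (interval_space b) f. g x) = ((LINT x|\<mu>. g x) + (LINT x|\<nu>. g x)) / 2"
      unfolding p(2) q(2) integral_interval_distr[OF f g'] integral_interval_distr[OF p(1) g'] integral_interval_distr[OF q(1) g'] .
  qed
qed

lemma potential_bounded:
  assumes \<nu>: "\<nu> \<in> prob_measures_on b"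
  shows "(\<lambda>t. LINT s|\<nu>. R (t - s)) \<in> borel_measurable borel" "\<bar>LINT s|\<nu>. R (t - s)\<bar> \<le> C"
  using prob_measures_onD(1,6)[OF \<nu>] by (auto intro!: potential_measurable abs_integral_le R_bound)

lemma mixture_optimal:
  assumes \<mu>: "optimal_measure b R \<mu>" and \<nu>: "optimal_measure b R \<nu>" and \<rho>: "midpoint_measure \<mu> \<nu> \<rho>"
  shows "optimal_measure b R \<rho>"
proof -
  have PM: "\<mu> \<in> prob_measures_on b" "\<nu> \<in> prob_measures_on b" using \<mu> \<nu> by (auto simp: optimal_measure_iff)
  let ?h = "\<lambda>\<nu> t. LINT s|\<nu>. R (t - s)"
  have inner: "?h \<rho> t = (?h \<mu> t + ?h \<nu> t) / 2" for t
    by (rule midpoint_measureD[OF \<rho>, where B=C]) (auto simp: R_bound)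
  note bdd = potential_bounded[OF PM(1)] potential_bounded[OF PM(2)]
  note int = bounded_integrable_interval[OF _ bdd(1) bdd(2)] bounded_integrable_interval[OF _ bdd(3) bdd(4)]
  have half: "\<bar>(x + y) / 2\<bar> \<le> C" if "\<bar>x\<bar> \<le> C" "\<bar>y\<bar> \<le> C" for x y
    using that abs_triangle_ineq[of x y] by (simp add: abs_divide)
  have "\<bar>(?h \<mu> t + ?h \<nu> t) / 2\<bar> \<le> C" for t by (rule half[OF bdd(2) bdd(4)])
  then have "energy R \<rho> = ((LINT t|\<mu>. (?h \<mu> t + ?h \<nu> t) / 2) + (LINT t|\<nu>. (?h \<mu> t + ?h \<nu> t) / 2)) / 2"
    unfolding energy_def inner using bdd by (intro midpoint_measureD[OF \<rho>, where B=C]) auto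
  also have "\<dots> = (cross \<mu> \<mu> + cross \<mu> \<nu> + (cross \<nu> \<mu> + cross \<nu> \<nu>)) / 4"
    using int PM by (simp add: cross_def add_divide_distrib)
  also have "\<dots> \<le> (energy R \<mu> + energy R \<nu>) / 2"
    using psd[OF PM] psd[OF PM(2) PM(1)] by (simp add: energy_eq_cross)
  also have "energy R \<mu> = energy R \<nu>" using \<mu> \<nu> by (auto simp: optimal_measure_iff intro: antisym)
  finally show ?thesis using \<rho> \<nu> by (auto simp: optimal_measure_iff midpoint_measure_def intro: order_trans)
qed

text \<open>The functions \<open>min p (q + \<delta>)\<close> and \<open>max (p - \<delta>) q\<close> again take values in \<open>[0,b]\<close>; here \<open>0 \<le> \<delta>\<close> is used. By rearrangement
their total energy is at most that of \<open>p\<close> and \<open>q\<close>, which is minimal, so equality holds for almost every pair of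
arguments. A crossing would make the inequality strict on a set of positive measure.\<close>
lemma quantiles_do_not_cross:
  assumes opt: "optimal_measure b R (distr unit_space (interval_space b) p)" "optimal_measure b R (distr unit_space (interval_space b) q)"
    and p: "p \<in> measurable unit_space (interval_space b)" "mono_on {0<..<1} p"
    and q: "q \<in> measurable unit_space (interval_space b)" "mono_on {0<..<1} q"
    and \<delta>: "0 \<le> \<delta>"
  shows "(AE u in unit_space. q u + \<delta> \<le> p u) \<or> (AE u in unit_space. p u \<le> q u + \<delta>)"
proof -
  interpret U: prob_space unit_space by (rule prob_space_unit_space)
  have sp: "space unit_space = {0<..<1}" by (simp add: space_restrict_space)
  have pm[measurable]: "p \<in> borel_measurable unit_space" "q \<in> borel_measurable unit_space"
    and range: "\<And>u. u \<in> {0<..<1} \<Longrightarrow> p u \<in> {0..b}" "\<And>u. u \<in> {0<..<1} \<Longrightarrow> q u \<in> {0..b}"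
    using p q by (auto simp: measurable_interval_space_iff sp)
  define lo where "lo u = min (p u) (q u + \<delta>)" for u
  define hi where "hi u = max (p u - \<delta>) (q u)" for u
  have [measurable]: "lo \<in> borel_measurable unit_space" "hi \<in> borel_measurable unit_space"
    unfolding lo_def hi_def by measurable
  have lohi: "lo \<in> measurable unit_space (interval_space b)" "hi \<in> measurable unit_space (interval_space b)"
    unfolding measurable_interval_space_iff sp using range \<delta> by (fastforce simp: lo_def hi_def)+
  let ?D = "\<lambda>f. distr unit_space (interval_space b) f"
  let ?E = "\<lambda>f. LINT u|unit_space. (LINT v|unit_space. R (f u - f v))"
  have E: "energy R (?D f) = ?E f" if "f \<in> measurable unit_space (interval_space b)" for f
    unfolding energy_eq_cross by (rule cross_distr[OF prob_space_unit_space prob_space_unit_space that that])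
  have PM: "?D lo \<in> prob_measures_on b" "?D hi \<in> prob_measures_on b"
    by (rule distr_in_prob_measures_on[OF prob_space_unit_space] lohi)+
  have le: "?E p \<le> ?E lo" "?E q \<le> ?E hi"
    using opt PM lohi p q by (auto simp: optimal_measure_iff E[symmetric])
  \<comment> \<open>the energy lost through the rearrangement by the pair \<open>(u, v)\<close>\<close>
  define h where "h u v = R (p u - p v) + R (q u - q v) - R (lo u - lo v) - R (hi u - hi v)" for u v
  have h_pt: "0 \<le> h u v \<and> ((p u < q u + \<delta> \<and> q v + \<delta> < p v) \<or> (q u + \<delta> < p u \<and> p v < q v + \<delta>) \<longrightarrow> 0 < h u v)"
    if u: "u \<in> {0<..<1}" and v: "v \<in> {0<..<1}" and uv: "u \<le> v" for u v
  proof -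
    have m: "p u \<le> p v" "q u + \<delta> \<le> q v + \<delta>" using p(2) q(2) u v uv by (auto simp: mono_on_def)
    have d: "p v - p u \<le> b" "(q v + \<delta>) - (q u + \<delta>) \<le> b" using range[OF u] range[OF v] by auto
    have neg: "R (x - y) = R (y - x)" for x y using R_sym[of "x - y"] by simp
    have eq: "h u v = R (p v - p u) + R ((q v + \<delta>) - (q u + \<delta>))
        - (R (min (p v) (q v + \<delta>) - min (p u) (q u + \<delta>)) + R (max (p v) (q v + \<delta>) - max (p u) (q u + \<delta>)))"
    proof -
      have "hi v - hi u = max (p v) (q v + \<delta>) - max (p u) (q u + \<delta>)" by (auto simp: hi_def max_def)
      then show ?thesis unfolding h_def neg[of "p u"] neg[of "q u"] neg[of "lo u"] neg[of "hi u"] by (simp add: lo_def)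
    qed
    show ?thesis unfolding eq using strictly_convex_rearrangement[OF R_convex m d] by auto
  qed
  have h_sym: "h u v = h v u" for u v
    unfolding h_def using R_sym[of "p u - p v"] R_sym[of "q u - q v"] R_sym[of "lo u - lo v"] R_sym[of "hi u - hi v"] by simp
  have h: "0 \<le> h u v" "p u < q u + \<delta> \<Longrightarrow> q v + \<delta> < p v \<Longrightarrow> 0 < h u v"
    if u: "u \<in> {0<..<1}" and v: "v \<in> {0<..<1}" for u v
    using h_pt[OF u v] h_pt[OF v u] h_sym[of u v] by (cases "u \<le> v"; auto)+
  define H where "H u = (LINT v|unit_space. h u v)" for u
  have hint: "integrable unit_space (h u)" for u
    unfolding h_def using double_integrable(1)[OF prob_space_unit_space] by simp
  have Heq: "H u = (LINT v|unit_space. R (p u - p v)) + (LINT v|unit_space. R (q u - q v))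
      - (LINT v|unit_space. R (lo u - lo v)) - (LINT v|unit_space. R (hi u - hi v))" for u
    unfolding H_def h_def using double_integrable(1)[OF prob_space_unit_space] by simp
  note dint = double_integrable(2)[OF prob_space_unit_space]
  have Hint: "integrable unit_space H" unfolding Heq using dint by simp
  have "(LINT u|unit_space. H u) = ?E p + ?E q - ?E lo - ?E hi" unfolding Heq using dint by simp
  then have "(LINT u|unit_space. H u) \<le> 0" using le by simp
  moreover have H0: "0 \<le> H u" if "u \<in> {0<..<1}" for u
    unfolding H_def using h(1)[OF that] by (intro integral_nonneg_AE AE_I2) (auto simp: sp)
  moreover have H0': "AE u in unit_space. 0 \<le> H u" using H0 by (auto simp: sp)
  ultimately have "(LINT u|unit_space. H u) = 0" using integral_nonneg_AE[OF H0'] by linarith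
  then have AEH: "AE u in unit_space. H u = 0"
    using integral_nonneg_eq_0_iff_AE[OF Hint H0'] by simp
  show ?thesis
  proof (cases "AE u in unit_space. q u + \<delta> \<le> p u")
    case False
    have "\<exists>u\<in>space unit_space. H u = 0 \<and> p u < q u + \<delta>"
    proof (rule ccontr)
      assume "\<not> ?thesis"
      then have "\<And>u. u \<in> space unit_space \<Longrightarrow> H u = 0 \<Longrightarrow> q u + \<delta> \<le> p u" by (meson not_le)
      then have "AE u in unit_space. q u + \<delta> \<le> p u" using AEH AE_space by (auto elim: eventually_elim2)
      with False show False ..
    qed
    then obtain u where u: "u \<in> {0<..<1}" "H u = 0" "p u < q u + \<delta>" by (auto simp: sp)
    have nn: "AE v in unit_space. 0 \<le> h u v" using h(1)[OF u(1)] by (auto simp: sp)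
    have "AE v in unit_space. h u v = 0"
      using u(2) integral_nonneg_eq_0_iff_AE[OF hint nn] by (simp add: H_def)
    then have "AE v in unit_space. p v \<le> q v + \<delta>"
    proof (rule AE_mp, intro AE_I2 impI)
      fix v assume "v \<in> space unit_space" "h u v = 0"
      then show "p v \<le> q v + \<delta>" using h(2)[OF u(1) _ u(3), of v] by (force simp: sp)
    qed
    then show ?thesis ..
  qed simp
qed

definition mean :: "real measure \<Rightarrow> real" where "mean \<nu> = (LINT t|\<nu>. t)"
definition var :: "real measure \<Rightarrow> real" where "var \<nu> = (LINT t|\<nu>. t\<^sup>2) - (mean \<nu>)\<^sup>2"

text \<open>With \<open>\<delta>\<close> the difference of the means, one of the two alternatives for \<open>p\<close> and \<open>q + \<delta>\<close> is an inequality between functions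
of equal mean, hence an almost sure equality: one measure is a translate of the other.\<close>
lemma optimal_translate:
  assumes opt: "optimal_measure b R \<mu>" "optimal_measure b R \<nu>" and le: "mean \<nu> \<le> mean \<mu>"
  shows "var \<mu> = var \<nu>" "mean \<mu> = mean \<nu> \<Longrightarrow> \<mu> = \<nu>"
proof -
  have PM: "\<mu> \<in> prob_measures_on b" "\<nu> \<in> prob_measures_on b" using opt by (auto simp: optimal_measure_iff)
  obtain p where p: "p \<in> measurable unit_space (interval_space b)" "mono_on {0<..<1} p" "\<mu> = distr unit_space (interval_space b) p"
    by (rule quantile_representation[OF PM(1)]) (rule that; assumption)
  obtain q where q: "q \<in> measurable unit_space (interval_space b)" "mono_on {0<..<1} q" "\<nu> = distr unit_space (interval_space b) q"
    by (rule quantile_representation[OF PM(2)]) (rule that; assumption)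
  interpret U: prob_space unit_space by (rule prob_space_unit_space)
  have sp: "space unit_space = {0<..<1}" by (simp add: space_restrict_space)
  have pm[measurable]: "p \<in> borel_measurable unit_space" "q \<in> borel_measurable unit_space"
    and range: "\<And>u. u \<in> {0<..<1} \<Longrightarrow> p u \<in> {0..b}" "\<And>u. u \<in> {0<..<1} \<Longrightarrow> q u \<in> {0..b}"
    using p q by (auto simp: measurable_interval_space_iff sp)
  have int: "integrable unit_space p" "integrable unit_space q"
    using range by (auto intro!: U.integrable_const_bound[where B=b] simp: sp)
  have int2: "integrable unit_space (\<lambda>u. (q u)\<^sup>2)"
  proof (rule U.integrable_const_bound[where B="b\<^sup>2"], rule AE_I2)
    fix u assume "u \<in> space unit_space"
    then show "norm ((q u)\<^sup>2) \<le> b\<^sup>2" using range(2)[of u] by (auto simp: sp intro!: power_mono)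
  qed measurable
  have avg: "(LINT t|\<mu>. g t) = (LINT u|unit_space. g (p u))" "(LINT t|\<nu>. g t) = (LINT u|unit_space. g (q u))"
    if "g \<in> borel_measurable borel" for g :: "real \<Rightarrow> real"
    unfolding p(3) q(3) by (intro integral_interval_distr p q measurable_restrict_space1 that)+
  have m: "mean \<mu> = (LINT u|unit_space. p u)" "mean \<nu> = (LINT u|unit_space. q u)"
    unfolding mean_def by (simp_all add: avg)
  define \<delta> where "\<delta> = mean \<mu> - mean \<nu>"
  have "0 \<le> \<delta>" using le by (simp add: \<delta>_def)
  have i0: "(LINT u|unit_space. p u - q u - \<delta>) = 0" "(LINT u|unit_space. q u + \<delta> - p u) = 0"
    using int by (simp_all add: \<delta>_def m U.prob_space[unfolded sp] sp)
  have AE: "AE u in unit_space. p u = q u + \<delta>"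
    using quantiles_do_not_cross[OF opt[unfolded p(3) q(3)] p(1,2) q(1,2) \<open>0 \<le> \<delta>\<close>]
  proof
    assume *: "AE u in unit_space. q u + \<delta> \<le> p u"
    then have nn: "AE u in unit_space. 0 \<le> p u - q u - \<delta>" by eventually_elim simp
    have "integrable unit_space (\<lambda>u. p u - q u - \<delta>)" using int by simp
    from integral_nonneg_eq_0_iff_AE[OF this nn] i0
    have "AE u in unit_space. p u - q u - \<delta> = 0" by simp
    then show ?thesis by eventually_elim simp
  next
    assume *: "AE u in unit_space. p u \<le> q u + \<delta>"
    then have nn: "AE u in unit_space. 0 \<le> q u + \<delta> - p u" by eventually_elim simp
    have "integrable unit_space (\<lambda>u. q u + \<delta> - p u)" using int by simp
    from integral_nonneg_eq_0_iff_AE[OF this nn] i0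
    have "AE u in unit_space. q u + \<delta> - p u = 0" by simp
    then show ?thesis by eventually_elim simp
  qed
  have "(LINT u|unit_space. (p u)\<^sup>2) = (LINT u|unit_space. (q u)\<^sup>2 + 2 * \<delta> * q u + \<delta>\<^sup>2)"
    by (rule integral_cong_AE, measurable) (use AE in \<open>eventually_elim; simp add: power2_eq_square algebra_simps\<close>)
  also have "\<dots> = (LINT u|unit_space. (q u)\<^sup>2) + 2 * \<delta> * mean \<nu> + \<delta>\<^sup>2" using int int2 by (simp add: m U.prob_space[unfolded sp] sp)
  finally show "var \<mu> = var \<nu>"
    by (simp add: var_def avg \<delta>_def power2_eq_square algebra_simps)
  show "\<mu> = \<nu>" if "mean \<mu> = mean \<nu>"
    unfolding p(3) q(3)
  proof (rule distr_cong_AE)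
    show "AE u in unit_space. p u = q u" using AE that by (simp add: \<delta>_def)
  qed (use p q in auto)
qed

text \<open>The midpoint of two optimal measures is optimal, hence has the same variance as both. Its variance exceeds the
average of theirs by \<open>(mean \<mu> - mean \<nu>)\<^sup>2 / 4\<close>.\<close>
theorem optimal_unique:
  assumes opt: "optimal_measure b R \<mu>" "optimal_measure b R \<nu>"
  shows "\<mu> = \<nu>"
proof -
  have PM: "\<mu> \<in> prob_measures_on b" "\<nu> \<in> prob_measures_on b" using opt by (auto simp: optimal_measure_iff)
  obtain \<rho> where \<rho>: "midpoint_measure \<mu> \<nu> \<rho>" using midpoint_measure_exists[OF PM] by blast
  have opt3: "optimal_measure b R \<rho>" by (rule mixture_optimal[OF opt \<rho>])
  have var_eq: "var \<mu>' = var \<nu>'" if "optimal_measure b R \<mu>'" "optimal_measure b R \<nu>'" for \<mu>' \<nu>'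
    using optimal_translate(1)[OF that] optimal_translate(1)[OF that(2,1)] by (cases "mean \<nu>' \<le> mean \<mu>'") auto
  have "mean \<rho> = (mean \<mu> + mean \<nu>) / 2" unfolding mean_def by (rule midpoint_measureD[OF \<rho>, where B=b]) auto
  moreover have "(LINT t|\<rho>. t\<^sup>2) = ((LINT t|\<mu>. t\<^sup>2) + (LINT t|\<nu>. t\<^sup>2)) / 2"
    by (rule midpoint_measureD[OF \<rho>, where B="b\<^sup>2"]) (auto intro: power_mono)
  ultimately have "var \<rho> = (var \<mu> + var \<nu>) / 2 + (mean \<mu> - mean \<nu>)\<^sup>2 / 4"
    unfolding var_def by (simp only:) (simp add: power2_eq_square algebra_simps add_divide_distrib diff_divide_distrib)
  then have "(mean \<mu> - mean \<nu>)\<^sup>2 = 0" using var_eq[OF opt] var_eq[OF opt3 opt(1)] by simp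
  then have "mean \<mu> = mean \<nu>" by simp
  then show ?thesis using optimal_translate(2)[OF opt] by simp
qed

theorem optimal_exists: "\<exists>\<nu>. optimal_measure b R \<nu>"
proof -
  let ?S = "energy R ` prob_measures_on b"
  have ne: "?S \<noteq> {}"
  proof -
    have "(\<lambda>_. 0) \<in> measurable unit_space (interval_space b)"
      unfolding measurable_interval_space_iff using b_pos by auto
    from distr_in_prob_measures_on[OF prob_space_unit_space this] show ?thesis by blast
  qed
  have bdd: "bdd_below ?S"
  proof (rule bdd_belowI)
    fix x assume "x \<in> ?S"
    then obtain \<nu> where \<nu>: "\<nu> \<in> prob_measures_on b" "x = energy R \<nu>" by auto
    have "\<bar>energy R \<nu>\<bar> \<le> C" unfolding energy_def
      by (intro abs_integral_le prob_measures_onD(1)[OF \<nu>(1)] potential_bounded(2)[OF \<nu>(1)])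
    then show "- C \<le> x" using \<nu> by simp
  qed
  have "\<exists>\<nu>\<in>prob_measures_on b. energy R \<nu> < Inf ?S + 1 / real (Suc n)" for n
    using cInf_less_iff[OF ne bdd, of "Inf ?S + 1 / real (Suc n)"] by simp
  then obtain \<nu> where \<nu>: "\<And>n. \<nu> n \<in> prob_measures_on b" "\<And>n. energy R (\<nu> n) < Inf ?S + 1 / real (Suc n)" by metis
  obtain r :: "nat \<Rightarrow> nat" and \<nu>' where r: "strict_mono r" and \<nu>': "\<nu>' \<in> prob_measures_on b"
    and lim: "(\<lambda>n. energy R (\<nu> (r n))) \<longlonglongrightarrow> energy R \<nu>'"
    by (rule prob_measures_on_compact[where \<nu>=\<nu>, OF \<nu>(1)]) (rule that; assumption)
  have "(\<lambda>n. Inf ?S + 1 / real (Suc n)) \<longlonglongrightarrow> Inf ?S"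
    using tendsto_add[OF tendsto_const LIMSEQ_Suc[OF lim_1_over_n], of "Inf ?S"] by simp
  from LIMSEQ_subseq_LIMSEQ[OF this r]
  have "energy R \<nu>' \<le> Inf ?S"
    using \<nu>(2) by (intro LIMSEQ_le[OF lim]) (auto simp: comp_def intro: less_imp_le)
  then have "optimal_measure b R \<nu>'"
    unfolding optimal_measure_iff using \<nu>' cInf_lower[OF _ bdd] by (auto intro: order_trans)
  then show ?thesis ..
qed

end

section \<open>Positive semidefiniteness of the energy\<close>

context gaussian_path
begin

text \<open>Continuous paths are limits of their values at the times rounded down to multiples of \<open>1/n\<close>.\<close>
lemma joint_measurable[measurable]: "(\<lambda>z. X (fst z) (snd z)) \<in> borel_measurable (borel \<Otimes>\<^sub>M M)"
proof -
  define a where "a n t = of_int \<lfloor>real (Suc n) * t\<rfloor> / real (Suc n)" for n and t :: real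
  have "(\<lambda>n. X (a n (fst z)) (snd z)) \<longlonglongrightarrow> X (fst z) (snd z)" if z: "z \<in> space (borel \<Otimes>\<^sub>M M)" for z
  proof -
    have "(\<lambda>n. a n (fst z)) \<longlonglongrightarrow> fst z"
    proof (rule tendsto_sandwich[of "\<lambda>n. fst z - 1 / real (Suc n)" _ _ "\<lambda>_. fst z"])
      have "fst z - 1 / real (Suc n) \<le> a n (fst z)" "a n (fst z) \<le> fst z" for n
      proof -
        define k where "k = real (Suc n)"
        have k: "0 < k" by (simp add: k_def)
        have "(k * fst z - 1) / k \<le> of_int \<lfloor>k * fst z\<rfloor> / k" "of_int \<lfloor>k * fst z\<rfloor> / k \<le> k * fst z / k"
          using k by (intro divide_right_mono; linarith)+
        then show "fst z - 1 / real (Suc n) \<le> a n (fst z)" "a n (fst z) \<le> fst z"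
          unfolding a_def k_def[symmetric] using k by (simp_all add: diff_divide_distrib)
      qed
      then show "\<forall>\<^sub>F n in sequentially. fst z - 1 / real (Suc n) \<le> a n (fst z)"
        "\<forall>\<^sub>F n in sequentially. a n (fst z) \<le> fst z" by simp_all
      show "(\<lambda>n. fst z - 1 / real (Suc n)) \<longlonglongrightarrow> fst z"
        using tendsto_diff[OF tendsto_const LIMSEQ_Suc[OF lim_1_over_n], of "fst z"] by simp
    qed simp
    then show ?thesis
      using z by (intro continuous_on_tendsto_compose[OF paths]) (auto simp: space_pair_measure)
  qed
  moreover have "(\<lambda>z. X (a n (fst z)) (snd z)) \<in> borel_measurable (borel \<Otimes>\<^sub>M M)" for n
  proof -
    have "(\<lambda>z. (\<lambda>k z. X (of_int k / real (Suc n)) (snd z)) \<lfloor>real (Suc n) * fst z\<rfloor> z) \<in> borel_measurable (borel \<Otimes>\<^sub>M M)"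
      by (rule measurable_compose_countable) measurable
    then show ?thesis by (simp add: a_def)
  qed
  ultimately show ?thesis by (rule borel_measurable_LIMSEQ_real)
qed

definition path_average :: "real measure \<Rightarrow> 'w \<Rightarrow> real" where
  "path_average \<nu> \<omega> = (LINT t|\<nu>. X t \<omega>)"

lemma path_average:
  assumes \<nu>: "\<nu> \<in> prob_measures_on b"
  shows "path_average \<nu> \<in> borel_measurable M" "\<omega> \<in> space M \<Longrightarrow> \<bar>path_average \<nu> \<omega>\<bar> \<le> path_sup \<omega>"
    "Z \<in> borel_measurable M \<Longrightarrow> (\<And>\<omega>. \<omega> \<in> space M \<Longrightarrow> \<bar>Z \<omega>\<bar> \<le> path_sup \<omega>) \<Longrightarrow>
      (LINT t|\<nu>. (LINT \<omega>|M. X t \<omega> * Z \<omega>)) = (LINT \<omega>|M. path_average \<nu> \<omega> * Z \<omega>)"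
proof -
  note N = prob_measures_onD[OF \<nu>]
  interpret N: prob_space \<nu> by (rule N)
  interpret NM: pair_prob_space \<nu> M ..
  have idm: "(\<lambda>z. (fst z, snd z)) \<in> measurable (\<nu> \<Otimes>\<^sub>M M) (borel \<Otimes>\<^sub>M M)"
    by (intro measurable_Pair measurable_compose[OF measurable_fst N(6)] measurable_snd)
  have jm[measurable]: "(\<lambda>z. X (fst z) (snd z)) \<in> borel_measurable (\<nu> \<Otimes>\<^sub>M M)"
    using measurable_compose[OF idm joint_measurable] by simp
  have "(\<lambda>z. X (snd z) (fst z)) \<in> borel_measurable (M \<Otimes>\<^sub>M \<nu>)"
    using measurable_compose[OF measurable_pair_swap' jm] by (simp add: case_prod_beta)
  then have "(\<lambda>\<omega>. LINT t|\<nu>. X t \<omega>) \<in> borel_measurable M"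
    by (intro N.borel_measurable_lebesgue_integral) (simp add: case_prod_beta)
  then show "path_average \<nu> \<in> borel_measurable M" unfolding path_average_def .
  show "\<bar>path_average \<nu> \<omega>\<bar> \<le> path_sup \<omega>" if \<omega>: "\<omega> \<in> space M"
  proof -
    have int: "integrable \<nu> (\<lambda>t. X t \<omega>)"
      by (rule N.integrable_const_bound[where B="path_sup \<omega>"])
         (use path_sup_bound(1)[OF \<omega>] N(3) N(5)[OF path_continuous[OF \<omega>]] in auto)
    have "\<bar>path_average \<nu> \<omega>\<bar> \<le> (LINT t|\<nu>. \<bar>X t \<omega>\<bar>)" unfolding path_average_def by (rule integral_abs_bound)
    also have "\<dots> \<le> (LINT t|\<nu>. path_sup \<omega>)"
      using int path_sup_bound(1)[OF \<omega>] N(3) by (intro integral_mono) auto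
    finally show ?thesis by (simp add: N.prob_space)
  qed
  assume Z[measurable]: "Z \<in> borel_measurable M" and Zb: "\<And>\<omega>. \<omega> \<in> space M \<Longrightarrow> \<bar>Z \<omega>\<bar> \<le> path_sup \<omega>"
  have XZ: "\<bar>X t \<omega> * Z \<omega>\<bar> \<le> (path_sup \<omega>)\<^sup>2" if "t \<in> {0..b}" "\<omega> \<in> space M" for t \<omega>
    unfolding abs_mult power2_eq_square using path_sup_bound(1)[OF that(2,1)] Zb[OF that(2)] by (intro mult_mono) auto
  have meas: "(\<lambda>(t, \<omega>). X t \<omega> * Z \<omega>) \<in> borel_measurable (\<nu> \<Otimes>\<^sub>M M)"
  proof -
    have "(\<lambda>z. X (fst z) (snd z) * Z (snd z)) \<in> borel_measurable (\<nu> \<Otimes>\<^sub>M M)" by measurable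
    then show ?thesis by (simp add: case_prod_beta)
  qed
  have intM: "integrable M (\<lambda>\<omega>. X t \<omega> * Z \<omega>)" if "t \<in> {0..b}" for t
    by (rule Bochner_Integration.integrable_bound[OF path_sup_square_integrable]) (use XZ[OF that] in auto)
  have "integrable (\<nu> \<Otimes>\<^sub>M M) (\<lambda>(t, \<omega>). X t \<omega> * Z \<omega>)"
  proof (rule NM.Fubini_integrable[OF meas])
    have "(\<lambda>t. LINT \<omega>|M. norm (X t \<omega> * Z \<omega>)) \<in> borel_measurable \<nu>"
      using meas by (intro borel_measurable_lebesgue_integral) (simp add: case_prod_beta)
    moreover have "(LINT \<omega>|M. norm (X t \<omega> * Z \<omega>)) \<le> (LINT \<omega>|M. (path_sup \<omega>)\<^sup>2)" if "t \<in> {0..b}" for t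
      using XZ[OF that] intM[OF that] path_sup_square_integrable by (intro integral_mono) auto
    ultimately show "integrable \<nu> (\<lambda>t. LINT \<omega>|M. norm (case (t, \<omega>) of (t, \<omega>) \<Rightarrow> X t \<omega> * Z \<omega>))"
      by (intro N.integrable_const_bound[where B="LINT \<omega>|M. (path_sup \<omega>)\<^sup>2"])
         (auto simp: N(3) intro!: AE_I2 integral_nonneg_AE)
    show "AE t in \<nu>. integrable M (\<lambda>\<omega>. case (t, \<omega>) of (t, \<omega>) \<Rightarrow> X t \<omega> * Z \<omega>)"
      using intM by (auto simp: N(3))
  qed
  from NM.Fubini_integral[OF this]
  show "(LINT t|\<nu>. (LINT \<omega>|M. X t \<omega> * Z \<omega>)) = (LINT \<omega>|M. path_average \<nu> \<omega> * Z \<omega>)"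
    by (simp add: path_average_def)
qed

lemma cross_energy:
  assumes \<mu>: "\<mu> \<in> prob_measures_on b" and \<nu>: "\<nu> \<in> prob_measures_on b"
  shows "(LINT t|\<mu>. (LINT s|\<nu>. R (t - s))) = (LINT \<omega>|M. path_average \<mu> \<omega> * path_average \<nu> \<omega>)"
proof -
  have "(LINT s|\<nu>. R (t - s)) = (LINT \<omega>|M. X t \<omega> * path_average \<nu> \<omega>)" if t: "t \<in> {0..b}" for t
    unfolding cov_eq using path_average(3)[OF \<nu> X_measurable path_sup_bound(1)[OF _ t]] by (simp add: mult.commute)
  then have "(LINT t|\<mu>. (LINT s|\<nu>. R (t - s))) = (LINT t|\<mu>. (LINT \<omega>|M. X t \<omega> * path_average \<nu> \<omega>))"
    using prob_measures_onD(3)[OF \<mu>] by (intro Bochner_Integration.integral_cong) auto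
  also have "\<dots> = (LINT \<omega>|M. path_average \<mu> \<omega> * path_average \<nu> \<omega>)"
    by (rule path_average(3)[OF \<mu> path_average(1,2)[OF \<nu>]])
  finally show ?thesis .
qed

text \<open>The energy of \<open>\<mu> - \<nu>\<close> is the second moment of the difference of the path averages.\<close>
theorem covariance_psd:
  assumes \<mu>: "\<mu> \<in> prob_measures_on b" and \<nu>: "\<nu> \<in> prob_measures_on b"
  shows "2 * (LINT t|\<mu>. (LINT s|\<nu>. R (t - s))) \<le> energy R \<mu> + energy R \<nu>"
proof -
  note [measurable] = path_average(1)[OF \<mu>] path_average(1)[OF \<nu>]
  have int: "integrable M (\<lambda>\<omega>. f \<omega> * g \<omega>)"
    if [measurable]: "f \<in> borel_measurable M" "g \<in> borel_measurable M"
      and le: "\<And>\<omega>. \<omega> \<in> space M \<Longrightarrow> \<bar>f \<omega>\<bar> \<le> path_sup \<omega>" "\<And>\<omega>. \<omega> \<in> space M \<Longrightarrow> \<bar>g \<omega>\<bar> \<le> path_sup \<omega>" for f g :: "'w \<Rightarrow> real"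
  proof (rule Bochner_Integration.integrable_bound[OF path_sup_square_integrable], measurable, rule AE_I2)
    fix \<omega> assume "\<omega> \<in> space M"
    then show "norm (f \<omega> * g \<omega>) \<le> norm ((path_sup \<omega>)\<^sup>2)"
      using le path_sup_bound(3) by (auto simp: abs_mult power2_eq_square intro!: mult_mono)
  qed
  let ?f = "path_average \<mu>" and ?g = "path_average \<nu>"
  note b = path_average(2)[OF \<mu>] path_average(2)[OF \<nu>]
  have "0 \<le> (LINT \<omega>|M. (?f \<omega> - ?g \<omega>)\<^sup>2)" by (rule integral_nonneg_AE) auto
  also have "\<dots> = (LINT \<omega>|M. ?f \<omega> * ?f \<omega> - 2 * (?f \<omega> * ?g \<omega>) + ?g \<omega> * ?g \<omega>)"
    by (simp add: power2_eq_square algebra_simps)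
  also have "\<dots> = (LINT \<omega>|M. ?f \<omega> * ?f \<omega>) - 2 * (LINT \<omega>|M. ?f \<omega> * ?g \<omega>) + (LINT \<omega>|M. ?g \<omega> * ?g \<omega>)"
    using int[of ?f ?f] int[of ?f ?g] int[of ?g ?g] b by simp
  finally show ?thesis unfolding energy_def cross_energy[OF \<mu> \<nu>] cross_energy[OF \<mu> \<mu>] cross_energy[OF \<nu> \<nu>] by simp
qed

end

section \<open>Convergence of the conditional law of the minimizer\<close>

locale convex_gaussian_path = gaussian_path +
  assumes convex: "strictly_convex_on {0..b} R"
begin

lemma R0_pos: "0 < R 0"
proof (rule ccontr)
  assume "\<not> 0 < R 0"
  then have "R t = 0" for t using R_abs_le[of t] by linarith
  moreover have "R ((1 - 1/2) * 0 + 1/2 * b) < (1 - 1/2) * R 0 + 1/2 * R b"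
  proof -
    have "\<forall>x\<in>{0..b}. \<forall>y\<in>{0..b}. \<forall>c. x \<noteq> y \<and> 0 < c \<and> c < 1 \<longrightarrow>
        R ((1 - c) * x + c * y) < (1 - c) * R x + c * R y"
      using convex unfolding strictly_convex_on_def by blast
    from this[rule_format, of 0 b "1/2"] b_pos show ?thesis by auto
  qed
  ultimately show False by simp
qed

sublocale K: psd_energy_kernel b R "R 0"
proof (unfold_locales, rule b_pos, rule R_continuous, rule R_abs_le, rule R_sym, rule convex)
  interpret energy_kernel b R "R 0"
    by unfold_locales (rule b_pos, rule R_continuous, rule R_abs_le, rule R_sym, rule convex)
  fix \<mu> \<nu> assume "\<mu> \<in> prob_measures_on b" "\<nu> \<in> prob_measures_on b"
  then show "2 * cross \<mu> \<nu> \<le> energy R \<mu> + energy R \<nu>"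
    unfolding cross_def by (rule covariance_psd)
qed

lemma weighted_integrable:
  assumes s: "s \<in> {0..b}"
  shows "integrable M (\<lambda>\<omega>. X s \<omega> * max 0 (path_min \<omega> - v))"
proof (rule Bochner_Integration.integrable_bound)
  show "integrable M (\<lambda>\<omega>. (path_sup \<omega>)\<^sup>2 + \<bar>v\<bar> * path_sup \<omega>)" using path_sup_square_integrable path_sup_integrable by simp
  show "AE \<omega> in M. norm (X s \<omega> * max 0 (path_min \<omega> - v)) \<le> norm ((path_sup \<omega>)\<^sup>2 + \<bar>v\<bar> * path_sup \<omega>)"
  proof (rule AE_I2)
    fix \<omega> assume \<omega>: "\<omega> \<in> space M"
    have "\<bar>X s \<omega>\<bar> * \<bar>max 0 (path_min \<omega> - v)\<bar> \<le> path_sup \<omega> * (path_sup \<omega> + \<bar>v\<bar>)"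
      using path_sup_bound(1)[OF \<omega> s] path_sup_bound(3,4)[OF \<omega>] by (intro mult_mono) auto
    also have "\<dots> = (path_sup \<omega>)\<^sup>2 + \<bar>v\<bar> * path_sup \<omega>" by (simp add: power2_eq_square algebra_simps)
    also have "\<dots> \<le> \<bar>(path_sup \<omega>)\<^sup>2 + \<bar>v\<bar> * path_sup \<omega>\<bar>" by (rule abs_ge_self)
    finally show "norm (X s \<omega> * max 0 (path_min \<omega> - v)) \<le> norm ((path_sup \<omega>)\<^sup>2 + \<bar>v\<bar> * path_sup \<omega>)"
      by (simp only: real_norm_def abs_mult)
  qed
qed measurable

lemma weighted_ge:
  assumes s: "s \<in> {0..b}"
  shows "v * excess v \<le> (LINT \<omega>|M. X s \<omega> * max 0 (path_min \<omega> - v))"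
proof -
  have "v * excess v = (LINT \<omega>|M. v * max 0 (path_min \<omega> - v))" by (simp add: excess_def)
  also have "\<dots> \<le> (LINT \<omega>|M. X s \<omega> * max 0 (path_min \<omega> - v))"
  proof (rule integral_mono)
    show "integrable M (\<lambda>\<omega>. v * max 0 (path_min \<omega> - v))" using excess_integrable by simp
    fix \<omega> assume \<omega>: "\<omega> \<in> space M"
    show "v * max 0 (path_min \<omega> - v) \<le> X s \<omega> * max 0 (path_min \<omega> - v)"
      using path_min_attained(2)[OF \<omega> s] by (cases "v < path_min \<omega>") (auto intro!: mult_right_mono)
  qed (rule weighted_integrable[OF s])
  finally show ?thesis .
qed

lemma min_tail_integral: "integrable M (\<lambda>\<omega>. indicator {v<..} (path_min \<omega>) :: real)" "(LINT \<omega>|M. indicator {v<..} (path_min \<omega>)) = min_tail v"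
proof -
  show "integrable M (\<lambda>\<omega>. indicator {v<..} (path_min \<omega>) :: real)"
    by (rule integrable_const_bound[where B=1]) auto
  have "(LINT \<omega>|M. indicator {v<..} (path_min \<omega>)) = (LINT \<omega>|M. indicator (exceed_event M X b v) \<omega> :: real)"
    by (intro Bochner_Integration.integral_cong) (auto simp: exceed_event_def indicator_def)
  then show "(LINT \<omega>|M. indicator {v<..} (path_min \<omega>)) = min_tail v" by (simp add: min_tail_def)
qed

text \<open>Integration by parts at time \<open>0\<close>, with \<open>R \<le> R(0)\<close> on one side and \<open>X\<^sub>0 \<ge> v\<close> on the exceedance event on the other.\<close>
lemma excess_le: "v * excess v \<le> R 0 * min_tail v"
proof -
  have 0: "0 \<in> {0..b}" using b_pos by simp
  have "v * excess v \<le> (LINT \<omega>|M. R (argmin_time \<omega> - 0) * indicator {v<..} (path_min \<omega>))"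
    using weighted_ge[OF 0] integration_by_parts[OF R0_pos 0] by simp
  also have "\<dots> \<le> (LINT \<omega>|M. R 0 * indicator {v<..} (path_min \<omega>))"
  proof (rule integral_mono)
    show "integrable M (\<lambda>\<omega>. R (argmin_time \<omega> - 0) * indicator {v<..} (path_min \<omega>))"
      by (rule integrable_const_bound[where B="R 0"]) (use R_abs_le R0_pos in \<open>auto simp: indicator_def\<close>)
    show "R (argmin_time \<omega> - 0) * indicator {v<..} (path_min \<omega>) \<le> R 0 * indicator {v<..} (path_min \<omega>)" for \<omega>
      using R_abs_le[of "argmin_time \<omega> - 0"] by (intro mult_right_mono) auto
  qed (use min_tail_integral in simp)
  finally show ?thesis by (simp add: min_tail_integral)
qed

end

locale exceeding_gaussian_path = convex_gaussian_path +
  assumes exceed: "\<And>u. 0 < measure M (exceed_event M X b u)"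
begin

lemma min_tail_pos: "0 < min_tail v" using exceed by (simp add: min_tail_def)

abbreviation argmin_law :: "real \<Rightarrow> real measure" where "argmin_law v \<equiv> cond_argmin_law M X b v"

lemma argmin_law_in: "argmin_law v \<in> prob_measures_on b"
  unfolding cond_argmin_law_def
proof (rule distr_in_prob_measures_on)
  show "prob_space (uniform_measure M (exceed_event M X b v))"
    using exceed[of v] by (intro prob_space_uniform_measure) (auto simp: emeasure_eq_measure)
  show "argmin_time \<in> measurable (uniform_measure M (exceed_event M X b v)) (interval_space b)"
    unfolding measurable_interval_space_iff using argmin_time_correct(1) by auto
qed

lemma argmin_law_integral:
  assumes [measurable]: "f \<in> borel_measurable borel"
  shows "(LINT t|argmin_law v. f t) = (LINT \<omega>|M. f (argmin_time \<omega>) * indicator {v<..} (path_min \<omega>)) / min_tail v"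
proof -
  have m: "argmin_time \<in> measurable (uniform_measure M (exceed_event M X b v)) (interval_space b)"
    unfolding measurable_interval_space_iff using argmin_time_correct(1) by auto
  have u: "uniform_measure M (exceed_event M X b v) = density M (\<lambda>\<omega>. ennreal (indicator (exceed_event M X b v) \<omega> / min_tail v))"
    unfolding uniform_measure_def using min_tail_pos[of v]
    by (intro density_cong) (auto simp: emeasure_eq_measure min_tail_def[symmetric] divide_ennreal indicator_def simp flip: ennreal_1)
  have "(LINT t|argmin_law v. f t) = (LINT \<omega>|uniform_measure M (exceed_event M X b v). f (argmin_time \<omega>))"
    unfolding cond_argmin_law_def by (rule integral_interval_distr[OF m]) (rule measurable_restrict_space1, measurable)
  also have "\<dots> = (LINT \<omega>|M. (indicator (exceed_event M X b v) \<omega> / min_tail v) * f (argmin_time \<omega>))"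
    unfolding u using min_tail_pos[of v] by (subst integral_density) auto
  also have "\<dots> = (LINT \<omega>|M. (f (argmin_time \<omega>) * indicator {v<..} (path_min \<omega>)) / min_tail v)"
    by (intro Bochner_Integration.integral_cong) (auto simp: exceed_event_def indicator_def)
  finally show ?thesis by simp
qed

lemma argmin_law_potential:
  assumes t: "t \<in> {0..b}"
  shows "(LINT s|argmin_law v. R (t - s)) = (LINT \<omega>|M. X t \<omega> * max 0 (path_min \<omega> - v)) / min_tail v"
proof -
  have "R (t - x) = R (x - t)" for x using R_sym[of "t - x"] by simp
  then show ?thesis
    using argmin_law_integral[of "\<lambda>s. R (t - s)" v] by (simp add: integration_by_parts[OF R0_pos t])
qed

text \<open>The potential of the conditional law is at least \<open>v A(v) / p(v)\<close> at every time, since the path exceeds \<open>v\<close> there.\<close>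
lemma cross_law_ge:
  assumes \<nu>: "\<nu> \<in> prob_measures_on b"
  shows "v * excess v / min_tail v \<le> K.cross \<nu> (argmin_law v)"
proof -
  interpret N: prob_space \<nu> by (rule prob_measures_onD[OF \<nu>])
  have "v * excess v / min_tail v = (LINT t|\<nu>. v * excess v / min_tail v)" by (simp add: N.prob_space)
  also have "\<dots> \<le> K.cross \<nu> (argmin_law v)"
    unfolding K.cross_def
  proof (rule integral_mono)
    show "integrable \<nu> (\<lambda>t. LINT s|argmin_law v. R (t - s))"
      by (rule K.bounded_integrable_interval[OF \<nu> K.potential_bounded[OF argmin_law_in]])
    fix t assume "t \<in> space \<nu>"
    then have t: "t \<in> {0..b}" by (simp add: prob_measures_onD(3)[OF \<nu>])
    show "v * excess v / min_tail v \<le> (LINT s|argmin_law v. R (t - s))"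
      unfolding argmin_law_potential[OF t] using weighted_ge[OF t] min_tail_pos by (intro divide_right_mono) (auto intro: less_imp_le)
  qed simp
  finally show ?thesis .
qed

text \<open>Integrating the potential of the conditional law against that law itself leads to an independent copy \<open>X'\<close>
evaluated at the minimizer \<open>T\<close> of \<open>X\<close>, where \<open>X'(T) \<le> min X + \<parallel>X' - X\<parallel>\<close>. The first summand on the right comes from
\<open>min X\<close>, the rest bounds the contribution of the distance.\<close>
lemma energy_law_le:
  assumes \<delta>: "0 \<le> \<delta>" and B: "0 \<le> B"
    "(\<integral>\<^sup>+\<omega>. ennreal (path_sup \<omega>) * indicator {\<delta> / sqrt 2<..} (path_sup \<omega>) \<partial>M) \<le> ennreal B"
  shows "energy R (argmin_law v) * (min_tail v)\<^sup>2 \<le>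
    excess v * (excess v + v * min_tail v) + (\<delta> * min_tail v * excess v + 2 * excess (sqrt 2 * v) * B)"
proof -
  let ?I = "\<lambda>\<omega>. indicator {v<..} (path_min \<omega>) :: real"
  let ?m = "\<lambda>\<omega>. max 0 (path_min \<omega> - v)"
  define G where "G t = (LINT \<omega>|M. X t \<omega> * ?m \<omega>)" for t
  define pot where "pot t = (LINT s|argmin_law v. R (t - s))" for t
  have pot: "pot \<in> borel_measurable borel" "\<And>t. \<bar>pot t\<bar> \<le> R 0"
    using K.potential_bounded[OF argmin_law_in] by (simp_all add: pot_def[abs_def])
  note [measurable] = pot(1)
  have G: "G t = min_tail v * pot t" if "t \<in> {0..b}" for t
    using min_tail_pos[of v] by (simp add: G_def pot_def argmin_law_potential[OF that])
  have GE: "energy R (argmin_law v) * (min_tail v)\<^sup>2 = (LINT \<omega>|M. min_tail v * (pot (argmin_time \<omega>) * ?I \<omega>))"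
    using argmin_law_integral[OF pot(1), of v] min_tail_pos[of v] by (simp add: energy_def pot_def[symmetric] power2_eq_square)
  \<comment> \<open>the contribution of the distance of the two copies, to which \<open>discrepancy_bound\<close> applies\<close>
  define F where "F z = ?I (fst z) * ?m (snd z) * path_gap z" for z
  have dif0: "0 \<le> path_gap z" if "z \<in> space MM" for z
    using path_norm_bound(3)[OF path_continuous2[OF that, of "- 1" 1] b_nonneg] .
  have F0: "0 \<le> F z" if "z \<in> space MM" for z using dif0[OF that] by (auto simp: F_def)
  have [measurable]: "F \<in> borel_measurable MM" unfolding F_def by measurable
  let ?bound = "\<delta> * min_tail v * excess v + 2 * excess (sqrt 2 * v) * B"
  have bound0: "0 \<le> ?bound" using \<delta> B(1) excess_nn(2) min_tail_pos[of v] by simp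
  have F_nn: "(\<integral>\<^sup>+z. ennreal (F z) \<partial>MM) \<le> ennreal ?bound"
  proof -
    have "(\<integral>\<^sup>+z. ennreal (F z) \<partial>MM)
      = (\<integral>\<^sup>+z. indicator {v<..} (path_min (fst z)) * ennreal (?m (snd z)) * ennreal (path_gap z) \<partial>MM)"
    proof (rule nn_integral_cong)
      fix z assume z: "z \<in> space MM"
      have "ennreal (?m (snd z) * path_gap z) = ennreal (?m (snd z)) * ennreal (path_gap z)"
        by (intro ennreal_mult dif0[OF z] max.cobounded1)
      then show "ennreal (F z) = indicator {v<..} (path_min (fst z)) * ennreal (?m (snd z)) * ennreal (path_gap z)"
        by (cases "v < path_min (fst z)") (simp_all add: F_def)
    qed
    also have "\<dots> \<le> ennreal (\<delta> * min_tail v * excess v) + ennreal (2 * excess (sqrt 2 * v)) * ennreal B"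
      by (rule order_trans[OF discrepancy_bound[OF \<delta>]]) (intro add_left_mono mult_left_mono B; simp)
    also have "\<dots> = ennreal ?bound"
      using \<delta> B(1) excess_nn(2) min_tail_pos[of v] by (simp add: ennreal_mult[symmetric] ennreal_plus[symmetric] del: ennreal_plus)
    finally show ?thesis .
  qed
  have F_int: "integrable MM F"
    using F_nn by (intro integrableI_nonneg) (auto intro!: AE_I2 F0 simp: le_less_trans[OF F_nn])
  have F_le: "(LINT z|MM. F z) \<le> ?bound"
    using F_nn bound0 F0 by (subst integral_eq_nn_integral) (auto intro!: AE_I2 enn2real_leI)
  define W where "W \<omega> = (LINT \<omega>'|M. F (\<omega>, \<omega>'))" for \<omega>
  have W: "integrable M W" "(LINT \<omega>|M. W \<omega>) = (LINT z|MM. F z)"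
    unfolding W_def using P.integrable_fst'[OF F_int] P.integral_fst'[OF F_int] by simp_all
  have lowI: "path_min \<omega> * ?I \<omega> = ?m \<omega> + v * ?I \<omega>" for \<omega> by (simp add: indicator_def max_def)
  have low_int: "integrable M (\<lambda>\<omega>. path_min \<omega> * ?I \<omega>)"
    unfolding lowI using excess_integrable min_tail_integral by simp
  have low_eq': "(LINT \<omega>|M. path_min \<omega> * ?I \<omega>) = excess v + v * min_tail v"
    unfolding lowI using excess_integrable min_tail_integral by (simp add: excess_def)
  have "AE \<omega> in M. min_tail v * (pot (argmin_time \<omega>) * ?I \<omega>) \<le> path_min \<omega> * ?I \<omega> * excess v + W \<omega>"
    using P.AE_integrable_fst'[OF F_int] AE_space
  proof eventually_elim
    case (elim \<omega>)
    let ?T = "argmin_time \<omega>"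
    have T: "?T \<in> {0..b}" "X ?T \<omega> = path_min \<omega>" using argmin_time_correct[OF elim(2)] by auto
    show ?case
    proof (cases "v < path_min \<omega>")
      case True
      have "G ?T \<le> (LINT \<omega>'|M. path_min \<omega> * ?m \<omega>' + F (\<omega>, \<omega>'))"
        unfolding G_def
      proof (rule integral_mono[OF weighted_integrable[OF T(1)]])
        show "integrable M (\<lambda>\<omega>'. path_min \<omega> * ?m \<omega>' + F (\<omega>, \<omega>'))" using elim(1) excess_integrable by simp
        fix \<omega>' assume \<omega>': "\<omega>' \<in> space M"
        then have z: "(\<omega>, \<omega>') \<in> space MM" using elim(2) by (simp add: space_pair_measure)
        have "X ?T \<omega>' \<le> X ?T \<omega> + path_gap (\<omega>, \<omega>')"
          using path_norm_bound(1)[OF path_continuous2[OF z, of "- 1" 1] b_nonneg T(1)] by simp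
        then have "X ?T \<omega>' * ?m \<omega>' \<le> (path_min \<omega> + path_gap (\<omega>, \<omega>')) * ?m \<omega>'"
          unfolding T(2) by (intro mult_right_mono) auto
        then show "X ?T \<omega>' * ?m \<omega>' \<le> path_min \<omega> * ?m \<omega>' + F (\<omega>, \<omega>')"
          using True by (simp add: F_def algebra_simps)
      qed
      also have "\<dots> = path_min \<omega> * excess v + W \<omega>"
        using elim(1) excess_integrable by (simp add: W_def excess_def)
      finally show ?thesis using True G[OF T(1)] by simp
    next
      case False
      then have "W \<omega> = 0" by (simp add: W_def F_def)
      then show ?thesis using False by simp
    qed
  qed
  moreover have "integrable M (\<lambda>\<omega>. min_tail v * (pot (argmin_time \<omega>) * ?I \<omega>))"
    using pot(2) R0_pos by (intro integrable_mult_right integrable_const_bound[where B="R 0"]) (auto simp: indicator_def)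
  ultimately have "energy R (argmin_law v) * (min_tail v)\<^sup>2 \<le> (LINT \<omega>|M. path_min \<omega> * ?I \<omega> * excess v + W \<omega>)"
    unfolding GE using low_int W by (intro integral_mono_AE) auto
  also have "\<dots> = (excess v + v * min_tail v) * excess v + (LINT z|MM. F z)"
    using low_int W low_eq' by simp
  finally show ?thesis using F_le by (simp add: mult.commute)
qed

text \<open>With \<open>a = A(v)/p(v) \<le> R(0)/v\<close> the previous bounds give \<open>e(\<nu>\<^sub>v) \<le> v a + a\<^sup>2 + \<delta> v a\<close> plus the Gaussian tail term; each of the last
three is at most \<open>\<epsilon>/3\<close> for large \<open>v\<close>, and \<open>v a \<le> K(\<nu>,\<nu>\<^sub>v)\<close>.\<close>
lemma energy_law_asymptotic:
  assumes \<epsilon>: "0 < \<epsilon>"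
  shows "\<forall>\<^sub>F v in at_top. \<forall>\<nu>\<in>prob_measures_on b. energy R (argmin_law v) \<le> K.cross \<nu> (argmin_law v) + \<epsilon>"
proof -
  obtain \<gamma> C where \<gamma>: "0 < \<gamma>" and C: "0 \<le> C" and tl: "\<And>t. 0 \<le> t \<Longrightarrow>
      (\<integral>\<^sup>+\<omega>. ennreal (path_sup \<omega>) * indicator {t<..} (path_sup \<omega>) \<partial>M) \<le> ennreal (C * exp (- \<gamma> * t\<^sup>2))"
    using path_sup_tail by auto
  define \<delta> where "\<delta> = \<epsilon> / (3 * R 0)"
  have \<delta>: "0 < \<delta>" "\<delta> * R 0 = \<epsilon> / 3" using \<epsilon> R0_pos by (auto simp: \<delta>_def)
  \<comment> \<open>half of the rate \<open>\<gamma>\<delta>\<^sup>2/2\<close> of the Gaussian tail at \<open>\<delta>v/\<surd>2\<close>; the other half remains after paying for the growth of \<open>p\<close>\<close>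
  define \<kappa> where "\<kappa> = \<gamma> * \<delta>\<^sup>2 / 4"
  have \<kappa>: "0 < \<kappa>" using \<gamma> \<delta> by (simp add: \<kappa>_def)
  have growth: "\<forall>\<^sub>F v in at_top. min_tail (sqrt 2 * v) \<le> exp (\<kappa> * v\<^sup>2) * (min_tail v)\<^sup>2"
    by (rule supermultiplicative_square_growth[OF min_tail_pos _ min_tail_antimono min_tail_mult \<kappa>]) (simp_all add: min_tail_def)
  have main: "energy R (argmin_law v) \<le> K.cross \<nu> (argmin_law v) + \<epsilon>"
    if gr: "min_tail (sqrt 2 * v) \<le> exp (\<kappa> * v\<^sup>2) * (min_tail v)\<^sup>2" and v: "1 \<le> v" "3 * (R 0)\<^sup>2 / \<epsilon> \<le> v" "6 * R 0 * C / (\<kappa> * \<epsilon>) \<le> v"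
      and \<nu>: "\<nu> \<in> prob_measures_on b" for v \<nu>
  proof -
    define a where "a = excess v / min_tail v"
    define B where "B = C * exp (- 2 * \<kappa> * v\<^sup>2)"
    have B: "0 \<le> B" "(\<integral>\<^sup>+\<omega>. ennreal (path_sup \<omega>) * indicator {\<delta> * v / sqrt 2<..} (path_sup \<omega>) \<partial>M) \<le> ennreal B"
    proof -
      show "0 \<le> B" using C by (simp add: B_def)
      have "\<gamma> * (\<delta> * v / sqrt 2)\<^sup>2 = 2 * \<kappa> * v\<^sup>2" by (simp add: \<kappa>_def power_divide power_mult_distrib)
      then show "(\<integral>\<^sup>+\<omega>. ennreal (path_sup \<omega>) * indicator {\<delta> * v / sqrt 2<..} (path_sup \<omega>) \<partial>M) \<le> ennreal B"
        using tl[of "\<delta> * v / sqrt 2"] \<delta> v by (simp add: B_def)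
    qed
    have tp: "0 < min_tail v" by (rule min_tail_pos)
    have a: "0 \<le> a" "v * a \<le> R 0" "v * excess v / min_tail v = v * a"
      using excess_nn(2)[of v] excess_le[of v] tp by (auto simp: a_def field_simps)
    have v2: "v \<le> v\<^sup>2" using v by (simp add: power2_eq_square)
    have sq: "a\<^sup>2 \<le> \<epsilon> / 3"
    proof -
      have "v * a\<^sup>2 \<le> v\<^sup>2 * a\<^sup>2" using v2 by (intro mult_right_mono) auto
      also have "\<dots> = (v * a)\<^sup>2" by (simp add: power_mult_distrib)
      also have "\<dots> \<le> (R 0)\<^sup>2" using a v by (intro power_mono) auto
      also have "\<dots> \<le> v * (\<epsilon> / 3)" using v(2) \<epsilon> by (simp add: field_simps)
      finally show ?thesis using v by simp
    qed
    have third: "2 * excess (sqrt 2 * v) * B / (min_tail v)\<^sup>2 \<le> \<epsilon> / 3"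
    proof -
      have s1: "1 \<le> sqrt 2 * v" using v mult_mono[of 1 "sqrt 2" 1 v] by simp
      have "1 * excess (sqrt 2 * v) \<le> sqrt 2 * v * excess (sqrt 2 * v)" using s1 excess_nn(2) by (intro mult_right_mono) auto
      also have "\<dots> \<le> R 0 * min_tail (sqrt 2 * v)" by (rule excess_le)
      also have "\<dots> \<le> R 0 * (exp (\<kappa> * v\<^sup>2) * (min_tail v)\<^sup>2)" using gr R0_pos by simp
      finally have "2 * excess (sqrt 2 * v) * B \<le> 2 * (R 0 * (exp (\<kappa> * v\<^sup>2) * (min_tail v)\<^sup>2)) * B"
        using B(1) by (intro mult_right_mono mult_left_mono) auto
      also have "\<dots> = 2 * R 0 * C * exp (- (\<kappa> * v\<^sup>2)) * (min_tail v)\<^sup>2"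
        by (simp add: B_def exp_add[symmetric])
      finally have 1: "2 * excess (sqrt 2 * v) * B / (min_tail v)\<^sup>2 \<le> 2 * R 0 * C * exp (- (\<kappa> * v\<^sup>2))"
        using tp by (simp add: field_simps)
      have kv: "0 < \<kappa> * v" using \<kappa> v by simp
      have "\<kappa> * v \<le> \<kappa> * v\<^sup>2" using v2 \<kappa> by simp
      also have "\<dots> \<le> exp (\<kappa> * v\<^sup>2)" using exp_ge_add_one_self[of "\<kappa> * v\<^sup>2"] by linarith
      finally have "exp (- (\<kappa> * v\<^sup>2)) \<le> 1 / (\<kappa> * v)"
        using kv by (simp add: exp_minus inverse_eq_divide frac_le)
      then have "2 * R 0 * C * exp (- (\<kappa> * v\<^sup>2)) \<le> 2 * R 0 * C * (1 / (\<kappa> * v))"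
        using R0_pos C by (intro mult_left_mono) auto
      also have "\<dots> \<le> \<epsilon> / 3" using v(1,3) \<kappa> \<epsilon> by (simp add: field_simps)
      finally show ?thesis using 1 by linarith
    qed
    have "energy R (argmin_law v) \<le> (excess v * (excess v + v * min_tail v) + (\<delta> * v * min_tail v * excess v + 2 * excess (sqrt 2 * v) * B)) / (min_tail v)\<^sup>2"
      using energy_law_le[OF _ B, of v] \<delta> v tp by (simp add: pos_le_divide_eq)
    also have "\<dots> = a\<^sup>2 + v * a + \<delta> * (v * a) + 2 * excess (sqrt 2 * v) * B / (min_tail v)\<^sup>2"
      using tp by (simp add: a_def field_simps power2_eq_square)
    also have "\<delta> * (v * a) \<le> \<epsilon> / 3" using mult_left_mono[OF a(2), of \<delta>] \<delta> by simp
    also have "v * a \<le> K.cross \<nu> (argmin_law v)" using cross_law_ge[OF \<nu>, of v] a(3) by simp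
    finally show ?thesis using sq third by simp
  qed
  show ?thesis
    using growth eventually_ge_at_top[of 1] eventually_ge_at_top[of "3 * (R 0)\<^sup>2 / \<epsilon>"]
      eventually_ge_at_top[of "6 * R 0 * C / (\<kappa> * \<epsilon>)"]
    by eventually_elim (intro ballI main)
qed

text \<open>In the limit, \<open>e(\<nu>') \<le> K(\<mu>,\<nu>') \<le> (e(\<mu>) + e(\<nu>'))/2\<close> for every \<open>\<mu>\<close>, that is \<open>e(\<nu>') \<le> e(\<mu>)\<close>.\<close>
lemma optimal_subsequential_limit:
  assumes u: "filterlim u at_top sequentially"
  obtains r :: "nat \<Rightarrow> nat" and \<nu> where "strict_mono r" "optimal_measure b R \<nu>"
    "\<And>f. continuous_on {0..b} f \<Longrightarrow> (\<lambda>n. LINT t|argmin_law (u (r n)). f t) \<longlonglongrightarrow> (LINT t|\<nu>. f t :: real)"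
proof -
  obtain r :: "nat \<Rightarrow> nat" and \<nu> where r: "strict_mono r" and \<nu>: "\<nu> \<in> prob_measures_on b"
    and lim: "\<And>f. continuous_on {0..b} f \<Longrightarrow> (\<lambda>n. LINT t|argmin_law (u (r n)). f t) \<longlonglongrightarrow> (LINT t|\<nu>. f t :: real)"
    and elim: "(\<lambda>n. energy R (argmin_law (u (r n)))) \<longlonglongrightarrow> energy R \<nu>"
    by (rule K.prob_measures_on_compact[where \<nu>="\<lambda>n. argmin_law (u n)", OF argmin_law_in]) (rule that; assumption)
  have ur: "filterlim (\<lambda>n. u (r n)) at_top sequentially"
    using filterlim_compose[OF u filterlim_subseq[OF r]] .
  have "energy R \<nu> \<le> energy R \<mu>" if \<mu>: "\<mu> \<in> prob_measures_on b" for \<mu>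
  proof -
    have clim: "(\<lambda>n. K.cross \<mu> (argmin_law (u (r n)))) \<longlonglongrightarrow> K.cross \<mu> \<nu>"
      unfolding K.cross_def
    proof (rule integral_dominated_convergence[where w="\<lambda>_. R 0"])
      interpret N: prob_space \<mu> by (rule prob_measures_onD[OF \<mu>])
      show "integrable \<mu> (\<lambda>_. R 0)" by simp
      show "AE t in \<mu>. (\<lambda>n. LINT s|argmin_law (u (r n)). R (t - s)) \<longlonglongrightarrow> (LINT s|\<nu>. R (t - s))"
        by (intro AE_I2 lim continuous_on_compose2[OF R_continuous] continuous_intros) auto
      show "AE t in \<mu>. norm (LINT s|argmin_law (u (r n)). R (t - s)) \<le> R 0" for n
        using K.potential_bounded(2)[OF argmin_law_in] by simp
    qed (intro prob_measures_onD(4)[OF \<mu>] K.potential_bounded argmin_law_in \<nu>)+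
    have "energy R \<nu> \<le> K.cross \<mu> \<nu>"
    proof (rule field_le_epsilon)
      fix \<epsilon> :: real assume "0 < \<epsilon>"
      from filterlim_iff[THEN iffD1, OF ur, rule_format, OF energy_law_asymptotic[OF this]]
      have ev: "\<forall>\<^sub>F n in sequentially. energy R (argmin_law (u (r n))) \<le> K.cross \<mu> (argmin_law (u (r n))) + \<epsilon>"
        by (rule eventually_mono) (use \<mu> in blast)
      show "energy R \<nu> \<le> K.cross \<mu> \<nu> + \<epsilon>"
        by (rule tendsto_le[OF _ tendsto_add[OF clim tendsto_const] elim ev]) simp
    qed
    then show ?thesis using K.psd[OF \<mu> \<nu>] by simp
  qed
  then have "optimal_measure b R \<nu>" using \<nu> by (simp add: K.optimal_measure_iff)
  from that[OF r this lim] show thesis .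
qed

theorem argmin_law_converges:
  assumes \<nu>: "optimal_measure b R \<nu>"
  shows "weakly_converges_on b argmin_law \<nu>"
  unfolding weakly_converges_on_def
proof (intro allI impI)
  fix f :: "real \<Rightarrow> real" assume f: "continuous_on {0..b} f"
  show "((\<lambda>u. LINT t|argmin_law u. f t) \<longlongrightarrow> (LINT t|\<nu>. f t)) at_top"
  proof (rule tendsto_at_topI_sequentially)
    fix u :: "nat \<Rightarrow> real" assume u: "filterlim u at_top sequentially"
    show "(\<lambda>n. LINT t|argmin_law (u n). f t) \<longlonglongrightarrow> (LINT t|\<nu>. f t)"
    proof (rule tendstoI, rule ccontr)
      fix e :: real assume e: "0 < e" and "\<not> (\<forall>\<^sub>F n in sequentially. dist (LINT t|argmin_law (u n). f t) (LINT t|\<nu>. f t) < e)"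
      then obtain s :: "nat \<Rightarrow> nat" where s: "strict_mono s"
        and far: "\<And>n. \<not> dist (LINT t|argmin_law (u (s n)). f t) (LINT t|\<nu>. f t) < e"
        using not_eventually_sequentiallyD by blast
      have "filterlim (\<lambda>n. u (s n)) at_top sequentially" using filterlim_compose[OF u filterlim_subseq[OF s]] .
      then obtain r :: "nat \<Rightarrow> nat" and \<nu>' where r: "optimal_measure b R \<nu>'"
        "\<And>f. continuous_on {0..b} f \<Longrightarrow> (\<lambda>n. LINT t|argmin_law (u (s (r n))). f t) \<longlonglongrightarrow> (LINT t|\<nu>'. f t :: real)"
        by (rule optimal_subsequential_limit) (rule that; assumption)
      have "\<nu>' = \<nu>" by (rule K.optimal_unique[OF r(1) \<nu>])
      from tendstoD[OF r(2)[OF f] e] obtain n where "dist (LINT t|argmin_law (u (s (r n))). f t) (LINT t|\<nu>. f t) < e"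
        unfolding \<open>\<nu>' = \<nu>\<close> by (auto dest: eventually_happens)
      then show False using far by blast
    qed
  qed
qed

end

theorem theorem4p1:
  fixes M :: "'w measure" and X :: "real \<Rightarrow> 'w \<Rightarrow> real" and R :: "real \<Rightarrow> real" and b :: real
  assumes "b > 0"
    and "gaussian_process M X"
    and "centered_process M X"
    and "stationary_process M X"
    and "\<And>\<omega>. \<omega> \<in> space M \<Longrightarrow> continuous_on UNIV (\<lambda>t. X t \<omega>)"
    and "\<And>s t. R t = (LINT \<omega>|M. X s \<omega> * X (s + t) \<omega>)"
    and "strictly_convex_on {0..b} R"
  shows "(\<exists>!\<nu>. optimal_measure b R \<nu>) \<and>
    ((\<forall>u. measure M (exceed_event M X b u) > 0) \<longrightarrow>
      (\<forall>\<nu>. optimal_measure b R \<nu> \<longrightarrow> weakly_converges_on b (cond_argmin_law M X b) \<nu>))"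
proof -
  interpret prob_space M using assms(2) by (simp add: gaussian_process_def)
  interpret convex_gaussian_path M X R b
    by unfold_locales (fact assms)+
  show ?thesis
  proof (intro conjI impI allI)
    show "\<exists>!\<nu>. optimal_measure b R \<nu>" using K.optimal_exists K.optimal_unique by blast
    fix \<nu> assume exceed: "\<forall>u. measure M (exceed_event M X b u) > 0" and \<nu>: "optimal_measure b R \<nu>"
    interpret exceeding_gaussian_path M X R b by unfold_locales (use exceed in blast)
    show "weakly_converges_on b (cond_argmin_law M X b) \<nu>" by (rule argmin_law_converges[OF \<nu>])
  qed
qed

end
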